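(* Let $\Phi$ be a field of characteristic $0$. The Grassmann $(-1,1)$-algebra $G_{(-1,1)}$ over $\Phi$ has a base formed by the elements $$(x^2)^I x^{\varepsilon}\otimes e_{j_1}e_{j_2}\cdots e_{j_n},\qquad j_1<j_2<\cdots<j_n,\quad I\in\mathbb Z_+^{\infty},\ \varepsilon\in\{0,1\},\ \varepsilon+|I|>0,\quad n=\deg\big((x^2)^Ix^{\varepsilon}\big).$$
   Context: $(x,y,z)=(xy)z-x(yz)$. A $(-1,1)$-algebra is an algebra satisfying $(x,y,y)=0$ and $(x,y,z)+(y,z,x)+(z,x,y)=0$. $G=G_0\oplus G_1$ is the associative unital Grassmann algebra with generators $e_1,e_2,\dots$, $e_ie_j=-e_je_i$. The Grassmann envelope of a superalgebra $X=X_0\oplus X_1$ is $G(X)=X_0\otimes G_0\oplus X_1\otimes G_1$, and $X$ is a $(-1,1)$-superalgebra if $G(X)$ is a $(-1,1)$-algebra. Let $F=F_{(-1,1)}[\emptyset;x]$ be the free $(-1,1)$-superalgebra over $\Phi$ on one odd generator $x$ (no even generators). $G_{(-1,1)}$ is the subalgebra of $G(F)$ generated by the elements $x\otimes e_i$, $i=1,2,\dots$. $\mathbb Z_+$ is the set of nonnegative integers and $\mathbb Z_+^\infty$ the set of finite sequences of elements of $\mathbb Z_+$ (sequences differing only by trailing zeros give the same element and are identified). For an even element $a$, $aR_{x,x}=(ax)x-ax^2=(a,x,x)$, and for $I=(i_0,i_1,\dots,i_k)\in\mathbb Z_+^\infty$, $$a^I=a^{i_0}(aR_{x,x})^{i_1}(aR_{x,x}^2)^{i_2}\cdots(aR_{x,x}^k)^{i_k},\qquad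 |I|=i_0+\dots+i_k.$$ (The even part of $F$ is associative and commutative, so $(x^2)^I$ is well defined; when $\varepsilon=0$ the factor $x^\varepsilon$ is omitted, and when $|I|=0$ the factor $(x^2)^I$ is omitted.) $\deg$ is the degree in $x$. *)

theory Defs
  imports Complex_Main "HOL-Library.Poly_Mapping" "HOL-Library.FSet"
begin

section \<open>Nonassociative algebras\<close>

locale nonassoc_algebra = vector_space scale
  for scale :: "'k::field \<Rightarrow> 'a::ab_group_add \<Rightarrow> 'a" +
  fixes mul :: "'a \<Rightarrow> 'a \<Rightarrow> 'a"
  assumes mul_add_left: "mul (x + y) z = mul x z + mul y z"
    and mul_add_right: "mul x (y + z) = mul x y + mul x z"
    and mul_scale_left: "mul (scale c x) y = scale c (mul x y)"
    and mul_scale_right: "mul x (scale c y) = scale c (mul x y)"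
begin

lemma mul_zero_left [simp]: "mul 0 y = 0"
  using mul_scale_left[of 0 0 y] by simp

lemma mul_zero_right [simp]: "mul x 0 = 0"
  using mul_scale_right[of x 0 0] by simp

lemma mul_minus_left: "mul (- x) y = - mul x y"
  using mul_scale_left[of "-1" x y] by simp

lemma mul_minus_right: "mul x (- y) = - mul x y"
  using mul_scale_right[of x "-1" y] by simp

lemma mul_diff_left: "mul (x - y) z = mul x z - mul y z"
  using mul_add_left[of x "- y" z] by (simp add: mul_minus_left)

lemma mul_diff_right: "mul x (y - z) = mul x y - mul x z"
  using mul_add_right[of x y "- z"] by (simp add: mul_minus_right)

lemma mul_sum_left: "mul (sum f A) y = (\<Sum>i\<in>A. mul (f i) y)"
  by (induction A rule: infinite_finite_induct) (simp_all add: mul_add_left)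

lemma mul_sum_right: "mul x (sum f A) = (\<Sum>i\<in>A. mul x (f i))"
  by (induction A rule: infinite_finite_induct) (simp_all add: mul_add_right)

definition subalgebra :: "'a set \<Rightarrow> bool" where
  "subalgebra B \<longleftrightarrow> subspace B \<and> (\<forall>x\<in>B. \<forall>y\<in>B. mul x y \<in> B)"

definition generated_subalgebra :: "'a set \<Rightarrow> 'a set" where
  "generated_subalgebra S = subalgebra hull S"

end

definition (in vector_space) basis_family :: "('i \<Rightarrow> 'b) \<Rightarrow> 'i set \<Rightarrow> 'b set \<Rightarrow> bool" where
  "basis_family b A V \<longleftrightarrow> inj_on b A \<and> independent (b ` A) \<and> span (b ` A) = V"

definition associator :: "('a::ab_group_add \<Rightarrow> 'a \<Rightarrow> 'a) \<Rightarrow> 'a \<Rightarrow> 'a \<Rightarrow> 'a \<Rightarrow> 'a" where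
  "associator mul x y z = mul (mul x y) z - mul x (mul y z)"

definition minus_one_one_on :: "('a::ab_group_add \<Rightarrow> 'a \<Rightarrow> 'a) \<Rightarrow> 'a set \<Rightarrow> bool" where
  "minus_one_one_on mul A \<longleftrightarrow>
     (\<forall>x\<in>A. \<forall>y\<in>A. associator mul x y y = 0) \<and>
     (\<forall>x\<in>A. \<forall>y\<in>A. \<forall>z\<in>A.
        associator mul x y z + associator mul y z x + associator mul z x y = 0)"


section \<open>Finitely supported functions\<close>

alias lookup = Poly_Mapping.lookup
alias keys = Poly_Mapping.keys
alias single = Poly_Mapping.single

definition coeff_scale ::
  "('k \<Rightarrow> 'a \<Rightarrow> 'a) \<Rightarrow> 'k \<Rightarrow> ('i \<Rightarrow>\<^sub>0 'a) \<Rightarrow> ('i \<Rightarrow>\<^sub>0 'a::zero)" where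
  "coeff_scale scale c u = Poly_Mapping.map (scale c) u"

definition lin_ext ::
  "('i \<Rightarrow> 'a \<Rightarrow> 'c) \<Rightarrow> ('i \<Rightarrow>\<^sub>0 'a::zero) \<Rightarrow> 'c::comm_monoid_add" where
  "lin_ext h u = (\<Sum>i\<in>keys u. h i (lookup u i))"

definition bilin_ext ::
  "('i \<Rightarrow> 'j \<Rightarrow> 'a \<Rightarrow> 'b \<Rightarrow> 'c) \<Rightarrow> ('i \<Rightarrow>\<^sub>0 'a::zero) \<Rightarrow> ('j \<Rightarrow>\<^sub>0 'b::zero) \<Rightarrow> 'c::comm_monoid_add" where
  "bilin_ext h u v = (\<Sum>i\<in>keys u. \<Sum>j\<in>keys v. h i j (lookup u i) (lookup v j))"

lemma lookup_map_zero: "f 0 = 0 \<Longrightarrow> lookup (Poly_Mapping.map f u) i = f (lookup u i)"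
  by (simp add: Poly_Mapping.map.rep_eq when_def)

lemma lin_ext_superset:
  assumes "finite A" "keys u \<subseteq> A" "\<And>i. h i 0 = 0"
  shows "lin_ext h u = (\<Sum>i\<in>A. h i (lookup u i))"
  unfolding lin_ext_def
  by (rule sum.mono_neutral_left) (use assms in \<open>auto simp: in_keys_iff\<close>)

lemma lin_ext_add:
  assumes "\<And>i. h i 0 = 0" "\<And>i a b. h i (a + b) = h i a + h i b"
  shows "lin_ext h (u + v) = lin_ext h u + lin_ext h v"
proof -
  let ?A = "keys u \<union> keys v"
  have "lin_ext h (u + v) = (\<Sum>i\<in>?A. h i (lookup (u + v) i))"
    by (rule lin_ext_superset) (use assms(1) Poly_Mapping.keys_add[of u v] in auto)
  also have "\<dots> = (\<Sum>i\<in>?A. h i (lookup u i)) + (\<Sum>i\<in>?A. h i (lookup v i))"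
    by (simp add: lookup_add assms sum.distrib)
  also have "\<dots> = lin_ext h u + lin_ext h v"
    by (subst (1 2) lin_ext_superset[where A = ?A]) (use assms in auto)
  finally show ?thesis .
qed

lemma lin_ext_map:
  assumes "\<And>i. h i 0 = 0" "f 0 = 0"
  shows "lin_ext h (Poly_Mapping.map f u) = lin_ext (\<lambda>i a. h i (f a)) u"
proof -
  have "lin_ext h (Poly_Mapping.map f u) = (\<Sum>i\<in>keys u. h i (lookup (Poly_Mapping.map f u) i))"
    by (rule lin_ext_superset) (use assms in \<open>auto simp: in_keys_iff lookup_map_zero\<close>)
  then show ?thesis by (simp add: lin_ext_def lookup_map_zero[of f, OF assms(2)])
qed

lemma lin_ext_coeff_scale:
  assumes "\<And>i. h i 0 = 0" "scale c 0 = 0"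
  shows "lin_ext h (coeff_scale scale c u) = lin_ext (\<lambda>i a. h i (scale c a)) u"
  unfolding coeff_scale_def by (rule lin_ext_map) (use assms in auto)

lemma lin_ext_single: "h i 0 = 0 \<Longrightarrow> lin_ext h (single i a) = h i a"
  by (simp add: lin_ext_def)

lemma bilin_ext_lin_ext: "bilin_ext h u v = lin_ext (\<lambda>i a. lin_ext (\<lambda>j b. h i j a b) v) u"
  by (simp add: bilin_ext_def lin_ext_def)

lemma bilin_ext_lin_ext': "bilin_ext h u v = lin_ext (\<lambda>j b. lin_ext (\<lambda>i a. h i j a b) u) v"
  unfolding bilin_ext_def lin_ext_def by (rule sum.swap)

lemma poly_mapping_sum_single: "(\<Sum>i\<in>keys u. single i (lookup u i)) = u"
proof (rule poly_mapping_eqI)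
  fix j
  have "lookup (\<Sum>i\<in>keys u. single i (lookup u i)) j
      = (\<Sum>i\<in>keys u. if i = j then lookup u i else 0)"
    by (simp add: lookup_sum lookup_single when_def)
  then show "lookup (\<Sum>i\<in>keys u. single i (lookup u i)) j = lookup u j"
    by (simp add: in_keys_iff)
qed


section \<open>The Grassmann algebra\<close>

text \<open>
  The finite set \<open>S = {s\<^sub>1 < \<dots> < s\<^sub>m}\<close> stands for the basis word \<open>e\<^bsub>s\<^sub>1\<^esub>\<dots>e\<^bsub>s\<^sub>m\<^esub>\<close>.  Sorting the
  concatenation of the words of \<open>S\<close> and \<open>T\<close> costs one sign for every pair \<open>s \<in> S\<close>, \<open>t \<in> T\<close> with
  \<open>t < s\<close>.  The generators are numbered from \<open>0\<close>.
\<close>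

type_synonym 'k grassmann = "nat fset \<Rightarrow>\<^sub>0 'k"

definition inversions :: "nat fset \<Rightarrow> nat fset \<Rightarrow> nat" where
  "inversions S T = card {(s, t). s |\<in>| S \<and> t |\<in>| T \<and> t < s}"

definition gword_mul :: "nat fset \<Rightarrow> nat fset \<Rightarrow> 'k::field grassmann" where
  "gword_mul S T =
     (if S |\<inter>| T = {||} then single (S |\<union>| T) ((- 1) ^ inversions S T) else 0)"

definition gmul :: "'k::field grassmann \<Rightarrow> 'k grassmann \<Rightarrow> 'k grassmann" where
  "gmul g h = bilin_ext (\<lambda>S T a b. coeff_scale (*) (a * b) (gword_mul S T)) g h"

definition gone :: "'k::field grassmann" where
  "gone = single {||} 1"

definition ggen :: "nat \<Rightarrow> 'k::field grassmann" where
  "ggen i = single {|i|} 1"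

definition gprod_list :: "'k::field grassmann list \<Rightarrow> 'k grassmann" where
  "gprod_list gs = foldr gmul gs gone"

definition geven :: "'k::field grassmann set" where
  "geven = {g. \<forall>S\<in>keys g. even (fcard S)}"

definition godd :: "'k::field grassmann set" where
  "godd = {g. \<forall>S\<in>keys g. odd (fcard S)}"


section \<open>Tensor product with the Grassmann algebra\<close>

text \<open>
  Since the words form a basis of \<open>G\<close>, every element of \<open>X \<otimes> G\<close> is uniquely a finite sum of
  terms \<open>x\<^sub>S \<otimes> e\<^sub>S\<close>; we represent it by the function \<open>S \<mapsto> x\<^sub>S\<close>.
\<close>

definition tensor :: "('k::field \<Rightarrow> 'a \<Rightarrow> 'a) \<Rightarrow> 'a \<Rightarrow> 'k grassmann \<Rightarrow> (nat fset \<Rightarrow>\<^sub>0 'a::ab_group_add)"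
  where "tensor scale x g = Poly_Mapping.map (\<lambda>c. scale c x) g"

definition tensor_mul ::
  "('k::field \<Rightarrow> 'a \<Rightarrow> 'a) \<Rightarrow> ('a \<Rightarrow> 'a \<Rightarrow> 'a) \<Rightarrow>
   (nat fset \<Rightarrow>\<^sub>0 'a) \<Rightarrow> (nat fset \<Rightarrow>\<^sub>0 'a) \<Rightarrow> (nat fset \<Rightarrow>\<^sub>0 'a::ab_group_add)" where
  "tensor_mul scale mul u v = bilin_ext (\<lambda>S T x y. tensor scale (mul x y) (gword_mul S T)) u v"

lemma gmul_eq_tensor_mul: "(gmul :: 'k::field grassmann \<Rightarrow> _) = tensor_mul (*) (*)"
proof -
  have *: "Poly_Mapping.map ((*) c) u = Poly_Mapping.map (\<lambda>x. x * c) u" for c and u :: "'k grassmann"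
    by (rule poly_mapping_eqI) (simp add: lookup_map_zero)
  show ?thesis
    unfolding fun_eq_iff gmul_def tensor_mul_def tensor_def coeff_scale_def * by simp
qed

lemma field_nonassoc_algebra: "nonassoc_algebra ((*) :: 'k::field \<Rightarrow> _) (*)"
  by unfold_locales (auto simp: algebra_simps)

lemma (in vector_space) vector_space_coeff_scale: "vector_space (coeff_scale scale)"
  by unfold_locales
    (auto intro!: poly_mapping_eqI simp: coeff_scale_def lookup_map_zero lookup_add
      scale_right_distrib scale_left_distrib)

context nonassoc_algebra
begin

lemma lookup_tensor: "lookup (tensor scale x g) S = scale (lookup g S) x"
  by (simp add: tensor_def lookup_map_zero)

lemma tensor_add_left: "tensor scale (x + y) g = tensor scale x g + tensor scale y g"
  and tensor_add_right: "tensor scale x (g + h) = tensor scale x g + tensor scale x h"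
  and tensor_scale_left: "tensor scale (scale c x) g = coeff_scale scale c (tensor scale x g)"
  and tensor_scale_right:
    "tensor scale x (coeff_scale (*) c g) = coeff_scale scale c (tensor scale x g)"
  and tensor_zero_left [simp]: "tensor scale 0 g = 0"
  and tensor_zero_right [simp]: "tensor scale x 0 = 0"
  by (rule poly_mapping_eqI; simp add: lookup_tensor lookup_add coeff_scale_def lookup_map_zero
      scale_right_distrib scale_left_distrib mult.commute)+

lemma tensor_mul_add_left:
  "tensor_mul scale mul (u + v) w = tensor_mul scale mul u w + tensor_mul scale mul v w"
  unfolding tensor_mul_def bilin_ext_lin_ext
  by (subst lin_ext_add) (simp_all add: lin_ext_def mul_add_left tensor_add_left sum.distrib)

lemma tensor_mul_add_right:
  "tensor_mul scale mul w (u + v) = tensor_mul scale mul w u + tensor_mul scale mul w v"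
  unfolding tensor_mul_def bilin_ext_lin_ext'
  by (subst lin_ext_add) (simp_all add: lin_ext_def mul_add_right tensor_add_left sum.distrib)

sublocale T: vector_space "coeff_scale scale"
  by (rule vector_space_coeff_scale)

lemma tensor_mul_scale_left:
  "tensor_mul scale mul (coeff_scale scale c u) v = coeff_scale scale c (tensor_mul scale mul u v)"
  unfolding tensor_mul_def bilin_ext_lin_ext
  by (subst lin_ext_coeff_scale)
    (simp_all add: lin_ext_def mul_scale_left tensor_scale_left T.scale_sum_right)

lemma tensor_mul_scale_right:
  "tensor_mul scale mul u (coeff_scale scale c v) = coeff_scale scale c (tensor_mul scale mul u v)"
  unfolding tensor_mul_def bilin_ext_lin_ext'
  by (subst lin_ext_coeff_scale)
    (simp_all add: lin_ext_def mul_scale_right tensor_scale_left T.scale_sum_right)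

lemma nonassoc_algebra_tensor: "nonassoc_algebra (coeff_scale scale) (tensor_mul scale mul)"
  by unfold_locales
    (simp_all add: tensor_mul_add_left tensor_mul_add_right tensor_mul_scale_left
      tensor_mul_scale_right)

lemma tensor_single: "tensor scale x (single S c) = single S (scale c x)"
  by (rule poly_mapping_eqI) (simp add: lookup_tensor lookup_single when_def)

lemma tensor_mul_tensor:
  "tensor_mul scale mul (tensor scale x g) (tensor scale y h) = tensor scale (mul x y) (gmul g h)"
proof -
  have *: "tensor scale x (sum f A) = (\<Sum>i\<in>A. tensor scale x (f i))" for x and f :: "'i \<Rightarrow> _" and A
    by (induction A rule: infinite_finite_induct) (simp_all add: tensor_add_right)
  have "tensor_mul scale mul (tensor scale x g) (tensor scale y h) =
     lin_ext (\<lambda>S a. lin_ext (\<lambda>T b.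
        tensor scale (mul (scale a x) (scale b y)) (gword_mul S T)) h) g"
    unfolding tensor_mul_def bilin_ext_lin_ext
    by (subst (2) tensor_def, subst lin_ext_map, simp add: lin_ext_def, simp,
        subst (2) tensor_def, subst lin_ext_map) simp_all
  also have "\<dots> = tensor scale (mul x y) (gmul g h)"
    by (simp add: gmul_def bilin_ext_def lin_ext_def * mul_scale_left mul_scale_right
        tensor_scale_left tensor_scale_right)
      (simp add: coeff_scale_def mult.commute)
  finally show ?thesis .
qed

end

text \<open>The model of the Grassmann algebra is associative and unital, its generators anticommute,
  and an increasing product of generators is the corresponding basis word.\<close>

interpretation grassmann: nonassoc_algebra "coeff_scale ((*) :: 'k::field \<Rightarrow> _)" gmul
  unfolding gmul_eq_tensor_mul
  by (rule nonassoc_algebra.nonassoc_algebra_tensor[OF field_nonassoc_algebra])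

lemma coeff_scale_single: "scale c 0 = 0 \<Longrightarrow> coeff_scale scale c (single S a) = single S (scale c a)"
  by (rule poly_mapping_eqI) (simp add: coeff_scale_def lookup_map_zero lookup_single when_def)

lemma coeff_scale_zero [simp]: "coeff_scale scale c 0 = 0"
  by (rule poly_mapping_eqI) (simp add: coeff_scale_def Poly_Mapping.map.rep_eq)

lemma gmul_single: "gmul (single S a) (single T b) = coeff_scale (*) (a * b) (gword_mul S T)"
  by (cases "a = 0 \<or> b = 0")
    (auto simp: gmul_def bilin_ext_def simp del: grassmann.scale_scale)

lemma gmul_single': "gmul (single S a) (single T b) =
    (if S |\<inter>| T = {||} then single (S |\<union>| T) (a * b * (- 1) ^ inversions S T) else 0)"
  by (simp add: gmul_single gword_mul_def coeff_scale_single)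

lemma finite_inversions: "finite {(s, t). s |\<in>| S \<and> t |\<in>| T \<and> t < s}"
  by (rule finite_subset[of _ "fset S \<times> fset T"]) auto

lemma inversions_union_left:
  assumes "S |\<inter>| T = {||}"
  shows "inversions (S |\<union>| T) U = inversions S U + inversions T U"
  unfolding inversions_def
  by (subst card_Un_disjoint[symmetric])
    (use assms in \<open>auto simp: finite_inversions intro!: arg_cong[where f = card]\<close>)

lemma inversions_union_right:
  assumes "T |\<inter>| U = {||}"
  shows "inversions S (T |\<union>| U) = inversions S T + inversions S U"
  unfolding inversions_def
  by (subst card_Un_disjoint[symmetric])
    (use assms in \<open>auto simp: finite_inversions intro!: arg_cong[where f = card]\<close>)

lemma gmul_assoc_single:
  "gmul (gmul (single S a) (single T b)) (single U c) =
   gmul (single S a) (gmul (single T b) (single U c))"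
proof (cases "S |\<inter>| T = {||} \<and> T |\<inter>| U = {||} \<and> S |\<inter>| U = {||}")
  case True
  then have "(S |\<union>| T) |\<inter>| U = {||}" "S |\<inter>| (T |\<union>| U) = {||}" by auto
  with True show ?thesis
    by (simp add: gmul_single' inversions_union_left inversions_union_right power_add ac_simps
        funion_assoc)
next
  case False
  then show ?thesis
    by (auto simp: gmul_single')
qed

lemma gmul_assoc: "gmul (gmul f g) h = gmul f (gmul g h)"
  by (subst (1 2) poly_mapping_sum_single[of f, symmetric],
      subst (1 2) poly_mapping_sum_single[of g, symmetric],
      subst (1 2) poly_mapping_sum_single[of h, symmetric])
    (simp only: grassmann.mul_sum_left grassmann.mul_sum_right gmul_assoc_single)

lemma gmul_one_left: "gmul gone g = g"
proof -
  have *: "gmul gone (single S a) = single S a" for S and a :: 'a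
    by (simp add: gone_def gmul_single' inversions_def)
  show ?thesis
    by (subst (1 2) poly_mapping_sum_single[of g, symmetric])
      (simp only: grassmann.mul_sum_right *)
qed

lemma gmul_one_right: "gmul g gone = g"
proof -
  have *: "gmul (single S a) gone = single S a" for S and a :: 'a
    by (simp add: gone_def gmul_single' inversions_def)
  show ?thesis
    by (subst (1 2) poly_mapping_sum_single[of g, symmetric])
      (simp only: grassmann.mul_sum_left *)
qed

lemma inversions_singleton_left: "(\<forall>t. t |\<in>| T \<longrightarrow> i < t) \<Longrightarrow> inversions {|i|} T = 0"
proof -
  assume "\<forall>t. t |\<in>| T \<longrightarrow> i < t"
  then have "{(s, t). s |\<in>| {|i|} \<and> t |\<in>| T \<and> t < s} = {}" by fastforce
  then show ?thesis unfolding inversions_def by (simp only: card.empty)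
qed

lemma ggen_anticommute: "gmul (ggen i) (ggen j) = - gmul (ggen j) (ggen i)"
proof -
  have 1: "inversions {|i|} {|j|} = 1" if "j < i" for i j :: nat
  proof -
    have "{(s, t). s |\<in>| {|i|} \<and> t |\<in>| {|j|} \<and> t < s} = {(i, j)}" using that by auto
    then show ?thesis by (simp add: inversions_def)
  qed
  have 0: "inversions {|i|} {|j|} = 0" if "i < j" for i j :: nat
    using that by (simp add: inversions_singleton_left)
  show ?thesis
    by (cases i j rule: linorder_cases)
      (auto simp: ggen_def gmul_single' 0 1 finsert_commute single_uminus)
qed

lemma gprod_list_ggen:
  "sorted_wrt (<) js \<Longrightarrow> gprod_list (map ggen js) = single (fset_of_list js) 1"
proof (induction js)
  case (Cons j js)
  then have "\<forall>t. t |\<in>| fset_of_list js \<longrightarrow> j < t" by (auto simp: fset_of_list_elem)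
  then have "{|j|} |\<inter>| fset_of_list js = {||}" "inversions {|j|} (fset_of_list js) = 0"
    by (auto simp: inversions_singleton_left)
  with Cons show ?case
    by (simp add: gprod_list_def ggen_def gmul_single')
qed (simp add: gprod_list_def gone_def)


section \<open>Superalgebras and Grassmann envelopes\<close>

locale superalgebra = nonassoc_algebra scale mul
  for scale :: "'k::field \<Rightarrow> 'a::ab_group_add \<Rightarrow> 'a" and mul :: "'a \<Rightarrow> 'a \<Rightarrow> 'a" +
  fixes X0 X1 :: "'a set"
  assumes subspace_even: "subspace X0" and subspace_odd: "subspace X1"
    and even_odd_disjoint: "X0 \<inter> X1 = {0}"
    and even_odd_sum: "\<exists>a\<in>X0. \<exists>b\<in>X1. x = a + b"
    and mul_even_even: "a \<in> X0 \<Longrightarrow> b \<in> X0 \<Longrightarrow> mul a b \<in> X0"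
    and mul_even_odd: "a \<in> X0 \<Longrightarrow> b \<in> X1 \<Longrightarrow> mul a b \<in> X1"
    and mul_odd_even: "a \<in> X1 \<Longrightarrow> b \<in> X0 \<Longrightarrow> mul a b \<in> X1"
    and mul_odd_odd: "a \<in> X1 \<Longrightarrow> b \<in> X1 \<Longrightarrow> mul a b \<in> X0"
begin

definition envelope :: "(nat fset \<Rightarrow>\<^sub>0 'a) set" where
  "envelope = module.span (coeff_scale scale)
     ({tensor scale x g | x g. x \<in> X0 \<and> g \<in> geven} \<union>
      {tensor scale x g | x g. x \<in> X1 \<and> g \<in> godd})"

abbreviation part :: "nat fset \<Rightarrow> 'a set" where
  "part S \<equiv> if even (fcard S) then X0 else X1"

lemma subspace_part: "subspace (part S)"
  by (simp add: subspace_even subspace_odd)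

lemma envelope_iff: "u \<in> envelope \<longleftrightarrow> (\<forall>S. lookup u S \<in> part S)"
proof
  assume "u \<in> envelope"
  then show "\<forall>S. lookup u S \<in> part S"
    unfolding envelope_def
  proof (induction u rule: T.span_induct)
    case base
    show ?case
      unfolding T.subspace_def
      using subspace_even subspace_odd
      by (auto simp: lookup_add coeff_scale_def lookup_map_zero subspace_def)
  next
    case (step u)
    then obtain x g where u: "u = tensor scale x g"
      and or: "x \<in> X0 \<and> g \<in> geven \<or> x \<in> X1 \<and> g \<in> godd" by blast
    have "scale (lookup g S) x \<in> part S" for S
    proof (cases "S \<in> keys g")
      case True
      with or show ?thesis
        using subspace_scale[OF subspace_even] subspace_scale[OF subspace_odd]
        by (auto simp: geven_def godd_def)
    qed (use subspace_0[OF subspace_part[of S]] in \<open>simp add: in_keys_iff\<close>)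
    then show ?case by (simp add: u lookup_tensor)
  qed
next
  assume *: "\<forall>S. lookup u S \<in> part S"
  have "single S (lookup u S) \<in> envelope" for S
  proof -
    have eq: "single S (lookup u S) = tensor scale (lookup u S) (single S 1)"
      by (simp add: tensor_single)
    have "lookup u S \<in> X0 \<and> single S (1::'k) \<in> geven \<or> lookup u S \<in> X1 \<and> single S (1::'k) \<in> godd"
      using *[rule_format, of S] by (auto simp: geven_def godd_def split: if_splits)
    then show ?thesis
      unfolding envelope_def eq by (intro T.span_base) blast
  qed
  then have "(\<Sum>S\<in>keys u. single S (lookup u S)) \<in> envelope"
    unfolding envelope_def by (rule T.span_sum)
  then show "u \<in> envelope" by (simp add: poly_mapping_sum_single)
qed

lemma subspace_envelope: "T.subspace envelope"
  by (simp add: envelope_def)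

lemma envelope_subalgebra:
  "nonassoc_algebra.subalgebra (coeff_scale scale) (tensor_mul scale mul) envelope"
proof -
  interpret E: nonassoc_algebra "coeff_scale scale" "tensor_mul scale mul"
    by (rule nonassoc_algebra_tensor)
  have "tensor_mul scale mul u v \<in> envelope" if "u \<in> envelope" "v \<in> envelope" for u v
  proof -
    have "tensor scale (mul (lookup u S) (lookup v T)) (gword_mul S T) \<in> envelope" for S T
    proof (cases "S |\<inter>| T = {||}")
      case True
      then have disjoint: "fset S \<inter> fset T = {}"
        by (metis bot_fset.rep_eq inf_fset.rep_eq)
      then have card: "fcard (S |\<union>| T) = fcard S + fcard T"
        by (simp add: fcard.rep_eq card_Un_disjoint disjoint)
      have "lookup u S \<in> part S" "lookup v T \<in> part T"
        using that by (simp_all only: envelope_iff)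
      then have "mul (lookup u S) (lookup v T) \<in> part (S |\<union>| T)"
        by (cases "even (fcard S)"; cases "even (fcard T)")
          (simp_all add: card mul_even_even mul_even_odd mul_odd_even mul_odd_odd)
      then have scaled: "scale c (mul (lookup u S) (lookup v T)) \<in> part (S |\<union>| T)" for c
        by (rule subspace_scale[OF subspace_part])
      have "lookup (single (S |\<union>| T) (scale c (mul (lookup u S) (lookup v T)))) R \<in> part R" for c R
      proof (cases "R = S |\<union>| T")
        case True
        then show ?thesis using scaled[of c] by (simp only: lookup_single_eq)
      next
        case False
        then have "lookup (single (S |\<union>| T) (scale c (mul (lookup u S) (lookup v T)))) R = 0"
          by (simp add: lookup_single when_def)
        then show ?thesis using subspace_0[OF subspace_part[of R]] by (simp only:)
      qed
      then show ?thesis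
        unfolding envelope_iff by (simp only: gword_mul_def tensor_single True if_True simp_thms)
    next
      case False
      then show ?thesis
        by (simp add: gword_mul_def T.subspace_0 subspace_envelope)
    qed
    then show ?thesis
      unfolding tensor_mul_def bilin_ext_def
      by (intro T.subspace_sum) (simp_all add: envelope_def)
  qed
  then show ?thesis
    unfolding E.subalgebra_def by (simp add: envelope_def)
qed

end

locale minus_one_one_superalgebra = superalgebra +
  assumes envelope_minus_one_one: "minus_one_one_on (tensor_mul scale mul) envelope"


locale algebra_hom = A: nonassoc_algebra s1 m1 + B: nonassoc_algebra s2 m2 + Vector_Spaces.linear s1 s2 \<phi>
  for s1 :: "'k::field \<Rightarrow> 'a::ab_group_add \<Rightarrow> 'a" and m1
    and s2 :: "'k \<Rightarrow> 'b::ab_group_add \<Rightarrow> 'b" and m2 and \<phi> +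
  assumes hom_mul: "\<phi> (m1 x y) = m2 (\<phi> x) (\<phi> y)"
begin

lemma lookup_map_hom: "lookup (Poly_Mapping.map \<phi> u) S = \<phi> (lookup u S)"
  by (rule lookup_map_zero) (rule zero)

lemma map_add: "Poly_Mapping.map \<phi> (u + v) = Poly_Mapping.map \<phi> u + Poly_Mapping.map \<phi> v"
  and map_diff: "Poly_Mapping.map \<phi> (u - v) = Poly_Mapping.map \<phi> u - Poly_Mapping.map \<phi> v"
  and map_tensor: "Poly_Mapping.map \<phi> (tensor s1 x g) = tensor s2 (\<phi> x) g"
  by (rule poly_mapping_eqI;
      simp add: lookup_map_hom lookup_add lookup_minus add diff scale A.lookup_tensor B.lookup_tensor)+

lemma map_sum: "Poly_Mapping.map \<phi> (sum f I) = (\<Sum>i\<in>I. Poly_Mapping.map \<phi> (f i))"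
  by (induction I rule: infinite_finite_induct)
    (auto simp: map_add intro!: poly_mapping_eqI simp: lookup_map_hom zero)

lemma map_tensor_mul:
  "Poly_Mapping.map \<phi> (tensor_mul s1 m1 u v) =
   tensor_mul s2 m2 (Poly_Mapping.map \<phi> u) (Poly_Mapping.map \<phi> v)"
proof -
  have "tensor_mul s2 m2 (Poly_Mapping.map \<phi> u) (Poly_Mapping.map \<phi> v) =
     lin_ext (\<lambda>S a. lin_ext (\<lambda>T b. tensor s2 (m2 (\<phi> a) (\<phi> b)) (gword_mul S T)) v) u"
    unfolding tensor_mul_def bilin_ext_lin_ext
    by (subst lin_ext_map, simp add: lin_ext_def, rule zero, subst lin_ext_map) (simp_all add: zero)
  then show ?thesis
    by (simp add: tensor_mul_def bilin_ext_def lin_ext_def map_sum map_tensor hom_mul)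
qed

lemma map_associator:
  "Poly_Mapping.map \<phi> (associator (tensor_mul s1 m1) u v w) =
   associator (tensor_mul s2 m2) (Poly_Mapping.map \<phi> u) (Poly_Mapping.map \<phi> v) (Poly_Mapping.map \<phi> w)"
  by (simp add: associator_def map_diff map_tensor_mul)

end


section \<open>The free nonassociative superalgebra on one odd generator\<close>

datatype monomial = Gen | Prod monomial monomial

primrec mdeg :: "monomial \<Rightarrow> nat" where
  "mdeg Gen = 1"
| "mdeg (Prod s t) = mdeg s + mdeg t"

type_synonym 'k freena = "monomial \<Rightarrow>\<^sub>0 'k"

definition freena_mul :: "'k::field freena \<Rightarrow> 'k freena \<Rightarrow> 'k freena" where
  "freena_mul f g = bilin_ext (\<lambda>s t a b. single (Prod s t) (a * b)) f g"

definition freena_even :: "'k::field freena set" where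
  "freena_even = {f. \<forall>t\<in>keys f. even (mdeg t)}"

definition freena_odd :: "'k::field freena set" where
  "freena_odd = {f. \<forall>t\<in>keys f. odd (mdeg t)}"

lemma freena_mul_eq_0_iff:
  "freena_mul f (0 :: 'k::field freena) = 0" "freena_mul (0 :: 'k::field freena) f = 0"
  by (simp_all add: freena_mul_def bilin_ext_def)

lemma freena_mul_single: "freena_mul (single s a) (single t b) = single (Prod s t) (a * b)"
  by (simp add: freena_mul_def bilin_ext_lin_ext lin_ext_single)

interpretation freena: nonassoc_algebra "coeff_scale ((*) :: 'k::field \<Rightarrow> _)" freena_mul
proof -
  interpret V: vector_space "coeff_scale ((*) :: 'k \<Rightarrow> _) :: _ \<Rightarrow> 'k freena \<Rightarrow> _"
    by (rule vector_space.vector_space_coeff_scale) (unfold_locales, auto simp: algebra_simps)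
  have sum: "coeff_scale (*) c (sum f I) = (\<Sum>i\<in>I. coeff_scale (*) c (f i))"
    for c :: 'k and f :: "'i \<Rightarrow> 'k freena" and I by (rule V.scale_sum_right)
  show "nonassoc_algebra (coeff_scale ((*) :: 'k \<Rightarrow> _)) freena_mul"
  proof unfold_locales
    fix x y z :: "'k freena" and c :: 'k
    show "freena_mul (x + y) z = freena_mul x z + freena_mul y z"
      unfolding freena_mul_def bilin_ext_lin_ext
      by (subst lin_ext_add) (simp_all add: lin_ext_def distrib_right single_add sum.distrib)
    show "freena_mul x (y + z) = freena_mul x y + freena_mul x z"
      unfolding freena_mul_def bilin_ext_lin_ext'
      by (subst lin_ext_add) (simp_all add: lin_ext_def distrib_left single_add sum.distrib)
    show "freena_mul (coeff_scale (*) c x) y = coeff_scale (*) c (freena_mul x y)"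
      unfolding freena_mul_def bilin_ext_lin_ext
      by (subst lin_ext_coeff_scale) (simp_all add: lin_ext_def sum coeff_scale_single mult.assoc)
    show "freena_mul x (coeff_scale (*) c y) = coeff_scale (*) c (freena_mul x y)"
      unfolding freena_mul_def bilin_ext_lin_ext'
      by (subst lin_ext_coeff_scale)
        (simp_all add: lin_ext_def sum coeff_scale_single mult.left_commute)
  qed
qed

lemma keys_freena_mul:
  "keys (freena_mul f g) \<subseteq> {Prod s t | s t. s \<in> keys f \<and> t \<in> keys g}"
proof -
  have "keys (freena_mul f g) \<subseteq>
      (\<Union>s\<in>keys f. keys (\<Sum>t\<in>keys g. single (Prod s t) (lookup f s * lookup g t)))"
    unfolding freena_mul_def bilin_ext_def by (rule Poly_Mapping.keys_sum)
  also have "\<dots> \<subseteq> (\<Union>s\<in>keys f. \<Union>t\<in>keys g. keys (single (Prod s t) (lookup f s * lookup g t)))"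
    by (intro UN_mono Poly_Mapping.keys_sum subset_refl)
  also have "\<dots> \<subseteq> {Prod s t | s t. s \<in> keys f \<and> t \<in> keys g}"
    by (auto split: if_splits)
  finally show ?thesis .
qed

definition freena_part :: "bool \<Rightarrow> 'k::field freena \<Rightarrow> 'k freena" where
  "freena_part p f = lin_ext (\<lambda>t a. if even (mdeg t) = p then single t a else 0) f"

lemma lookup_freena_part:
  "lookup (freena_part p f) t = (if even (mdeg t) = p then lookup f t else 0)"
proof -
  have "lookup (freena_part p f) t =
      (\<Sum>s\<in>keys f. if s = t then if even (mdeg t) = p then lookup f t else 0 else 0)"
    unfolding freena_part_def lin_ext_def lookup_sum
    by (rule sum.cong) (auto simp: lookup_single when_def)
  then show ?thesis by (auto simp: in_keys_iff)
qed

lemma freena_part_in: "freena_part True f \<in> freena_even" "freena_part False f \<in> freena_odd"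
  by (auto simp: freena_even_def freena_odd_def in_keys_iff lookup_freena_part split: if_splits)

lemma freena_part_sum: "freena_part True f + freena_part False f = f"
  by (rule poly_mapping_eqI) (simp add: lookup_add lookup_freena_part)

lemma freena_even_iff: "f \<in> freena_even \<longleftrightarrow> (\<forall>t. odd (mdeg t) \<longrightarrow> lookup f t = 0)"
  and freena_odd_iff: "f \<in> freena_odd \<longleftrightarrow> (\<forall>t. even (mdeg t) \<longrightarrow> lookup f t = 0)"
  by (auto simp: freena_even_def freena_odd_def in_keys_iff)

interpretation freena: superalgebra "coeff_scale ((*) :: 'k::field \<Rightarrow> _)" freena_mul
  freena_even freena_odd
proof unfold_locales
  show "freena.subspace (freena_even :: 'k freena set)" "freena.subspace (freena_odd :: 'k freena set)"
    by (auto simp: freena.subspace_def freena_even_iff freena_odd_iff lookup_add coeff_scale_def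
        lookup_map_zero)
  show "freena_even \<inter> freena_odd = {0 :: 'k freena}"
    by (auto simp: freena_even_iff freena_odd_iff intro!: poly_mapping_eqI) blast+
  show "\<exists>a\<in>freena_even. \<exists>b\<in>freena_odd. f = a + b" for f :: "'k freena"
    using freena_part_in freena_part_sum by metis
qed (use keys_freena_mul in \<open>fastforce simp: freena_even_def freena_odd_def\<close>)+


section \<open>The free (-1,1)-superalgebra on one odd generator\<close>

text \<open>
  The smallest ideal \<open>J\<close> of the free nonassociative superalgebra \<open>A\<close> such that both defining
  identities, evaluated in \<open>G(A)\<close>, only take values with coefficients in \<open>J\<close>.
\<close>

inductive_set free11_ideal :: "'k::field freena set" where
  right_alternative: "u \<in> freena.envelope \<Longrightarrow> v \<in> freena.envelope \<Longrightarrow>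
    lookup (associator (tensor_mul (coeff_scale (*)) freena_mul) u v v) S \<in> free11_ideal"
| cyclic: "u \<in> freena.envelope \<Longrightarrow> v \<in> freena.envelope \<Longrightarrow> w \<in> freena.envelope \<Longrightarrow>
    lookup (associator (tensor_mul (coeff_scale (*)) freena_mul) u v w
          + associator (tensor_mul (coeff_scale (*)) freena_mul) v w u
          + associator (tensor_mul (coeff_scale (*)) freena_mul) w u v) S \<in> free11_ideal"
| zero: "0 \<in> free11_ideal"
| add: "f \<in> free11_ideal \<Longrightarrow> g \<in> free11_ideal \<Longrightarrow> f + g \<in> free11_ideal"
| scale: "f \<in> free11_ideal \<Longrightarrow> coeff_scale (*) c f \<in> free11_ideal"
| mul_left: "f \<in> free11_ideal \<Longrightarrow> freena_mul g f \<in> free11_ideal"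
| mul_right: "f \<in> free11_ideal \<Longrightarrow> freena_mul f g \<in> free11_ideal"

lemma free11_ideal_subspace: "freena.subspace free11_ideal"
  by (rule freena.subspaceI) (auto intro: free11_ideal.intros)

lemmas free11_ideal_diff = freena.subspace_diff[OF free11_ideal_subspace]
lemmas free11_ideal_minus = freena.subspace_neg[OF free11_ideal_subspace]

quotient_type (overloaded) 'k free11 = "'k::field freena" / "\<lambda>f g. f - g \<in> free11_ideal"
proof (rule equivpI)
  show "reflp (\<lambda>f g :: 'k freena. f - g \<in> free11_ideal)"
    by (simp add: reflp_def free11_ideal.zero)
  show "symp (\<lambda>f g :: 'k freena. f - g \<in> free11_ideal)"
    using free11_ideal_minus by (fastforce simp: symp_def)
  show "transp (\<lambda>f g :: 'k freena. f - g \<in> free11_ideal)"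
    using free11_ideal.add by (fastforce simp: transp_def)
qed

instantiation free11 :: (field) ab_group_add
begin

lift_definition zero_free11 :: "'a free11" is 0 .

lift_definition plus_free11 :: "'a free11 \<Rightarrow> 'a free11 \<Rightarrow> 'a free11" is "(+)"
  by (simp add: add_diff_add free11_ideal.add)

lift_definition uminus_free11 :: "'a free11 \<Rightarrow> 'a free11" is uminus
  using free11_ideal_minus by fastforce

lift_definition minus_free11 :: "'a free11 \<Rightarrow> 'a free11 \<Rightarrow> 'a free11" is "(-)"
  using free11_ideal_diff by (fastforce simp: algebra_simps)

instance
  by standard (transfer; simp add: free11_ideal.zero)+

end

lift_definition free11_scale :: "'k::field \<Rightarrow> 'k free11 \<Rightarrow> 'k free11" is "coeff_scale (*)"
  by (metis free11_ideal.scale freena.scale_right_diff_distrib)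

lift_definition free11_mul :: "'k::field free11 \<Rightarrow> 'k free11 \<Rightarrow> 'k free11" is freena_mul
proof -
  fix f f' g g' :: "'k freena"
  assume "f - f' \<in> free11_ideal" "g - g' \<in> free11_ideal"
  then have "freena_mul (f - f') g + freena_mul f' (g - g') \<in> free11_ideal"
    by (intro free11_ideal.intros)
  then show "freena_mul f g - freena_mul f' g' \<in> free11_ideal"
    by (simp add: freena.mul_diff_left freena.mul_diff_right)
qed

lift_definition free11_gen :: "'k::field free11" is "single Gen 1" .

definition free11_even :: "'k::field free11 set" where
  "free11_even = abs_free11 ` freena_even"

definition free11_odd :: "'k::field free11 set" where
  "free11_odd = abs_free11 ` freena_odd"


lemma abs_free11_surj: obtains f where "x = abs_free11 f"
  using Quotient3_abs_rep[OF Quotient3_free11, of x] that by metis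

lemma abs_free11_eq_0_iff: "abs_free11 f = 0 \<longleftrightarrow> f \<in> free11_ideal"
  by (simp add: zero_free11_def free11.abs_eq_iff)

interpretation free11: nonassoc_algebra "free11_scale :: 'k::field \<Rightarrow> _" free11_mul
proof (unfold_locales)
  fix a b :: 'k and x y z :: "'k free11"
  show "free11_scale a (x + y) = free11_scale a x + free11_scale a y"
    by transfer (simp add: freena.scale_right_distrib free11_ideal.zero)
  show "free11_scale (a + b) x = free11_scale a x + free11_scale b x"
    by transfer (simp add: freena.scale_left_distrib free11_ideal.zero)
  show "free11_scale a (free11_scale b x) = free11_scale (a * b) x"
    by transfer (simp add: free11_ideal.zero)
  show "free11_scale 1 x = x"
    by transfer (simp add: free11_ideal.zero)
  show "free11_mul (x + y) z = free11_mul x z + free11_mul y z"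
    by transfer (simp add: freena.mul_add_left free11_ideal.zero)
  show "free11_mul x (y + z) = free11_mul x y + free11_mul x z"
    by transfer (simp add: freena.mul_add_right free11_ideal.zero)
  show "free11_mul (free11_scale a x) y = free11_scale a (free11_mul x y)"
    by transfer (simp add: freena.mul_scale_left free11_ideal.zero)
  show "free11_mul x (free11_scale a y) = free11_scale a (free11_mul x y)"
    by transfer (simp add: freena.mul_scale_right free11_ideal.zero)
qed

interpretation abs_free11: algebra_hom "coeff_scale ((*) :: 'k::field \<Rightarrow> _)" freena_mul
  free11_scale free11_mul abs_free11
  by unfold_locales
    (simp_all add: plus_free11.abs_eq free11_scale.abs_eq free11_mul.abs_eq)

lemma freena_part_add: "freena_part p (f + g) = freena_part p f + freena_part p g"
  and freena_part_scale: "freena_part p (coeff_scale (*) c f) = coeff_scale (*) c (freena_part p f)"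
  and freena_part_zero: "freena_part p (0 :: 'k::field freena) = 0"
  by (rule poly_mapping_eqI;
      simp add: lookup_freena_part lookup_add coeff_scale_def lookup_map_zero)+

lemma freena_part_of_even:
  "f \<in> freena_even \<Longrightarrow> freena_part True f = f" "f \<in> freena_even \<Longrightarrow> freena_part False f = 0"
  and freena_part_of_odd:
  "f \<in> freena_odd \<Longrightarrow> freena_part False f = f" "f \<in> freena_odd \<Longrightarrow> freena_part True f = 0"
  by (auto intro!: poly_mapping_eqI simp: lookup_freena_part freena_even_iff freena_odd_iff)

lemma freena_part_mul:
  "freena_part True (freena_mul f g) = freena_mul (freena_part True f) (freena_part True g)
     + freena_mul (freena_part False f) (freena_part False g)" (is ?thesis1)
  "freena_part False (freena_mul f g) = freena_mul (freena_part True f) (freena_part False g)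
     + freena_mul (freena_part False f) (freena_part True g)" (is ?thesis2)
proof -
  let ?f0 = "freena_part True f" and ?f1 = "freena_part False f"
  let ?g0 = "freena_part True g" and ?g1 = "freena_part False g"
  have eq: "freena_mul f g = freena_mul ?f0 ?g0 + freena_mul ?f0 ?g1
      + (freena_mul ?f1 ?g0 + freena_mul ?f1 ?g1)"
    by (metis freena_part_sum freena.mul_add_left freena.mul_add_right)
  have "freena_mul ?f0 ?g0 \<in> freena_even" "freena_mul ?f1 ?g1 \<in> freena_even"
    "freena_mul ?f0 ?g1 \<in> freena_odd" "freena_mul ?f1 ?g0 \<in> freena_odd"
    by (auto intro: freena.mul_even_even freena.mul_even_odd freena.mul_odd_even
        freena.mul_odd_odd freena_part_in)
  then show ?thesis1 ?thesis2
    by (simp_all add: eq freena_part_add freena_part_of_even freena_part_of_odd)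
qed

lemma freena_envelope_coeff_part:
  assumes "w \<in> freena.envelope" "lookup w S \<in> free11_ideal"
  shows "freena_part p (lookup w S) \<in> free11_ideal"
proof -
  have "lookup w S \<in> freena_even \<or> lookup w S \<in> freena_odd"
    using assms(1) by (auto simp: freena.envelope_iff split: if_splits)
  with assms(2) show ?thesis
    by (cases p) (auto simp: freena_part_of_even freena_part_of_odd free11_ideal.zero)
qed

interpretation freena_tensor: nonassoc_algebra
  "coeff_scale (coeff_scale ((*) :: 'k::field \<Rightarrow> _))" "tensor_mul (coeff_scale (*)) freena_mul"
  by (rule freena.nonassoc_algebra_tensor)

lemma freena_envelope_associator:
  assumes "u \<in> freena.envelope" "v \<in> freena.envelope" "w \<in> freena.envelope"
  shows "associator (tensor_mul (coeff_scale (*)) freena_mul) u v w \<in> freena.envelope"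
  using freena.envelope_subalgebra assms unfolding freena_tensor.subalgebra_def associator_def
  by (blast intro: freena.T.subspace_diff freena.subspace_envelope)

lemma free11_ideal_part: "f \<in> free11_ideal \<Longrightarrow> freena_part p f \<in> free11_ideal"
proof (induction arbitrary: p rule: free11_ideal.induct)
  case (right_alternative u v S)
  then show ?case
    by (intro freena_envelope_coeff_part freena_envelope_associator free11_ideal.right_alternative)
next
  case (cyclic u v w S)
  then show ?case
    by (intro freena_envelope_coeff_part freena.T.subspace_add freena.subspace_envelope freena_envelope_associator
        free11_ideal.cyclic)
next
  case (mul_left f g)
  then show ?case
    by (cases p) (auto simp: freena_part_mul intro!: free11_ideal.add free11_ideal.mul_left)
next
  case (mul_right f g)
  then show ?case
    by (cases p) (auto simp: freena_part_mul intro!: free11_ideal.add free11_ideal.mul_right)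
qed (auto simp: freena_part_zero freena_part_add freena_part_scale intro: free11_ideal.intros)

interpretation free11: superalgebra "free11_scale :: 'k::field \<Rightarrow> _" free11_mul free11_even free11_odd
proof unfold_locales
  show "free11.subspace (free11_even :: 'k free11 set)"
    unfolding free11_even_def by (rule abs_free11.subspace_image[OF freena.subspace_even])
  show "free11.subspace (free11_odd :: 'k free11 set)"
    unfolding free11_odd_def by (rule abs_free11.subspace_image[OF freena.subspace_odd])
  show "free11_even \<inter> free11_odd = {0 :: 'k free11}"
  proof (intro equalityI subsetI)
    fix x :: "'k free11" assume "x \<in> free11_even \<inter> free11_odd"
    then obtain f g where f: "f \<in> freena_even" "x = abs_free11 f"
      and g: "g \<in> freena_odd" "x = abs_free11 g"
      by (auto simp: free11_even_def free11_odd_def)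
    then have "abs_free11 f = abs_free11 g" by simp
    then have "f - g \<in> free11_ideal" by (simp only: free11.abs_eq_iff)
    then have "freena_part True (f - g) \<in> free11_ideal" by (rule free11_ideal_part)
    moreover have "freena_part True (f - g) = f"
      using f g freena_part_add[of True "f - g" g]
      by (simp add: freena_part_of_even freena_part_of_odd)
    ultimately show "x \<in> {0}" using f by (simp add: abs_free11_eq_0_iff)
  next
    have "abs_free11 0 \<in> abs_free11 ` (freena_even :: 'k freena set)"
      "abs_free11 0 \<in> abs_free11 ` (freena_odd :: 'k freena set)"
      by (intro imageI freena.subspace_0 freena.subspace_even freena.subspace_odd)+
    then show "x \<in> free11_even \<inter> free11_odd" if "x \<in> {0}" for x :: "'k free11"
      using that by (simp add: free11_even_def free11_odd_def abs_free11.zero)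
  qed
  show "\<exists>a\<in>free11_even. \<exists>b\<in>free11_odd. x = a + b" for x :: "'k free11"
  proof -
    obtain f where "x = abs_free11 f" by (rule abs_free11_surj)
    then have "x = abs_free11 (freena_part True f) + abs_free11 (freena_part False f)"
      by (simp add: freena_part_sum flip: abs_free11.add)
    then show ?thesis
      unfolding free11_even_def free11_odd_def using freena_part_in by blast
  qed
  fix a b :: "'k free11"
  have *: "free11_mul a b \<in> abs_free11 ` C"
    if "a \<in> abs_free11 ` A" "b \<in> abs_free11 ` B"
      and "\<And>f g. f \<in> A \<Longrightarrow> g \<in> B \<Longrightarrow> freena_mul f g \<in> C" for A B C :: "'k freena set"
    using that by (auto simp only: abs_free11.hom_mul[symmetric])
  show "free11_mul a b \<in> free11_even" if "a \<in> free11_even" "b \<in> free11_even"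
    using that freena.mul_even_even unfolding free11_even_def by (rule *)
  show "free11_mul a b \<in> free11_odd" if "a \<in> free11_even" "b \<in> free11_odd"
    using that freena.mul_even_odd unfolding free11_even_def free11_odd_def by (rule *)
  show "free11_mul a b \<in> free11_odd" if "a \<in> free11_odd" "b \<in> free11_even"
    using that freena.mul_odd_even unfolding free11_even_def free11_odd_def by (rule *)
  show "free11_mul a b \<in> free11_even" if "a \<in> free11_odd" "b \<in> free11_odd"
    using that freena.mul_odd_odd unfolding free11_even_def free11_odd_def by (rule *)
qed

lemma free11_envelope_lift:
  assumes "u \<in> free11.envelope"
  obtains v where "v \<in> freena.envelope" "u = Poly_Mapping.map abs_free11 v"
proof -
  have "\<exists>f \<in> freena.part S. lookup u S = abs_free11 f" for S
  proof -
    have "lookup u S \<in> free11.part S" using assms by (simp only: free11.envelope_iff)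
    then show ?thesis by (auto simp: free11_even_def free11_odd_def)
  qed
  then obtain p where p: "p S \<in> freena.part S" "lookup u S = abs_free11 (p S)" for S by metis
  define v where "v = (\<Sum>S\<in>keys u. single S (p S))"
  have v: "lookup v S = (if S \<in> keys u then p S else 0)" for S
  proof -
    have "lookup v S = (\<Sum>T\<in>keys u. if T = S then p T else 0)"
      unfolding v_def lookup_sum by (rule sum.cong) (auto simp: lookup_single when_def)
    then show ?thesis by simp
  qed
  have "v \<in> freena.envelope"
    unfolding freena.envelope_iff
  proof
    show "lookup v S \<in> freena.part S" for S
      using p(1)[of S] freena.subspace_0[OF freena.subspace_part[of S]]
      by (cases "S \<in> keys u"; cases "even (fcard S)") (auto simp: v)
  qed
  moreover have "u = Poly_Mapping.map abs_free11 v"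
    by (rule poly_mapping_eqI) (auto simp: abs_free11.lookup_map_hom v p(2)[symmetric] in_keys_iff
        abs_free11.zero)
  ultimately show thesis by (rule that)
qed

interpretation free11: minus_one_one_superalgebra "free11_scale :: 'k::field \<Rightarrow> _" free11_mul
  free11_even free11_odd
proof unfold_locales
  let ?A = "associator (tensor_mul (coeff_scale (*)) freena_mul)"
  let ?F = "associator (tensor_mul free11_scale free11_mul)"
  have zero: "Poly_Mapping.map abs_free11 w = 0"
    if "\<And>S. lookup w S \<in> free11_ideal" for w :: "nat fset \<Rightarrow>\<^sub>0 'k freena"
    using that by (intro poly_mapping_eqI) (simp add: abs_free11.lookup_map_hom abs_free11_eq_0_iff)
  show "minus_one_one_on (tensor_mul free11_scale free11_mul)
      (free11.envelope :: (nat fset \<Rightarrow>\<^sub>0 'k free11) set)"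
    unfolding minus_one_one_on_def
  proof (intro conjI ballI)
    fix x y :: "nat fset \<Rightarrow>\<^sub>0 'k free11"
    assume xy: "x \<in> free11.envelope" "y \<in> free11.envelope"
    obtain u where u: "u \<in> freena.envelope" "x = Poly_Mapping.map abs_free11 u"
      using xy(1) by (rule free11_envelope_lift)
    obtain v where v: "v \<in> freena.envelope" "y = Poly_Mapping.map abs_free11 v"
      using xy(2) by (rule free11_envelope_lift)
    have "Poly_Mapping.map abs_free11 (?A u v v) = 0"
      by (intro zero free11_ideal.right_alternative u v)
    then show "?F x y y = 0" by (simp add: u v abs_free11.map_associator)
    fix z :: "nat fset \<Rightarrow>\<^sub>0 'k free11"
    assume z: "z \<in> free11.envelope"
    obtain w where w: "w \<in> freena.envelope" "z = Poly_Mapping.map abs_free11 w"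
      using z by (rule free11_envelope_lift)
    have "Poly_Mapping.map abs_free11 (?A u v w + ?A v w u + ?A w u v) = 0"
      by (intro zero free11_ideal.cyclic u v w)
    then show "?F x y z + ?F y z x + ?F z x y = 0"
      by (simp add: u v w abs_free11.map_associator abs_free11.map_add)
  qed
qed

lemma free11_gen_odd: "free11_gen \<in> free11_odd"
  unfolding free11_odd_def free11_gen.abs_eq by (rule imageI) (simp add: freena_odd_def)

text \<open>The following universal property determines \<open>free11\<close> up to isomorphism and so justifies the
  choice of the ideal.\<close>

primrec eval_monomial :: "('a \<Rightarrow> 'a \<Rightarrow> 'a) \<Rightarrow> 'a \<Rightarrow> monomial \<Rightarrow> 'a" where
  "eval_monomial mul y Gen = y"
| "eval_monomial mul y (Prod s t) = mul (eval_monomial mul y s) (eval_monomial mul y t)"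

theorem free11_universal:
  fixes scale :: "'k::field \<Rightarrow> 'a::ab_group_add \<Rightarrow> 'a"
  assumes "minus_one_one_superalgebra scale mul X0 X1" "y \<in> X1"
  shows "\<exists>!\<phi>. algebra_hom free11_scale free11_mul scale mul \<phi> \<and>
    \<phi> ` free11_even \<subseteq> X0 \<and> \<phi> ` free11_odd \<subseteq> X1 \<and> \<phi> free11_gen = y"
proof -
  interpret X: minus_one_one_superalgebra scale mul X0 X1 by fact
  define ev where "ev f = lin_ext (\<lambda>t c. scale c (eval_monomial mul y t)) f" for f
  have ev_add: "ev (f + g) = ev f + ev g" for f g
    unfolding ev_def by (rule lin_ext_add) (auto simp: X.scale_left_distrib)
  have ev_scale: "ev (coeff_scale (*) c f) = scale c (ev f)" for c f
    unfolding ev_def by (subst lin_ext_coeff_scale) (auto simp: lin_ext_def X.scale_sum_right)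
  have ev_single: "ev (single t c) = scale c (eval_monomial mul y t)" for t c
    unfolding ev_def by (rule lin_ext_single) simp
  interpret ev: Vector_Spaces.linear "coeff_scale (*)" scale ev
    by unfold_locales (auto simp: ev_add ev_scale)
  have ev_mul: "ev (freena_mul f g) = mul (ev f) (ev g)" for f g
    by (subst (1 2) poly_mapping_sum_single[of f, symmetric],
        subst (1 2) poly_mapping_sum_single[of g, symmetric])
      (simp only: freena.mul_sum_left freena.mul_sum_right X.mul_sum_left X.mul_sum_right ev.sum
        freena_mul_single ev_single eval_monomial.simps X.mul_scale_left X.mul_scale_right
        X.scale_scale X.scale_sum_right mult.commute)
  interpret ev: algebra_hom "coeff_scale (*)" freena_mul scale mul ev
    by unfold_locales (rule ev_mul)
  have mon: "eval_monomial mul y t \<in> (if even (mdeg t) then X0 else X1)" for t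
    by (induction t) (use assms(2) X.mul_even_even X.mul_even_odd X.mul_odd_even X.mul_odd_odd
        in \<open>auto split: if_splits\<close>)
  have ev0: "ev f \<in> X0" if "f \<in> freena_even" for f
    unfolding ev_def lin_ext_def
  proof (intro X.subspace_sum X.subspace_scale X.subspace_even)
    fix t assume "t \<in> keys f"
    then show "eval_monomial mul y t \<in> X0"
      using that mon[of t] by (auto simp: freena_even_def)
  qed
  have ev1: "ev f \<in> X1" if "f \<in> freena_odd" for f
    unfolding ev_def lin_ext_def
  proof (intro X.subspace_sum X.subspace_scale X.subspace_odd)
    fix t assume "t \<in> keys f"
    then show "eval_monomial mul y t \<in> X1"
      using that mon[of t] by (auto simp: freena_odd_def)
  qed
  have env: "Poly_Mapping.map ev u \<in> X.envelope" if "u \<in> freena.envelope" for u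
    unfolding X.envelope_iff ev.lookup_map_hom
  proof
    fix S
    have "lookup u S \<in> freena.part S" using that by (simp only: freena.envelope_iff)
    then show "ev (lookup u S) \<in> X.part S" using ev0 ev1 by (cases "even (fcard S)") auto
  qed
  have ker: "ev f = 0" if "f \<in> free11_ideal" for f
    using that
  proof induction
    case (right_alternative u v S)
    then have "Poly_Mapping.map ev (associator (tensor_mul (coeff_scale (*)) freena_mul) u v v) = 0"
      using X.envelope_minus_one_one env
      unfolding minus_one_one_on_def ev.map_associator by blast
    then show ?case by (simp flip: ev.lookup_map_hom)
  next
    case (cyclic u v w S)
    then have "Poly_Mapping.map ev (associator (tensor_mul (coeff_scale (*)) freena_mul) u v w
        + associator (tensor_mul (coeff_scale (*)) freena_mul) v w u
        + associator (tensor_mul (coeff_scale (*)) freena_mul) w u v) = 0"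
      using X.envelope_minus_one_one env
      unfolding minus_one_one_on_def ev.map_associator ev.map_add by blast
    then show ?case by (simp only: ev.lookup_map_hom[symmetric]) simp
  qed (simp_all add: ev.zero ev_add ev_scale ev_mul)
  define \<phi> where "\<phi> x = ev (rep_free11 x)" for x
  have \<phi>_abs: "\<phi> (abs_free11 f) = ev f" for f
  proof -
    have "rep_free11 (abs_free11 f) - f \<in> free11_ideal"
      using Quotient3_rep_abs[OF Quotient3_free11, of f] by (simp add: free11_ideal.zero)
    then have "ev (rep_free11 (abs_free11 f) - f) = 0" by (rule ker)
    then show ?thesis by (simp add: \<phi>_def ev.diff)
  qed
  have hom: "algebra_hom free11_scale free11_mul scale mul \<phi>"
  proof unfold_locales
    fix a b :: "'k free11" and c
    obtain f where a: "a = abs_free11 f" by (rule abs_free11_surj)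
    obtain g where b: "b = abs_free11 g" by (rule abs_free11_surj)
    show "\<phi> (a + b) = \<phi> a + \<phi> b"
      unfolding a b abs_free11.add[symmetric] \<phi>_abs by (rule ev_add)
    show "\<phi> (free11_scale c a) = scale c (\<phi> a)"
      unfolding a abs_free11.scale[symmetric] \<phi>_abs by (rule ev_scale)
    show "\<phi> (free11_mul a b) = mul (\<phi> a) (\<phi> b)"
      unfolding a b abs_free11.hom_mul[symmetric] \<phi>_abs by (rule ev_mul)
  qed
  have unique: "\<psi> = \<phi>" if \<psi>: "algebra_hom free11_scale free11_mul scale mul \<psi>" "\<psi> free11_gen = y"
    for \<psi>
  proof
    interpret \<psi>: algebra_hom free11_scale free11_mul scale mul \<psi> by fact
    have mono: "\<psi> (abs_free11 (single t 1)) = eval_monomial mul y t" for t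
    proof (induction t)
      case Gen
      then show ?case using \<psi>(2) by (simp add: free11_gen.abs_eq)
    next
      case (Prod s t)
      have "single (Prod s t) (1::'k) = freena_mul (single s 1) (single t 1)"
        by (simp add: freena_mul_single)
      then show ?case by (simp only: abs_free11.hom_mul \<psi>.hom_mul Prod eval_monomial.simps)
    qed
    have sing: "\<psi> (abs_free11 (single t c)) = ev (single t c)" for t c
    proof -
      have "single t c = coeff_scale (*) c (single t 1)" by (simp add: coeff_scale_single)
      then show ?thesis by (simp only: abs_free11.scale \<psi>.scale mono ev_scale ev_single X.scale_one)
    qed
    fix x :: "'k free11"
    obtain f where x: "x = abs_free11 f" by (rule abs_free11_surj)
    have "\<psi> (abs_free11 (\<Sum>t\<in>keys f. single t (lookup f t)))
        = ev (\<Sum>t\<in>keys f. single t (lookup f t))"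
      by (simp only: abs_free11.sum \<psi>.sum ev.sum sing)
    then show "\<psi> x = \<phi> x" by (simp add: x \<phi>_abs poly_mapping_sum_single)
  qed
  have gen: "\<phi> free11_gen = y" by (simp add: free11_gen.abs_eq \<phi>_abs ev_single)
  have sub: "\<phi> ` free11_even \<subseteq> X0" "\<phi> ` free11_odd \<subseteq> X1"
    using ev0 ev1 by (auto simp: free11_even_def free11_odd_def \<phi>_abs)
  show ?thesis
    by (rule ex1I[of _ \<phi>]) (intro conjI hom gen sub, elim conjE, rule unique)
qed

text \<open>The degree with respect to the filtration by degree in the generator; on nonzero homogeneous
  elements it is the degree in the generator.\<close>

definition free11_degree :: "'k::field free11 \<Rightarrow> nat" where
  "free11_degree a = (LEAST n. \<exists>f. a = abs_free11 f \<and> (\<forall>t\<in>keys f. mdeg t \<le> n))"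


section \<open>The Grassmann (-1,1)-algebra and its base\<close>

definition free11_tensor :: "'k::field free11 \<Rightarrow> 'k grassmann \<Rightarrow> (nat fset \<Rightarrow>\<^sub>0 'k free11)" where
  "free11_tensor = tensor free11_scale"

text \<open>The subalgebra is taken inside \<open>F \<otimes> G\<close>; since the Grassmann envelope is a subalgebra of
  \<open>F \<otimes> G\<close> containing the generators, this is the subalgebra of \<open>G(F)\<close> they generate.\<close>

definition grassmann11 :: "(nat fset \<Rightarrow>\<^sub>0 'k::field free11) set" where
  "grassmann11 = nonassoc_algebra.generated_subalgebra
     (coeff_scale free11_scale) (tensor_mul free11_scale free11_mul)
     (range (\<lambda>i. free11_tensor free11_gen (ggen i)))"

lemma grassmann11_subset_envelope:
  "(grassmann11 :: (nat fset \<Rightarrow>\<^sub>0 'k::field free11) set) \<subseteq> free11.envelope"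
proof -
  interpret T: nonassoc_algebra "coeff_scale (free11_scale :: 'k \<Rightarrow> _)"
    "tensor_mul free11_scale free11_mul"
    by (rule free11.nonassoc_algebra_tensor)
  have "free11_tensor (free11_gen :: 'k free11) (ggen i) \<in> free11.envelope" for i
    unfolding free11_tensor_def free11.envelope_def ggen_def
  proof (intro free11.T.span_base UnI2 CollectI exI conjI refl)
    show "(free11_gen :: 'k free11) \<in> free11_odd" by (rule free11_gen_odd)
    show "single {|i|} (1 :: 'k) \<in> godd" by (simp add: godd_def fcard.rep_eq)
  qed (rule refl)
  then show ?thesis
    unfolding grassmann11_def T.generated_subalgebra_def
    by (intro hull_minimal free11.envelope_subalgebra) auto
qed

text \<open>
  A finite sequence \<open>I\<close> of nonnegative integers up to trailing zeros is a finitely supported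
  function.  As the even part of the free superalgebra is associative and commutative, the
  bracketing of \<open>a\<^sup>I\<close> is immaterial; we use the left-normed one.  The empty product does not
  occur in the base.
\<close>

definition R_op :: "('a::ab_group_add \<Rightarrow> 'a \<Rightarrow> 'a) \<Rightarrow> 'a \<Rightarrow> 'a \<Rightarrow> 'a" where
  "R_op mul x a = associator mul a x x"

fun left_normed :: "('a::zero \<Rightarrow> 'a \<Rightarrow> 'a) \<Rightarrow> 'a list \<Rightarrow> 'a" where
  "left_normed mul [] = 0"
| "left_normed mul (a # as) = foldl mul a as"

definition power_factors ::
  "('a::ab_group_add \<Rightarrow> 'a \<Rightarrow> 'a) \<Rightarrow> 'a \<Rightarrow> 'a \<Rightarrow> (nat \<Rightarrow>\<^sub>0 nat) \<Rightarrow> 'a list" where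
  "power_factors mul x a I =
     concat (map (\<lambda>j. replicate (lookup I j) ((R_op mul x ^^ j) a)) (sorted_list_of_set (keys I)))"

definition index_norm :: "(nat \<Rightarrow>\<^sub>0 nat) \<Rightarrow> nat" where
  "index_norm I = (\<Sum>j\<in>keys I. lookup I j)"

definition base_monomial :: "(nat \<Rightarrow>\<^sub>0 nat) \<Rightarrow> nat \<Rightarrow> 'k::field free11" where
  "base_monomial I \<epsilon> = left_normed free11_mul
     (power_factors free11_mul free11_gen (free11_mul free11_gen free11_gen) I @
      replicate \<epsilon> free11_gen)"

end

theory Submission
  imports Defs "HOL-Library.Product_Plus"
begin

text \<open>
  Let \<open>\<Gamma> = \<Phi>[\<gamma>, D \<gamma>, D\<^sup>2 \<gamma>, \<dots>]\<close> be the algebra of differential polynomials.  The superalgebra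
  \<open>\<Gamma> + \<Gamma>x\<close> with \<open>ax \<cdot> bx = \<gamma>ab + 2D(a)b + aD(b)\<close> is a (-1,1)-superalgebra in which \<open>x\<^sup>2 = \<gamma>\<close> and
  \<open>R\<^sub>x\<^sub>,\<^sub>x = 2D\<close>, so that \<open>(x\<^sup>2)\<^sup>I\<close> is, up to a power of \<open>2\<close>, a monomial of \<open>\<Gamma>\<close>; this gives
  independence.  For spanning, let \<open>\<psi>\<close> be the linear map from \<open>\<Gamma> + \<Gamma>x\<close> to the free superalgebra
  that inverts this correspondence on the base monomials.  By induction on the degree, the defect
  \<open>\<psi>(u)\<psi>(v) - \<psi>(uv)\<close> satisfies the cocycle identities that come from the superidentities, and these,
  together with the normalization of \<open>\<psi>\<close> on left-normed products, force it to vanish.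
\<close>

section \<open>Differential polynomials in one indeterminate\<close>

text \<open>Commutativity and associativity of the even part are not presupposed. A base monomial is
  left-normed with its factors in increasing order of the index, and both properties come out of the
  multiplicativity of \<open>psi\<close>. By construction only three things hold: multiplicativity
  for a last factor \<open>R_power j\<close> of maximal index, multiplicativity for a last factor x
  after an even element, and the recursion (p, x, x) = 2 D(p) for p = \<open>dvar j\<close>.

  The constants of the product are forced. With R_{x,x} = 2D one has (bx)x = b x^2 + 2D(b); if b
  commutes with x and x^2, the superidentity (x,x,b) + (x,b,x) = 0 becomes 2 x(bx) = 2 x^2 b +
  2D(b), whence x(bx) = x^2 b + D(b).

  The defects are cocycles because the inner products of an associator have smaller degree, where
  \<open>psi\<close> is already multiplicative. The identities alone cannot make the even defects
  vanish: a linear change of \<open>psi\<close> in the degree at hand gives nonzero coboundaries.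
  This is where the order of the factors comes in.\<close>

type_synonym 'k dpoly = "(nat \<Rightarrow>\<^sub>0 nat) \<Rightarrow>\<^sub>0 'k"

text \<open>The variable with index \<open>j\<close> is the \<open>j\<close>-th derivative of the indeterminate \<open>\<gamma> = dvar 0\<close>.  It has
  weight \<open>j + 1\<close>, which is half the degree in \<open>x\<close> of \<open>x\<^sup>2 R\<^sub>x\<^sub>,\<^sub>x\<^sup>j\<close>.\<close>

definition dvar :: "nat \<Rightarrow> 'k::field_char_0 dpoly" where
  "dvar j = single (single j 1) 1"

definition weight :: "(nat \<Rightarrow>\<^sub>0 nat) \<Rightarrow> nat" where
  "weight m = lin_ext (\<lambda>j n. n * Suc j) m"

definition deriv_monomial :: "(nat \<Rightarrow>\<^sub>0 nat) \<Rightarrow> 'k::field_char_0 dpoly" where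
  "deriv_monomial m =
     (\<Sum>j\<in>keys m. single (m - single j 1 + single (Suc j) 1) (of_nat (lookup m j)))"

definition dderiv :: "'k::field_char_0 dpoly \<Rightarrow> 'k dpoly" where
  "dderiv p = lin_ext (\<lambda>m c. single 0 c * deriv_monomial m) p"

lemma weight_add: "weight (m + m') = weight m + weight m'"
  unfolding weight_def by (rule lin_ext_add) (simp_all add: algebra_simps)

lemma weight_single: "weight (single j n) = n * Suc j"
  by (simp add: weight_def lin_ext_single)

lemma weight_0 [simp]: "weight 0 = 0"
  by (simp add: weight_def lin_ext_def)

lemma monomial_split:
  fixes m :: "nat \<Rightarrow>\<^sub>0 nat"
  assumes "lookup m j \<noteq> 0"
  shows "m = m - single j 1 + single j 1"
  using assms by (intro poly_mapping_eqI) (auto simp: lookup_add lookup_minus lookup_single when_def)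

lemma weight_pos: "m \<noteq> 0 \<Longrightarrow> weight m > 0"
proof -
  assume "m \<noteq> 0"
  then obtain j where "lookup m j \<noteq> 0" by (metis poly_mapping_eqI lookup_zero)
  then have "weight m = weight (m - single j 1) + Suc j"
    by (metis monomial_split weight_add weight_single mult_1)
  then show ?thesis by simp
qed

lemma deriv_monomial_superset:
  assumes "finite A" "keys m \<subseteq> A"
  shows "deriv_monomial m =
    (\<Sum>j\<in>A. single (m - single j 1 + single (Suc j) 1) (of_nat (lookup m j)))"
  unfolding deriv_monomial_def
  by (rule sum.mono_neutral_left) (use assms in \<open>auto simp: in_keys_iff\<close>)

lemma deriv_monomial_add:
  "deriv_monomial (m + m') = deriv_monomial m * single m' 1 + single m 1 * deriv_monomial m'"
proof -
  \<comment> \<open>If \<open>lookup m j\<close> is 0, the truncated subtraction spoils the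
    exponents, but the coefficient is 0 as well.\<close>
  have shift: "single (m + m' - single j 1 + single (Suc j) 1) (of_nat (lookup m j)) =
      single (m - single j 1 + single (Suc j) 1) (of_nat (lookup m j)) * (single m' 1 :: 'a dpoly)"
    for j m m'
  proof (cases "lookup m j = 0")
    case False
    then have "m + m' - single j 1 + single (Suc j) 1 = m - single j 1 + single (Suc j) 1 + m'"
      by (intro poly_mapping_eqI) (auto simp: lookup_add lookup_minus lookup_single when_def)
    then show ?thesis by (simp add: mult_single)
  qed simp
  let ?A = "keys m \<union> keys m'"
  have "deriv_monomial (m + m') = (\<Sum>j\<in>?A. single (m + m' - single j 1 + single (Suc j) 1)
      (of_nat (lookup (m + m') j)) :: 'a dpoly)"
    by (rule deriv_monomial_superset) (use Poly_Mapping.keys_add[of m m'] in auto)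
  also have "\<dots> = (\<Sum>j\<in>?A. single (m - single j 1 + single (Suc j) 1) (of_nat (lookup m j))
        * single m' 1) +
      (\<Sum>j\<in>?A. single (m' - single j 1 + single (Suc j) 1) (of_nat (lookup m' j)) * single m 1)"
    using shift[of m m'] shift[of m' m]
    by (simp add: lookup_add single_add sum.distrib add.commute[of m'])
  also have "\<dots> = deriv_monomial m * single m' 1 + single m 1 * deriv_monomial m'"
    by (subst (1 2) deriv_monomial_superset[where A = ?A])
      (auto simp: sum_distrib_left sum_distrib_right mult.commute)
  finally show ?thesis .
qed

lemma dderiv_add: "dderiv (p + q) = dderiv p + dderiv q"
  unfolding dderiv_def by (rule lin_ext_add) (simp_all add: single_add distrib_right)

lemma dderiv_sum: "dderiv (sum f A) = (\<Sum>i\<in>A. dderiv (f i))"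
  by (induction A rule: infinite_finite_induct) (simp_all add: dderiv_add, simp_all add: dderiv_def lin_ext_def)

lemma dderiv_single: "dderiv (single m c) = single 0 c * deriv_monomial m"
  by (simp add: dderiv_def lin_ext_single)

lemma dderiv_mult: "dderiv (p * q) = dderiv p * q + p * dderiv q"
proof -
  have single: "dderiv (single m a * single m' b) =
      dderiv (single m a) * single m' b + single m a * dderiv (single m' b)" for m m' and a b :: 'a
  proof -
    have "dderiv (single m a * single m' b) =
        single 0 a * single 0 b * (deriv_monomial m * single m' 1 + single m 1 * deriv_monomial m')"
      by (simp add: mult_single dderiv_single deriv_monomial_add)
    also have "\<dots> = single 0 a * deriv_monomial m * (single 0 b * single m' 1)
        + single 0 a * single m 1 * (single 0 b * deriv_monomial m')"
      by (simp add: algebra_simps)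
    also have "\<dots> = dderiv (single m a) * single m' b + single m a * dderiv (single m' b)"
      by (simp add: mult_single[of 0] dderiv_single)
    finally show ?thesis .
  qed
  show ?thesis
    by (subst (1 2 3) poly_mapping_sum_single[of p, symmetric],
        subst (1 2 3) poly_mapping_sum_single[of q, symmetric])
      (simp only: sum_product dderiv_sum single sum.distrib)
qed

lemma dderiv_const: "dderiv (single 0 c) = 0"
  by (simp add: dderiv_single deriv_monomial_def)

lemma dderiv_one [simp]: "dderiv 1 = 0"
  using dderiv_const[of 1] by simp

lemma dderiv_zero [simp]: "dderiv 0 = 0"
  using dderiv_const[of 0] by simp

lemma dderiv_dvar: "dderiv (dvar j) = dvar (Suc j)"
  by (simp add: dvar_def dderiv_single deriv_monomial_def)

section \<open>The weight grading\<close>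

definition homogeneous :: "nat \<Rightarrow> 'k::field_char_0 dpoly set" where
  "homogeneous d = {p. \<forall>m\<in>keys p. weight m = d}"

lemma homogeneous_add: "p \<in> homogeneous d \<Longrightarrow> q \<in> homogeneous d \<Longrightarrow> p + q \<in> homogeneous d"
  unfolding homogeneous_def using Poly_Mapping.keys_add[of p q] by auto

lemma homogeneous_zero [simp]: "0 \<in> homogeneous d"
  by (simp add: homogeneous_def)

lemma homogeneous_sum: "(\<And>i. i \<in> A \<Longrightarrow> f i \<in> homogeneous d) \<Longrightarrow> sum f A \<in> homogeneous d"
  by (induction A rule: infinite_finite_induct) (auto intro: homogeneous_add)

lemma homogeneous_mult:
  "p \<in> homogeneous i \<Longrightarrow> q \<in> homogeneous j \<Longrightarrow> d = i + j \<Longrightarrow> p * q \<in> homogeneous d"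
  using Poly_Mapping.keys_mult[of p q] by (fastforce simp: homogeneous_def weight_add)

lemma homogeneous_single: "weight m = d \<Longrightarrow> single m c \<in> homogeneous d"
  by (auto simp: homogeneous_def)

lemma homogeneous_one: "1 \<in> homogeneous 0"
  using homogeneous_single[of 0 0 1] by simp

lemma homogeneous_dvar: "dvar j \<in> homogeneous (Suc j)"
  unfolding dvar_def by (rule homogeneous_single) (simp add: weight_single)

lemma homogeneous_dderiv: "p \<in> homogeneous d \<Longrightarrow> dderiv p \<in> homogeneous (Suc d)"
  unfolding dderiv_def lin_ext_def deriv_monomial_def
proof (intro homogeneous_sum homogeneous_mult[of _ 0 _ "Suc d"] homogeneous_single)
  fix m j assume "p \<in> homogeneous d" "m \<in> keys p" "j \<in> keys m"
  then have "weight m = d" "lookup m j \<noteq> 0" by (auto simp: homogeneous_def in_keys_iff)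
  then have "weight (m - single j 1) + Suc j = d"
    by (metis monomial_split weight_add weight_single mult_1)
  then show "weight (m - single j 1 + single (Suc j) 1) = Suc d"
    by (simp add: weight_add weight_single)
qed simp_all

section \<open>Vanishing of cocycles\<close>

definition odd_product :: "'k::field_char_0 dpoly \<Rightarrow> 'k dpoly \<Rightarrow> 'k dpoly" where
  "odd_product a b = dvar 0 * a * b + 2 * dderiv a * b + a * dderiv b"

text \<open>
  \<open>E\<close>, \<open>M\<close>, \<open>N\<close>, \<open>P\<close> are a functional applied to the defects of products of type even-even,
  even-odd, odd-even and odd-odd; \<open>b\<close> in an odd position stands for \<open>bx\<close>.  Functionals with values
  in \<open>rat\<close> suffice to separate points and make linear arithmetic available.
\<close>

locale odd_cocycle =
  fixes n :: nat and M N :: "'k::field_char_0 dpoly \<Rightarrow> 'k dpoly \<Rightarrow> rat"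
  assumes M_add_left: "M (a + b) c = M a c + M b c"
    and N_add_right: "N a (b + c) = N a b + N a c"
    and normal: "a \<in> homogeneous n \<Longrightarrow> 0 < n \<Longrightarrow> M a 1 = 0"
    and RA_eeo: "a \<in> homogeneous i \<Longrightarrow> b \<in> homogeneous j \<Longrightarrow> c \<in> homogeneous k \<Longrightarrow>
      0 < i \<Longrightarrow> 0 < j \<Longrightarrow> i + j + k = n \<Longrightarrow> M (a * b) c - 2 * M a (b * c) + N (a * c) b = 0"
    and RA_oee: "a \<in> homogeneous i \<Longrightarrow> b \<in> homogeneous j \<Longrightarrow> c \<in> homogeneous k \<Longrightarrow>
      0 < i \<Longrightarrow> 0 < j \<Longrightarrow> i + j + k = n \<Longrightarrow> N (a * c) b + N (b * c) a = 2 * N c (a * b)"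
    and RA_ooo: "a \<in> homogeneous i \<Longrightarrow> b \<in> homogeneous j \<Longrightarrow> c \<in> homogeneous k \<Longrightarrow>
      i + j + k + 1 = n \<Longrightarrow>
      M (odd_product a b) c - N a (odd_product b c) = M (odd_product a c) b - N a (odd_product c b)"
    and cyclic_ooo: "a \<in> homogeneous i \<Longrightarrow> b \<in> homogeneous j \<Longrightarrow> c \<in> homogeneous k \<Longrightarrow>
      i + j + k + 1 = n \<Longrightarrow>
      M (odd_product a b) c - N a (odd_product b c) +
      (M (odd_product b c) a - N b (odd_product c a)) +
      (M (odd_product c a) b - N c (odd_product a b)) = 0"
begin

lemma M_two: "M (2 * a) c = 2 * M a c" and N_two: "N a (2 * c) = 2 * N a c"
  using M_add_left[of a a c] N_add_right[of a c c] by (simp_all flip: mult_2)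

lemmas expand = odd_product_def M_add_left N_add_right mult.assoc M_two N_two

text \<open>This is \<open>RA_eeo\<close> at c = 1, where \<open>normal\<close> removes the first
  term. It leaves \<open>M\<close> and the values \<open>N 1\<close> as the only unknowns.\<close>

lemma N_eq:
  assumes "a \<in> homogeneous i" "b \<in> homogeneous j" "0 < i" "0 < j" "i + j = n"
  shows "N a b = 2 * M a b"
proof -
  have "a * b \<in> homogeneous n" using assms homogeneous_mult by blast
  then show ?thesis
    using RA_eeo[OF assms(1,2) homogeneous_one] normal[of "a * b"] assms by simp
qed

lemma N_one:
  assumes "a \<in> homogeneous i" "b \<in> homogeneous j" "0 < i" "0 < j" "i + j = n"
  shows "N 1 (a * b) = M a b + M b a"
  using RA_oee[OF assms(1,2) homogeneous_one] N_eq[OF assms] N_eq[OF assms(2,1)] assms by simp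

text \<open>\<open>RA_eeo\<close> and its copy with b and c exchanged, combined with
  \<open>N_eq\<close>, make \<open>M (a * b) c\<close> symmetric in b and c; hence in all instances
  3 \<open>M (a * b) c\<close> = 2 \<open>M a (b * c)\<close>, and X = \<open>M (a * b) c\<close> is
  symmetric in all three arguments. Then \<open>RA_oee\<close> reads 4 X = 6 X.\<close>

lemma triple:
  assumes a: "a \<in> homogeneous i" and b: "b \<in> homogeneous j" and c: "c \<in> homogeneous k"
    and pos: "0 < i" "0 < j" "0 < k" and n: "i + j + k = n"
  shows "M (a * b) c = 0" "M a (b * c) = 0"
proof -
  have main: "3 * M (a * b) c = 2 * M a (b * c)"
    if "a \<in> homogeneous i" "b \<in> homogeneous j" "c \<in> homogeneous k"
       "0 < i" "0 < j" "0 < k" "i + j + k = n" for a b c i j k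
  proof -
    note h = that(1-3) and p = that(4-6) and n = that(7)
    have "N (a * c) b = 2 * M (a * c) b" "N (a * b) c = 2 * M (a * b) c"
      using h p n by (auto intro!: N_eq homogeneous_mult)
    moreover have "M (a * b) c - 2 * M a (b * c) + N (a * c) b = 0"
      using h p n by (intro RA_eeo) auto
    moreover have "M (a * c) b - 2 * M a (c * b) + N (a * b) c = 0"
      using h p n by (intro RA_eeo[of a i c k b j]) auto
    ultimately show ?thesis by (simp add: mult.commute)
  qed
  have "N (a * c) b = 2 * M (a * c) b" "N (b * c) a = 2 * M (b * c) a" "N c (a * b) = 2 * M c (a * b)"
    using a b c pos n by (auto intro!: N_eq homogeneous_mult)
  moreover have "N (a * c) b + N (b * c) a = 2 * N c (a * b)"
    using a b c pos n by (intro RA_oee) auto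
  ultimately have "M (a * b) c = 0 \<and> M a (b * c) = 0"
    using main[OF a b c] main[OF b a c] main[OF a c b] main[OF c a b] main[OF c b a] main[OF b c a]
      pos n
    by (simp add: mult.commute)
  then show "M (a * b) c = 0" "M a (b * c) = 0" by auto
qed

text \<open>Both odd identities are taken at a = b = 1, that is, at the triple x, x, cx. The second
  equation gives access to \<open>N 1\<close> on derivatives, which \<open>N_one\<close> reaches
  only if they are products.\<close>

lemma dvar_one:
  assumes c: "c \<in> homogeneous k" "0 < k" "k + 1 = n"
  shows "M (dvar 0) c = 2 * M c (dvar 0)" "N 1 (dderiv c) = - 2 * M c (dvar 0)"
proof -
  have g: "dvar 0 \<in> homogeneous 1" using homogeneous_dvar[of 0] by simp
  have h: "dvar 0 * c \<in> homogeneous n" "dderiv c \<in> homogeneous n"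
    using homogeneous_mult[OF g c(1)] homogeneous_dderiv[OF c(1)] c by auto
  have "M (dvar 0 * c) 1 = 0" "M (dderiv c) 1 = 0" using h normal c by auto
  moreover have "N 1 (dvar 0 * c) = M (dvar 0) c + M c (dvar 0)"
    using N_one[OF g c(1)] c by simp
  moreover have "N c (dvar 0) = 2 * M c (dvar 0)" using N_eq[OF c(1) g] c by simp
  ultimately show "M (dvar 0) c = 2 * M c (dvar 0)" "N 1 (dderiv c) = - 2 * M c (dvar 0)"
    using RA_ooo[OF homogeneous_one homogeneous_one c(1)]
      cyclic_ooo[OF homogeneous_one homogeneous_one c(1)] c
    by (simp_all add: expand)
qed

lemma N_one_dvar: "n = 1 \<Longrightarrow> N 1 (dvar 0) = 0"
proof -
  assume n: "n = 1"
  then have "M (dvar 0) 1 = 0" using normal homogeneous_dvar[of 0] by auto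
  then show ?thesis
    using cyclic_ooo[OF homogeneous_one homogeneous_one homogeneous_one] n
    by (simp add: expand)
qed

lemma dvar_dvar: "n = 2 \<Longrightarrow> M (dvar 0) (dvar 0) = 0"
  using dvar_one(1)[of "dvar 0" 1] homogeneous_dvar[of 0] by simp

text \<open>The odd identities are taken with one argument equal to 1. Terms containing the factor
  \<open>dvar 0\<close> vanish by \<open>triple\<close> or by \<open>normal\<close>, so only defects
  with a derivative survive.\<close>

lemma derivative:
  assumes b: "b \<in> homogeneous j" "0 < j" and c: "c \<in> homogeneous k" "0 < k" and n: "j + k + 1 = n"
  shows "M b (dderiv c) = 0" "M (dderiv b) c = 0"
proof -
  have g: "dvar 0 \<in> homogeneous 1" using homogeneous_dvar[of 0] by simp
  note b' = homogeneous_dderiv[OF b(1)] and c' = homogeneous_dderiv[OF c(1)]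
  have N1: "N 1 (dvar 0 * (b * c)) = 0"
    using N_one[OF g homogeneous_mult[OF b(1) c(1) refl]] triple(1)[OF b(1) c(1) g]
      triple(2)[OF g b(1) c(1)] b c n by (simp add: mult.commute)
  have gb: "M (dvar 0 * b) c = 0" "M (dvar 0 * c) b = 0" "M b (dvar 0 * c) = 0" "M c (dvar 0 * b) = 0"
    using triple[OF g b(1) c(1)] triple[OF g c(1) b(1)] triple[OF b(1) g c(1)]
      triple[OF c(1) g b(1)] b c n by (auto simp: mult.commute)
  have "dvar 0 * (b * c) \<in> homogeneous n" "dderiv b * c \<in> homogeneous n" "b * dderiv c \<in> homogeneous n"
    using homogeneous_mult[OF g homogeneous_mult[OF b(1) c(1) refl]] n
      homogeneous_mult[OF b' c(1)] homogeneous_mult[OF b(1) c'] by auto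
  then have M1: "M (dvar 0 * (b * c)) 1 = 0" "M (dderiv b * c) 1 = 0" "M (b * dderiv c) 1 = 0"
    using normal n by auto
  have N2: "N 1 (dderiv b * c) = M (dderiv b) c + M c (dderiv b)"
    "N 1 (dderiv c * b) = M (dderiv c) b + M b (dderiv c)"
    using N_one[OF b' c(1)] N_one[OF c' b(1)] b c n by auto
  have N3: "N b (dvar 0 * c) = 2 * M b (dvar 0 * c)" "N c (dvar 0 * b) = 2 * M c (dvar 0 * b)"
    "N b (dderiv c) = 2 * M b (dderiv c)" "N c (dderiv b) = 2 * M c (dderiv b)"
    using N_eq[OF b(1) homogeneous_mult[OF g c(1) refl]] N_eq[OF c(1) homogeneous_mult[OF g b(1) refl]]
      N_eq[OF b(1) c'] N_eq[OF c(1) b'] b c n by auto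
  note comm = mult.commute[of c b] mult.commute[of c "dderiv b"] mult.commute[of b "dderiv c"]
  have e1: "M (dderiv b) c - 2 * N 1 (dderiv b * c) - N 1 (dderiv c * b)
      = M (dderiv c) b - 2 * N 1 (dderiv c * b) - N 1 (dderiv b * c)"
    using RA_ooo[OF homogeneous_one b(1) c(1)] n
    by (simp add: expand N1 gb comm)
  have e2: "2 * M (dderiv b) c - N b (dderiv c) = - 2 * N b (dderiv c)"
    using RA_ooo[OF b(1) homogeneous_one c(1)] n M1
    by (simp add: expand N1 N3(1) gb comm)
  have e2': "2 * M (dderiv c) b - N c (dderiv b) = - 2 * N c (dderiv b)"
    using RA_ooo[OF c(1) homogeneous_one b(1)] n M1
    by (simp add: expand N1 N3(2) gb comm)
  have e3: "M (dderiv b) c - 2 * N 1 (dderiv b * c) - N 1 (dderiv c * b)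
      - 2 * N b (dderiv c) + 2 * M (dderiv c) b - N c (dderiv b) = 0"
    using cyclic_ooo[OF homogeneous_one b(1) c(1)] n M1
    by (simp add: expand N1 N3(1,2) gb comm)
  \<comment> \<open>Put r = \<open>M b (dderiv c)\<close> and s = \<open>M c (dderiv b)\<close>.
    Then \<open>e2\<close> and \<open>e2'\<close> give \<open>M (dderiv b) c\<close> = - r and
    \<open>M (dderiv c) b\<close> = - s, \<open>e1\<close> gives r = s, and \<open>e3\<close>
    becomes - 9 r = 0.\<close>
  show "M b (dderiv c) = 0" "M (dderiv b) c = 0"
    using e1 e2 e2' e3 N2 N3(3,4) by linarith+
qed

end


text \<open>There is no normalization among these assumptions, and nonzero solutions exist: for
  additive h, \<open>E a b\<close> = h(ab) and \<open>P a b\<close> =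
  h(\<open>odd_product a b\<close>). The aim is therefore not vanishing but rules for moving factors
  between the two arguments of \<open>E\<close>, and formulas for \<open>P\<close> in terms of
  \<open>P 1\<close> and \<open>E\<close>.\<close>

locale even_cocycle =
  fixes n :: nat and E P :: "'k::field_char_0 dpoly \<Rightarrow> 'k dpoly \<Rightarrow> rat"
  assumes E_add_left: "E (a + b) c = E a c + E b c"
    and E_add_right: "E a (b + c) = E a b + E a c"
    and RA_eee: "a \<in> homogeneous i \<Longrightarrow> b \<in> homogeneous j \<Longrightarrow> c \<in> homogeneous k \<Longrightarrow>
      0 < i \<Longrightarrow> 0 < j \<Longrightarrow> 0 < k \<Longrightarrow> i + j + k = n \<Longrightarrow> E (a * b) c + E (a * c) b = 2 * E a (b * c)"
    and RA_eoo: "a \<in> homogeneous i \<Longrightarrow> b \<in> homogeneous j \<Longrightarrow> c \<in> homogeneous k \<Longrightarrow>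
      0 < i \<Longrightarrow> i + j + k + 1 = n \<Longrightarrow>
      P (a * b) c - E a (odd_product b c) = P (a * c) b - E a (odd_product c b)"
    and RA_oeo: "a \<in> homogeneous i \<Longrightarrow> b \<in> homogeneous j \<Longrightarrow> c \<in> homogeneous k \<Longrightarrow>
      0 < i \<Longrightarrow> i + j + k + 1 = n \<Longrightarrow>
      E (odd_product b c) a - 2 * P b (c * a) + P (a * b) c = 0"
    and cyclic_eoo: "a \<in> homogeneous i \<Longrightarrow> b \<in> homogeneous j \<Longrightarrow> c \<in> homogeneous k \<Longrightarrow>
      0 < i \<Longrightarrow> i + j + k + 1 = n \<Longrightarrow>
      P (a * b) c - E a (odd_product b c) + (E (odd_product b c) a - P b (c * a)) =
      P (c * a) b - P c (a * b)"
begin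

lemma E_two: "E (2 * a) c = 2 * E a c" "E a (2 * c) = 2 * E a c"
  using E_add_left[of a a c] E_add_right[of a c c] by (simp_all flip: mult_2)

lemma E_zero [simp]: "E 0 c = 0" "E a 0 = 0"
  using E_add_left[of 0 0 c] E_add_right[of a 0 0] by simp_all

lemmas expand = odd_product_def E_add_left E_add_right mult.assoc E_two

lemma dvar_sym:
  assumes "a \<in> homogeneous i" "0 < i" "i + 1 = n"
  shows "E a (dvar 0) = E (dvar 0) a"
  using cyclic_eoo[OF assms(1) homogeneous_one homogeneous_one] assms by (simp add: expand)

text \<open>This is \<open>RA_oeo\<close> at b = 1. It leaves \<open>P 1\<close> as the only odd-odd
  unknown.\<close>

lemma O_eq:
  assumes "a \<in> homogeneous i" "c \<in> homogeneous k" "0 < i" "i + k + 1 = n"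
  shows "P a c = 2 * P 1 (a * c) - E (dvar 0 * c) a - E (dderiv c) a"
  using RA_oeo[OF assms(1) homogeneous_one assms(2)] assms(3,4) by (simp add: expand mult.commute)

lemma O_one:
  assumes a: "a \<in> homogeneous i" and b: "b \<in> homogeneous j" and pos: "0 < i" "0 < j"
    and n: "i + j + 1 = n"
  shows "2 * P 1 (a * b) = 2 * E (dvar 0 * a) b + 2 * E (dderiv a) b
    + E (dvar 0 * b) a + 2 * E (dderiv b) a - E (dvar 0) (a * b)"
  using RA_oeo[OF a b homogeneous_one] O_eq[OF homogeneous_mult[OF a b refl] homogeneous_one]
    O_eq[OF b a] pos n
  by (simp add: expand mult.commute[of b a])

text \<open>The left side of \<open>O_one\<close> is symmetric in a and b; comparing the right sides
  for both orders leaves \<open>E (dvar 0 * a) b = E (dvar 0 * b) a\<close>. The remaining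
  equalities follow from \<open>RA_eee\<close> and \<open>dvar_sym\<close>.\<close>

lemma dvar_pair:
  assumes a: "a \<in> homogeneous i" and b: "b \<in> homogeneous j" and pos: "0 < i" "0 < j"
    and n: "i + j + 1 = n"
  shows "E (dvar 0 * a) b = E (dvar 0) (a * b)" "E (a * b) (dvar 0) = E (dvar 0) (a * b)"
    "E a (dvar 0 * b) = E (dvar 0) (a * b)"
proof -
  have g: "dvar 0 \<in> homogeneous 1" using homogeneous_dvar[of 0] by simp
  have 1: "E (dvar 0 * a) b = E (dvar 0 * b) a"
    using O_one[OF a b] O_one[OF b a] pos n by (simp add: mult.commute[of b a])
  have 2: "E (a * b) (dvar 0) = E (dvar 0) (a * b)"
    using dvar_sym[OF homogeneous_mult[OF a b refl]] pos n by simp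
  have "E (dvar 0 * a) b + E (dvar 0 * b) a = 2 * E (dvar 0) (a * b)"
    using RA_eee[OF g a b] pos n by simp
  moreover have "E (a * b) (dvar 0) + E (a * dvar 0) b = 2 * E a (b * dvar 0)"
    using RA_eee[OF a b g] pos n by simp
  ultimately show "E (dvar 0 * a) b = E (dvar 0) (a * b)" "E (a * b) (dvar 0) = E (dvar 0) (a * b)"
    "E a (dvar 0 * b) = E (dvar 0) (a * b)"
    using 1 2 by (simp_all add: mult.commute[of _ "dvar 0"])
qed

lemma O_one_mult:
  assumes "a \<in> homogeneous i" "b \<in> homogeneous j" "0 < i" "0 < j" "i + j + 1 = n"
  shows "P 1 (a * b) = E (dvar 0) (a * b) + E (dderiv a) b + E (dderiv b) a"
  using O_one[OF assms] dvar_pair(1)[OF assms] dvar_pair(1)[OF assms(2,1)] assms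
  by (simp add: mult.commute[of b a])

text \<open>In \<open>RA_eoo\<close> at b = 1 both values of \<open>P\<close> reduce by
  \<open>O_eq\<close> to the same \<open>P 1 (a * c)\<close>, which cancels.\<close>

lemma deriv_sym:
  assumes a: "a \<in> homogeneous i" and c: "c \<in> homogeneous k" and pos: "0 < i" "0 < k"
    and n: "i + k + 1 = n"
  shows "E (dderiv c) a = E a (dderiv c)"
  using RA_eoo[OF a homogeneous_one c] O_eq[OF a c] O_eq[OF homogeneous_mult[OF a c refl] homogeneous_one]
    dvar_pair(1)[OF c a] pos n
  by (simp add: expand mult.commute[of c a])

text \<open>The analogue of \<open>dvar_pair\<close> for a derivative in place of
  \<open>dvar 0\<close>. Since every variable is \<open>dvar 0\<close> or the derivative of a
  variable, the two lemmas together carry any variable out of a product in either argument of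
  \<open>E\<close> into the second argument.\<close>

lemma deriv_pair:
  assumes a: "a \<in> homogeneous i" and b: "b \<in> homogeneous j" and d: "d \<in> homogeneous k"
    and pos: "0 < i" "0 < j" "0 < k" and n: "i + j + k + 1 = n"
  shows "E (dderiv d * a) b = E (dderiv d) (a * b)" "E (a * b) (dderiv d) = E (dderiv d) (a * b)"
    "E a (dderiv d * b) = E (dderiv d) (a * b)"
proof -
  have three: "E (a * b) (dderiv d) = E (dderiv d) (a * b)"
    "E (dderiv d * a) b + E (dderiv d * b) a = 2 * E (dderiv d) (a * b)"
    "E (a * b) (dderiv d) + E (dderiv d * a) b = 2 * E a (dderiv d * b)"
    if a: "a \<in> homogeneous i" and b: "b \<in> homogeneous j" and d: "d \<in> homogeneous k"
      and pos: "0 < i" "0 < j" "0 < k" and n: "i + j + k + 1 = n" for a b d i j k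
  proof -
    note d' = homogeneous_dderiv[OF d]
    show "E (a * b) (dderiv d) = E (dderiv d) (a * b)"
      using deriv_sym[OF homogeneous_mult[OF a b refl] d] pos n by simp
    show "E (dderiv d * a) b + E (dderiv d * b) a = 2 * E (dderiv d) (a * b)"
      using RA_eee[OF d' a b] pos n by simp
    show "E (a * b) (dderiv d) + E (dderiv d * a) b = 2 * E a (dderiv d * b)"
      using RA_eee[OF a b d'] pos n by (simp add: mult.commute[of _ "dderiv d"])
  qed
  \<comment> \<open>The defect \<open>E (d' b) a - E (d' a) b\<close> is skew-symmetric in \<open>a, b\<close> and symmetric in
    \<open>b, d\<close>, hence zero.\<close>
  have sym: "E (dderiv d * b) a - E (dderiv d * a) b = E (dderiv b * d) a - E (dderiv b * a) d"
    if a: "a \<in> homogeneous i" and b: "b \<in> homogeneous j" and d: "d \<in> homogeneous k"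
      and pos: "0 < i" "0 < j" "0 < k" and n: "i + j + k + 1 = n" for a b d i j k
  proof -
    have g: "dvar 0 \<in> homogeneous 1" using homogeneous_dvar[of 0] by simp
    have "P (a * b) d - P (a * d) b =
        E (dvar 0 * b) (a * d) - E (dvar 0 * d) (a * b) + E (dderiv b) (a * d) - E (dderiv d) (a * b)"
      using O_eq[OF homogeneous_mult[OF a b refl] d] O_eq[OF homogeneous_mult[OF a d refl] b] pos n
      by (simp add: ac_simps)
    moreover have "E (dvar 0 * b) (a * d) = E (dvar 0) (a * b * d)"
      "E (dvar 0 * d) (a * b) = E (dvar 0) (a * b * d)"
      using dvar_pair(1)[OF b homogeneous_mult[OF a d refl]]
        dvar_pair(1)[OF d homogeneous_mult[OF a b refl]] pos n
      by (simp_all add: ac_simps)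
    moreover have "P (a * b) d - P (a * d) b = E a (dderiv b * d) - E a (dderiv d * b)"
      using RA_eoo[OF a b d] pos n
      by (simp add: expand mult.commute[of d b] mult.commute[of b "dderiv d"]
          mult.commute[of d "dderiv b"])
    ultimately show ?thesis
      using three[OF a d b] three[OF a b d] pos n by linarith
  qed
  have "E (dderiv d * b) a = E (dderiv d * a) b"
    using sym[OF a b d] sym[OF b a d] sym[OF a d b] sym[OF d a b] sym[OF b d a] sym[OF d b a] pos n
    by linarith
  then show "E (dderiv d * a) b = E (dderiv d) (a * b)" "E (a * b) (dderiv d) = E (dderiv d) (a * b)"
    "E a (dderiv d * b) = E (dderiv d) (a * b)"
    using three[OF a b d pos n] by linarith+
qed

end

section \<open>Superidentities\<close>

context nonassoc_algebra
begin

lemma associator_add: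
  "associator mul (a + a') b c = associator mul a b c + associator mul a' b c"
  "associator mul a (b + b') c = associator mul a b c + associator mul a b' c"
  "associator mul a b (c + c') = associator mul a b c + associator mul a b c'"
  by (simp_all add: associator_def mul_add_left mul_add_right)

lemma tensor_diff_left: "tensor scale (x - y) g = tensor scale x g - tensor scale y g"
  using tensor_add_left[of "x - y" y g] by (simp add: algebra_simps)

lemma tensor_minus: "tensor scale (- x) g = - tensor scale x g" "tensor scale x (- g) = - tensor scale x g"
  using tensor_add_left[of "- x" x g] tensor_add_right[of x "- g" g]
  by (simp_all add: eq_neg_iff_add_eq_0)

lemma associator_tensor:
  "associator (tensor_mul scale mul) (tensor scale a g) (tensor scale b h) (tensor scale c k) =
   tensor scale (associator mul a b c) (gmul (gmul g h) k)"
  by (simp add: associator_def tensor_mul_tensor gmul_assoc tensor_diff_left)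

lemma single_eq_tensor: "single S x = tensor scale x (single S 1)"
  by (simp add: tensor_single)

end

context superalgebra
begin

text \<open>The flags record which arguments are odd.\<close>

abbreviation parity_part :: "bool \<Rightarrow> 'a set" where
  "parity_part p \<equiv> if p then X1 else X0"

text \<open>The linearized right alternative law and the cyclic law with the signs of the Koszul
  rule: exchanging two odd elements costs a sign, and \<open>p \<and> (q \<noteq> r)\<close> says
  that moving a past b and c costs one in total.\<close>

definition super_identities :: bool where
  "super_identities \<longleftrightarrow>
    (\<forall>p q r. \<forall>a\<in>parity_part p. \<forall>b\<in>parity_part q. \<forall>c\<in>parity_part r.
      associator mul a b c + (if q \<and> r then - associator mul a c b else associator mul a c b) = 0 \<and>
      associator mul a b c
        + (if p \<and> (q \<noteq> r) then - associator mul b c a else associator mul b c a)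
        + (if r \<and> (p \<noteq> q) then - associator mul c a b else associator mul c a b) = 0)"

end

text \<open>The envelope identities are evaluated at a, b, c tensored with independent words, a
  generator for an odd element and the unit for an even one. All terms are then multiples of one
  basis word \<open>W\<close>, whose coefficient can be read off. The right alternative law is
  linearized first, by inserting the sum of two elements.\<close>

lemma (in minus_one_one_superalgebra) super_identities: super_identities
  unfolding super_identities_def
proof (intro allI ballI)
  fix p q r a b c
  assume abc: "a \<in> parity_part p" "b \<in> parity_part q" "c \<in> parity_part r"
  \<comment> \<open>Of the indices 0, 2, 3 used below only the increasing order matters: it makes
    \<open>W\<close> a basis word without sign.\<close>
  define w :: "bool \<Rightarrow> nat \<Rightarrow> 'a grassmann" where "w s i = (if s then ggen i else gone)" for s i
  define W where "W = gmul (gmul (w p 0) (w q 2)) (w r 3)"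
  have swap: "gmul (ggen 2) (ggen 0) = - gmul (ggen 0) (ggen 2 :: 'a grassmann)"
    "gmul (ggen 3) (ggen 0) = - gmul (ggen 0) (ggen 3 :: 'a grassmann)"
    "gmul (ggen 3) (ggen 2) = - gmul (ggen 2) (ggen 3 :: 'a grassmann)"
    by (rule ggen_anticommute)+
  have swap': "gmul (ggen 2) (gmul (ggen 0) g) = - gmul (ggen 0) (gmul (ggen 2) g)"
    "gmul (ggen 3) (gmul (ggen 0) g) = - gmul (ggen 0) (gmul (ggen 3) g)"
    "gmul (ggen 3) (gmul (ggen 2) g) = - gmul (ggen 2) (gmul (ggen 3) g)" for g :: "'a grassmann"
    by (simp_all flip: gmul_assoc add: swap grassmann.mul_minus_left)
  note norm = w_def gmul_one_left gmul_one_right gmul_assoc swap swap'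
    grassmann.mul_minus_left grassmann.mul_minus_right
  have W2: "gmul (gmul (w p 0) (w r 3)) (w q 2) = (if q \<and> r then - W else W)"
    and W3: "gmul (gmul (w q 2) (w r 3)) (w p 0) = (if p \<and> (q \<noteq> r) then - W else W)"
    and W4: "gmul (gmul (w r 3) (w p 0)) (w q 2) = (if r \<and> (p \<noteq> q) then - W else W)"
    unfolding W_def by (cases p; cases q; cases r; simp add: norm)+
  have "\<exists>js. sorted_wrt (<) js \<and> W = gprod_list (map ggen js)"
    by (rule exI[of _ "(if p then [0] else []) @ (if q then [2] else []) @ (if r then [3] else [])"])
      (simp add: W_def norm gprod_list_def)
  then obtain S where S: "W = single S 1" using gprod_list_ggen by blast
  have inj: "x = 0" if "tensor scale x W = 0" for x
    using arg_cong[OF that, of "\<lambda>u. lookup u S"] by (simp add: lookup_tensor S)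
  have env: "tensor scale y (w s i) \<in> envelope" if "y \<in> parity_part s" for y s i
  proof -
    have "w True i \<in> godd" "w False i \<in> geven"
      by (auto simp: w_def ggen_def gone_def geven_def godd_def fcard.rep_eq)
    with that show ?thesis
      unfolding envelope_def by (intro T.span_base) (cases s; auto)
  qed
  let ?T = "associator (tensor_mul scale mul)"
  have assoc: "?T (tensor scale x (w s i)) (tensor scale y (w t j)) (tensor scale z (w u k)) =
      tensor scale (associator mul x y z) (gmul (gmul (w s i) (w t j)) (w u k))" for x y z s t u i j k
    by (rule associator_tensor)
  have RA: "?T u v v = 0" if "u \<in> envelope" "v \<in> envelope" for u v
    using envelope_minus_one_one that unfolding minus_one_one_on_def by blast
  have cyc: "?T u v v' + ?T v v' u + ?T v' u v = 0"
    if "u \<in> envelope" "v \<in> envelope" "v' \<in> envelope" for u v v'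
    using envelope_minus_one_one that unfolding minus_one_one_on_def by blast
  interpret E: nonassoc_algebra "coeff_scale scale" "tensor_mul scale mul"
    by (rule nonassoc_algebra_tensor)
  let ?u = "tensor scale a (w p 0)" and ?v = "tensor scale b (w q 2)" and ?v' = "tensor scale c (w r 3)"
  have e: "?u \<in> envelope" "?v \<in> envelope" "?v' \<in> envelope"
    using abc by (intro env; simp)+
  then have "?v + ?v' \<in> envelope" by (intro T.subspace_add subspace_envelope)
  then have "?T ?u ?v ?v' + ?T ?u ?v' ?v = 0"
    using RA[OF e(1), of "?v + ?v'"] RA[OF e(1,2)] RA[OF e(1,3)]
    by (simp add: E.associator_add add.commute)
  then have "tensor scale (associator mul a b c
      + (if q \<and> r then - associator mul a c b else associator mul a c b)) W = 0"
    unfolding assoc W2 W_def[symmetric] by (cases p; cases q; cases r) (simp_all add: tensor_add_left tensor_diff_left tensor_minus)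
  moreover have "tensor scale (associator mul a b c
        + (if p \<and> (q \<noteq> r) then - associator mul b c a else associator mul b c a)
        + (if r \<and> (p \<noteq> q) then - associator mul c a b else associator mul c a b)) W = 0"
    using cyc[OF e] unfolding assoc W3 W4 W_def[symmetric]
    by (cases p; cases q; cases r) (simp_all add: tensor_add_left tensor_diff_left tensor_minus)
  ultimately show "associator mul a b c
      + (if q \<and> r then - associator mul a c b else associator mul a c b) = 0 \<and>
      associator mul a b c
        + (if p \<and> (q \<noteq> r) then - associator mul b c a else associator mul b c a)
        + (if r \<and> (p \<noteq> q) then - associator mul c a b else associator mul c a b) = 0"
    by (blast dest: inj)
qed

section \<open>From superidentities back to the Grassmann envelope\<close>

lemma inversions_swap:
  assumes "S |\<inter>| T = {||}"
  shows "inversions S T + inversions T S = fcard S * fcard T"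
proof -
  have disj: "fset S \<inter> fset T = {}" using assms by (metis bot_fset.rep_eq inf_fset.rep_eq)
  have T: "inversions T S = card {(s, t). s |\<in>| S \<and> t |\<in>| T \<and> s < t}"
    unfolding inversions_def
    by (rule bij_betw_same_card[of prod.swap]) (auto simp: bij_betw_def inj_on_def)
  have fin: "finite {(s, t). s |\<in>| S \<and> t |\<in>| T \<and> s < t}"
    by (rule finite_subset[of _ "fset S \<times> fset T"]) auto
  have "fset S \<times> fset T = {(s, t). s |\<in>| S \<and> t |\<in>| T \<and> t < s} \<union> {(s, t). s |\<in>| S \<and> t |\<in>| T \<and> s < t}"
    using disj by (auto simp: disjoint_iff) (metis linorder_cases)
  then have "card (fset S \<times> fset T) = inversions S T + inversions T S"
    unfolding T unfolding inversions_def
    by (simp add: finite_inversions fin card_Un_disjoint disjoint_iff)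
  then show ?thesis by (simp add: card_cartesian_product fcard.rep_eq)
qed

lemma gword_commute:
  "gmul (single T 1) (single S 1) =
    (if odd (fcard S) \<and> odd (fcard T) then - gmul (single S 1) (single T 1)
     else gmul (single S 1) (single T (1 :: 'k::field)))"
proof (cases "S |\<inter>| T = {||}")
  case True
  have "(- 1 :: 'k) ^ inversions T S = (- 1) ^ (inversions S T + inversions T S) * (- 1) ^ inversions S T"
    by (simp add: power_add ac_simps flip: power_mult_distrib)
  also have "\<dots> = (if odd (fcard S) \<and> odd (fcard T) then - ((- 1) ^ inversions S T) else (- 1) ^ inversions S T)"
    by (auto simp: inversions_swap[OF True])
  finally show ?thesis
    using True by (auto simp: gmul_single' inf_commute sup_commute single_uminus)
qed (auto simp: gmul_single' inf_commute)

lemma triadditive_eq_0: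
  fixes F :: "('i \<Rightarrow>\<^sub>0 'a::ab_group_add) \<Rightarrow> ('i \<Rightarrow>\<^sub>0 'a) \<Rightarrow> ('i \<Rightarrow>\<^sub>0 'a) \<Rightarrow> 'b::ab_group_add"
  assumes "\<And>u u' v w. F (u + u') v w = F u v w + F u' v w"
    and "\<And>u v v' w. F u (v + v') w = F u v w + F u v' w"
    and "\<And>u v w w'. F u v (w + w') = F u v w + F u v w'"
    and "\<And>i j k. F (single i (lookup u i)) (single j (lookup v j)) (single k (lookup w k)) = 0"
  shows "F u v w = 0"
proof -
  have "F (\<Sum>i\<in>keys u. single i (lookup u i)) v w
      = (\<Sum>i\<in>keys u. F (single i (lookup u i)) v w)" for v w
    by (rule additive.sum) (unfold_locales, rule assms(1))
  moreover have "F x (\<Sum>i\<in>keys v. single i (lookup v i)) w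
      = (\<Sum>i\<in>keys v. F x (single i (lookup v i)) w)" for x w
    by (rule additive.sum) (unfold_locales, rule assms(2))
  moreover have "F x y (\<Sum>i\<in>keys w. single i (lookup w i))
      = (\<Sum>i\<in>keys w. F x y (single i (lookup w i)))" for x y
    by (rule additive.sum) (unfold_locales, rule assms(3))
  ultimately show ?thesis by (simp add: poly_mapping_sum_single assms(4))
qed

text \<open>On basis words the signs from \<open>gword_commute\<close> depend only on parities and
  match those of the superidentities; additivity in each argument extends this to the whole
  envelope.\<close>

lemma minus_one_one_superalgebraI:
  fixes scale :: "'k::field_char_0 \<Rightarrow> 'a::ab_group_add \<Rightarrow> 'a"
  assumes "superalgebra scale mul X0 X1" "superalgebra.super_identities mul X0 X1"
  shows "minus_one_one_superalgebra scale mul X0 X1"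
proof -
  interpret superalgebra scale mul X0 X1 by fact
  interpret E: nonassoc_algebra "coeff_scale scale" "tensor_mul scale mul"
    by (rule nonassoc_algebra_tensor)
  let ?T = "associator (tensor_mul scale mul)"
  have assoc: "?T (single S a) (single U b) (single V c) =
      tensor scale (associator mul a b c) (gmul (gmul (single S 1) (single U 1)) (single V 1))"
    for a b c S U V
    by (simp only: single_eq_tensor[of _ a] single_eq_tensor[of _ b] single_eq_tensor[of _ c]
        associator_tensor)
  have words: "gmul (gmul (single S 1) (single V 1)) (single U 1) =
      (if odd (fcard U) \<and> odd (fcard V) then - gmul (gmul (single S 1) (single U 1)) (single V 1)
       else gmul (gmul (single S 1) (single U 1)) (single V (1 :: 'k)))"
    "gmul (gmul (single U 1) (single V 1)) (single S 1) =
      (if odd (fcard S) \<and> (odd (fcard U) \<noteq> odd (fcard V))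
       then - gmul (gmul (single S 1) (single U 1)) (single V 1)
       else gmul (gmul (single S 1) (single U 1)) (single V (1 :: 'k)))"
    "gmul (gmul (single V 1) (single S 1)) (single U 1) =
      (if odd (fcard V) \<and> (odd (fcard S) \<noteq> odd (fcard U))
       then - gmul (gmul (single S 1) (single U 1)) (single V 1)
       else gmul (gmul (single S 1) (single U 1)) (single V (1 :: 'k)))" for S U V
  proof -
    show 1: "gmul (gmul (single S 1) (single V 1)) (single U 1) =
      (if odd (fcard U) \<and> odd (fcard V) then - gmul (gmul (single S 1) (single U 1)) (single V 1)
       else gmul (gmul (single S 1) (single U 1)) (single V (1 :: 'k)))" for S U V
      by (simp add: gmul_assoc gword_commute[of V U] grassmann.mul_minus_right)
    have 2: "gmul (gmul (single V 1) (single S 1)) (single U 1) =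
      (if odd (fcard S) \<and> odd (fcard V) then - gmul (gmul (single S 1) (single V 1)) (single U 1)
       else gmul (gmul (single S 1) (single V 1)) (single U (1 :: 'k)))" for S U V
      by (simp add: gword_commute[of V S] grassmann.mul_minus_left)
    show "gmul (gmul (single V 1) (single S 1)) (single U 1) =
      (if odd (fcard V) \<and> (odd (fcard S) \<noteq> odd (fcard U))
       then - gmul (gmul (single S 1) (single U 1)) (single V 1)
       else gmul (gmul (single S 1) (single U 1)) (single V (1 :: 'k)))"
      unfolding 2[of V S U] 1[of S V U] by auto
    show "gmul (gmul (single U 1) (single V 1)) (single S 1) =
      (if odd (fcard S) \<and> (odd (fcard U) \<noteq> odd (fcard V))
       then - gmul (gmul (single S 1) (single U 1)) (single V 1)
       else gmul (gmul (single S 1) (single U 1)) (single V (1 :: 'k)))"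
      unfolding 1[of U V S] 2[of U S V] by auto
  qed
  have si: "associator mul a b c
        + (if q \<and> r then - associator mul a c b else associator mul a c b) = 0"
      "associator mul a b c
        + (if p \<and> (q \<noteq> r) then - associator mul b c a else associator mul b c a)
        + (if r \<and> (p \<noteq> q) then - associator mul c a b else associator mul c a b) = 0"
    if "a \<in> parity_part p" "b \<in> parity_part q" "c \<in> parity_part r" for p q r a b c
    using assms(2) that unfolding super_identities_def by blast+
  have part: "lookup u S \<in> parity_part (odd (fcard S))" if "u \<in> envelope" for u S
    using that unfolding envelope_iff by (cases "odd (fcard S)") (metis (full_types))+
  have minus: "tensor scale (if Q then - x else x) g = (if Q then - tensor scale x g else tensor scale x g)"
    "tensor scale x (if Q then - g else g) = (if Q then - tensor scale x g else tensor scale x g)"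
    for Q x g
    by (simp_all add: tensor_minus)
  have RA: "?T u v w + ?T u w v = 0" if "u \<in> envelope" "v \<in> envelope" "w \<in> envelope" for u v w
  proof (rule triadditive_eq_0[where F = "\<lambda>u v w. ?T u v w + ?T u w v"])
    fix S U V
    show "?T (single S (lookup u S)) (single U (lookup v U)) (single V (lookup w V)) +
        ?T (single S (lookup u S)) (single V (lookup w V)) (single U (lookup v U)) = 0"
      using arg_cong[OF si(1)[OF part[OF that(1), of S] part[OF that(2), of U] part[OF that(3), of V]],
          of "\<lambda>x. tensor scale x (gmul (gmul (single S 1) (single U 1)) (single V 1))"]
      unfolding assoc words(1)[of S V U] by (simp add: tensor_add_left minus)
  qed (simp_all add: E.associator_add algebra_simps)
  have cyc: "?T u v w + ?T v w u + ?T w u v = 0" if "u \<in> envelope" "v \<in> envelope" "w \<in> envelope" for u v w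
  proof (rule triadditive_eq_0[where F = "\<lambda>u v w. ?T u v w + ?T v w u + ?T w u v"])
    fix S U V
    show "?T (single S (lookup u S)) (single U (lookup v U)) (single V (lookup w V)) +
        ?T (single U (lookup v U)) (single V (lookup w V)) (single S (lookup u S)) +
        ?T (single V (lookup w V)) (single S (lookup u S)) (single U (lookup v U)) = 0"
      using arg_cong[OF si(2)[OF part[OF that(1), of S] part[OF that(2), of U] part[OF that(3), of V]],
          of "\<lambda>x. tensor scale x (gmul (gmul (single S 1) (single U 1)) (single V 1))"]
      unfolding assoc words(2)[of U V S] words(3)[of V S U] by (simp add: tensor_add_left minus)
  qed (simp_all add: E.associator_add algebra_simps)
  \<comment> \<open>Setting v = w in the linearized right alternative law yields only twice the
    associator (u, v, v), so division by 2 is required.\<close>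
  have half: "x = 0" if "x + x = 0" for x :: "nat fset \<Rightarrow>\<^sub>0 'a"
  proof -
    have "coeff_scale scale 2 x = 0" using that by (metis T.scale_left_distrib T.scale_one one_add_one)
    then show ?thesis using T.scale_eq_0_iff by auto
  qed
  show ?thesis
    by unfold_locales (auto simp: minus_one_one_on_def intro: half RA cyc)
qed

declare One_nat_def [simp del]

section \<open>A model of the free superalgebra\<close>

text \<open>This is Shestakov's superalgebra \<open>B(\<Gamma>, D, \<gamma>)\<close> for \<open>\<Gamma> = \<Phi>[\<gamma>, D \<gamma>, D\<^sup>2 \<gamma>, \<dots>]\<close>: the pair \<open>(a, b)\<close>
  stands for \<open>a + bx\<close>, where \<open>ax \<cdot> bx = \<gamma>ab + 2D(a)b + aD(b)\<close>.\<close>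

type_synonym 'k model = "'k dpoly \<times> 'k dpoly"

definition model_scale :: "'k::field_char_0 \<Rightarrow> 'k model \<Rightarrow> 'k model" where
  "model_scale c u = (single 0 c * fst u, single 0 c * snd u)"

definition model_mul :: "'k::field_char_0 model \<Rightarrow> 'k model \<Rightarrow> 'k model" where
  "model_mul u v =
     (fst u * fst v + odd_product (snd u) (snd v), fst u * snd v + snd u * fst v)"

definition model_even :: "'k::field_char_0 model set" where
  "model_even = {u. snd u = 0}"

definition model_odd :: "'k::field_char_0 model set" where
  "model_odd = {u. fst u = 0}"

lemma dderiv_numeral [simp]: "dderiv (numeral k) = 0"
  using dderiv_const[of "numeral k"] by simp

lemma odd_product_zero [simp]: "odd_product 0 b = 0" "odd_product a 0 = 0"
  by (simp_all add: odd_product_def)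

interpretation model: superalgebra "model_scale :: 'k::field_char_0 \<Rightarrow> _" model_mul model_even model_odd
proof -
  have sc: "single 0 (a * b) = single 0 a * (single 0 b :: 'k dpoly)" for a b :: 'k
    by (simp add: mult_single)
  interpret nonassoc_algebra "model_scale :: 'k \<Rightarrow> _" model_mul
    by unfold_locales
      (auto simp: model_scale_def model_mul_def odd_product_def dderiv_add dderiv_mult dderiv_const
        single_add sc algebra_simps prod_eq_iff)
  have "\<exists>a\<in>model_even. \<exists>b\<in>model_odd. x = a + b" for x :: "'k model"
    by (rule bexI[of _ "(fst x, 0)"], rule bexI[of _ "(0, snd x)"])
      (auto simp: model_even_def model_odd_def prod_eq_iff)
  then show "superalgebra (model_scale :: 'k \<Rightarrow> _) model_mul model_even model_odd"
    by unfold_locales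
      (auto simp: model_even_def model_odd_def subspace_def model_scale_def model_mul_def prod_eq_iff)
qed

lemma model_minus_one_one_superalgebra:
  "minus_one_one_superalgebra (model_scale :: 'k::field_char_0 \<Rightarrow> _) model_mul model_even model_odd"
proof (rule minus_one_one_superalgebraI)
  show "model.super_identities TYPE('k)"
    unfolding model.super_identities_def
  proof (intro allI ballI)
    fix p q r and a b c :: "'k model"
    assume "a \<in> (if p then model_odd else model_even)" "b \<in> (if q then model_odd else model_even)"
      "c \<in> (if r then model_odd else model_even)"
    then show "associator model_mul a b c
        + (if q \<and> r then - associator model_mul a c b else associator model_mul a c b) = 0 \<and>
      associator model_mul a b c
        + (if p \<and> (q \<noteq> r) then - associator model_mul b c a else associator model_mul b c a)
        + (if r \<and> (p \<noteq> q) then - associator model_mul c a b else associator model_mul c a b) = 0"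
      by (cases a; cases b; cases c; cases p; cases q; cases r)
        (simp_all add: model_even_def model_odd_def associator_def model_mul_def odd_product_def
          dderiv_add dderiv_mult algebra_simps zero_prod_def)
  qed
qed (rule model.superalgebra_axioms)

definition model_hom :: "'k::field_char_0 free11 \<Rightarrow> 'k model" where
  "model_hom = (SOME \<phi>. algebra_hom free11_scale free11_mul model_scale model_mul \<phi> \<and>
     \<phi> free11_gen = (0, 1))"

lemma model_hom:
  "algebra_hom free11_scale free11_mul (model_scale :: 'k::field_char_0 \<Rightarrow> _) model_mul model_hom"
  "model_hom (free11_gen :: 'k free11) = (0, 1)"
proof -
  have "(0, 1) \<in> (model_odd :: 'k model set)" by (simp add: model_odd_def)
  from free11_universal[OF model_minus_one_one_superalgebra this]
  have "\<exists>\<phi>. algebra_hom free11_scale free11_mul (model_scale :: 'k \<Rightarrow> _) model_mul \<phi> \<and>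
      \<phi> free11_gen = (0, 1)" by blast
  from someI_ex[OF this]
  show "algebra_hom free11_scale free11_mul (model_scale :: 'k \<Rightarrow> _) model_mul model_hom"
    "model_hom (free11_gen :: 'k free11) = (0, 1)"
    unfolding model_hom_def by blast+
qed

interpretation model_hom: algebra_hom free11_scale free11_mul "model_scale :: 'k::field_char_0 \<Rightarrow> _"
  model_mul model_hom
  by (rule model_hom)


section \<open>The base monomials\<close>

definition R_power :: "nat \<Rightarrow> 'k::field_char_0 free11" where
  "R_power j = (R_op free11_mul free11_gen ^^ j) (free11_mul free11_gen free11_gen)"

lemma R_power_0: "R_power 0 = free11_mul free11_gen free11_gen"
  and R_power_Suc: "R_power (Suc j) = associator free11_mul (R_power j) free11_gen free11_gen"
  by (simp_all add: R_power_def R_op_def)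

text \<open>The new index bounds all earlier ones, which mirrors the left-normed products in
  \<open>base_monomial\<close>: their factors are sorted by index, so the added factor stands
  last.\<close>

lemma monomial_induct [case_names zero add]:
  assumes zero: "P 0"
    and add: "\<And>m j. P m \<Longrightarrow> \<forall>k\<in>keys m. k \<le> j \<Longrightarrow> P (m + single j 1)"
  shows "P (m :: nat \<Rightarrow>\<^sub>0 nat)"
proof (induction "weight m" arbitrary: m rule: less_induct)
  case less
  show ?case
  proof (cases "m = 0")
    case False
    let ?j = "Max (keys m)" and ?m = "m - single (Max (keys m)) 1"
    from False have "?j \<in> keys m" by (intro Max_in) auto
    then have m: "m = ?m + single ?j 1" by (intro monomial_split) (simp add: in_keys_iff)
    have "weight ?m < weight m" by (subst (2) m) (simp add: weight_add weight_single)
    moreover have "\<forall>k\<in>keys ?m. k \<le> ?j"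
      by (auto simp: in_keys_iff lookup_minus intro!: Max_ge)
    ultimately show ?thesis using add less m by metis
  qed (use zero in simp)
qed

lemma power_factors_last:
  assumes "\<forall>k\<in>keys m. k \<le> j"
  shows "power_factors mul x a m =
    concat (map (\<lambda>i. replicate (lookup m i) ((R_op mul x ^^ i) a)) (sorted_list_of_set (keys m - {j})))
      @ replicate (lookup m j) ((R_op mul x ^^ j) a)"
proof (cases "j \<in> keys m")
  case True
  let ?xs = "sorted_list_of_set (keys m - {j})"
  have "sorted (?xs @ [j])" "distinct (?xs @ [j])"
    using assms by (auto simp: sorted_append)
  moreover have "set (?xs @ [j]) = keys m" using True by auto
  ultimately have "sorted_list_of_set (keys m) = ?xs @ [j]"
    by (metis sorted_list_of_set.idem_if_sorted_distinct)
  then show ?thesis by (simp add: power_factors_def)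
qed (simp add: power_factors_def in_keys_iff)

lemma power_factors_add:
  assumes "\<forall>k\<in>keys m. k \<le> j"
  shows "power_factors mul x a (m + single j 1) = power_factors mul x a m @ [(R_op mul x ^^ j) a]"
proof -
  have keys: "keys (m + single j 1) - {j} = keys m - {j}"
    by (auto simp: in_keys_iff lookup_add lookup_single when_def)
  have "\<forall>k\<in>keys (m + single j 1). k \<le> j"
    using assms Poly_Mapping.keys_add[of m "single j 1"] by auto
  moreover have "map (\<lambda>i. replicate (lookup (m + single j 1) i) ((R_op mul x ^^ i) a))
        (sorted_list_of_set (keys m - {j})) =
      map (\<lambda>i. replicate (lookup m i) ((R_op mul x ^^ i) a)) (sorted_list_of_set (keys m - {j}))"
    by (auto simp: lookup_add lookup_single when_def)
  moreover have "replicate (Suc n) y = replicate n y @ [y]" for n and y :: 'a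
    by (simp add: replicate_append_same)
  ultimately show ?thesis
    by (simp only: power_factors_last[OF assms] power_factors_last keys lookup_add lookup_single_eq
        append_assoc Suc_eq_plus1[symmetric])
qed

lemma power_factors_eq_Nil_iff: "power_factors mul x a m = [] \<longleftrightarrow> m = 0"
  by (induction m rule: monomial_induct) (auto simp: power_factors_add poly_mapping_eq_iff
      fun_eq_iff lookup_add lookup_single when_def, simp add: power_factors_def)

lemma left_normed_snoc: "xs \<noteq> [] \<Longrightarrow> left_normed mul (xs @ [y]) = mul (left_normed mul xs) y"
  by (cases xs) simp_all

lemma base_monomial_0: "base_monomial 0 0 = 0" "base_monomial 0 1 = free11_gen"
  by (simp_all add: base_monomial_def power_factors_def One_nat_def)

lemma base_monomial_add:
  assumes "\<forall>k\<in>keys m. k \<le> j"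
  shows "(base_monomial (m + single j 1) 0 :: 'k::field_char_0 free11) =
    (if m = 0 then R_power j else free11_mul (base_monomial m 0) (R_power j))"
  using power_factors_eq_Nil_iff[of free11_mul "free11_gen :: 'k free11" "free11_mul free11_gen free11_gen" m]
  by (auto simp: base_monomial_def power_factors_add[OF assms] left_normed_snoc R_power_def)

lemma base_monomial_odd:
  "m \<noteq> 0 \<Longrightarrow> base_monomial m 1 = free11_mul (base_monomial m 0) free11_gen"
  by (simp add: base_monomial_def left_normed_snoc power_factors_eq_Nil_iff One_nat_def)

text \<open>Since R_{x,x} acts in the model as 2D, \<open>R_power j\<close> corresponds to 2^j times
  \<open>dvar j\<close>. These exponents add up over the factors of a monomial.\<close>

definition two_exponent :: "(nat \<Rightarrow>\<^sub>0 nat) \<Rightarrow> nat" where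
  "two_exponent m = lin_ext (\<lambda>j n. n * j) m"

lemma two_exponent_add: "two_exponent (m + m') = two_exponent m + two_exponent m'"
  unfolding two_exponent_def by (rule lin_ext_add) (simp_all add: algebra_simps)

lemma two_exponent_single: "two_exponent (single j n) = n * j"
  by (simp add: two_exponent_def lin_ext_single)

lemma two_exponent_0 [simp]: "two_exponent 0 = 0"
  by (simp add: two_exponent_def lin_ext_def)

lemma model_hom_R_power:
  "model_hom (R_power j :: 'k::field_char_0 free11) = (single (single j 1) (2 ^ j), 0)"
proof (induction j)
  case 0
  show ?case
    by (simp add: R_power_0 model_hom.hom_mul model_hom(2) model_mul_def odd_product_def dvar_def)
next
  case (Suc j)
  have assoc: "associator model_mul (p, 0) (0, 1) (0, 1) = (2 * dderiv p, 0)" for p :: "'k dpoly"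
    by (simp add: associator_def model_mul_def odd_product_def mult.commute)
  have D: "dderiv (single (single j 1) (2 ^ j) :: 'k dpoly) = single (single (Suc j) 1) (2 ^ j)"
    by (simp add: dderiv_single deriv_monomial_def mult_single)
  have "model_hom (R_power (Suc j) :: 'k free11)
      = associator model_mul (model_hom (R_power j)) (0, 1) (0, 1)"
    by (simp add: R_power_Suc associator_def model_hom.hom_mul model_hom.diff model_hom(2))
  also have "\<dots> = (2 * single (single (Suc j) 1) (2 ^ j), 0)"
    unfolding Suc assoc D ..
  also have "2 * single (single (Suc j) 1) (2 ^ j) = (single (single (Suc j) 1) (2 ^ Suc j) :: 'k dpoly)"
    by (simp add: mult_single flip: single_numeral)
  finally show ?case .
qed

lemma model_hom_base_monomial:
  "m \<noteq> 0 \<Longrightarrow> model_hom (base_monomial m 0) = (single m (2 ^ two_exponent m), 0)"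
proof (induction m rule: monomial_induct)
  case (add m j)
  then show ?case
    unfolding base_monomial_add[OF add(2)]
    by (cases "m = 0") (simp_all add: model_hom_R_power model_hom.hom_mul
        model_mul_def mult_single two_exponent_add two_exponent_single power_add)
qed simp

lemma model_hom_base_monomial_odd:
  "model_hom (base_monomial m 1) = (0, single m (2 ^ two_exponent m))"
  by (cases "m = 0") (simp_all add: base_monomial_0 base_monomial_odd model_hom(2)
      model_hom.hom_mul model_hom_base_monomial model_mul_def)

section \<open>Multiplicativity of the parametrization\<close>

text \<open>\<open>psi 0\<close> and \<open>psi 1\<close> are \<open>\<psi>\<close> on \<open>\<Gamma>\<close> and on \<open>\<Gamma>x\<close>.  Since \<open>base_monomial 0 0 = 0\<close>, constants are
  killed by \<open>psi 0\<close>, hence the positivity assumptions on the weights of even elements.\<close>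

definition psi :: "nat \<Rightarrow> 'k::field_char_0 dpoly \<Rightarrow> 'k free11" where
  "psi \<epsilon> p = lin_ext (\<lambda>m c. free11_scale (c / 2 ^ two_exponent m) (base_monomial m \<epsilon>)) p"

lemma psi_add: "psi \<epsilon> (p + q) = psi \<epsilon> p + psi \<epsilon> q"
  unfolding psi_def by (rule lin_ext_add) (simp_all add: add_divide_distrib free11.scale_left_distrib)

lemma additive_psi: "additive (psi \<epsilon>)"
  by unfold_locales (rule psi_add)

lemmas psi_diff = additive.diff[OF additive_psi] and psi_sum = additive.sum[OF additive_psi]
  and psi_zero [simp] = additive.zero[OF additive_psi]

lemma psi_single:
  "psi \<epsilon> (single m c) = free11_scale (c / 2 ^ two_exponent m) (base_monomial m \<epsilon>)"
  by (simp add: psi_def lin_ext_single)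

lemma psi_scale: "psi \<epsilon> (single 0 c * p) = free11_scale c (psi \<epsilon> p)"
proof -
  have "psi \<epsilon> (single 0 c * (\<Sum>m\<in>keys p. single m (lookup p m))) =
      free11_scale c (psi \<epsilon> (\<Sum>m\<in>keys p. single m (lookup p m)))"
    by (simp add: sum_distrib_left psi_sum free11.scale_sum_right mult_single psi_single)
  then show ?thesis by (simp add: poly_mapping_sum_single)
qed

lemma psi_one: "psi 1 1 = free11_gen" "psi 0 1 = 0"
  using psi_single[of 1 0 1] psi_single[of 0 0 1] by (simp_all add: base_monomial_0)

lemma psi_dvar: "psi 0 (dvar j) = free11_scale (1 / 2 ^ j) (R_power j)"
  using base_monomial_add[of 0 j]
  by (simp add: dvar_def psi_single two_exponent_single)

lemma psi_dvar_0: "psi 0 (dvar 0) = free11_mul free11_gen free11_gen"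
  by (simp add: psi_dvar R_power_0)

lemma psi_dvar_Suc:
  "free11_scale 2 (psi 0 (dvar (Suc j))) = associator free11_mul (psi 0 (dvar j)) free11_gen free11_gen"
  by (simp add: psi_dvar R_power_Suc associator_def free11.mul_scale_left free11.scale_right_diff_distrib)

lemma psi_odd:
  fixes p :: "'k::field_char_0 dpoly"
  assumes "p \<in> homogeneous i" "0 < i"
  shows "free11_mul (psi 0 p) free11_gen = psi 1 p"
proof -
  have "free11_mul (psi 0 (single m c)) free11_gen = psi 1 (single m c)" if "m \<in> keys p" for m and c :: 'k
  proof -
    have "m \<noteq> 0" using that assms by (auto simp: homogeneous_def)
    then show ?thesis by (simp add: psi_single base_monomial_odd free11.mul_scale_left)
  qed
  then have "free11_mul (psi 0 (\<Sum>m\<in>keys p. single m (lookup p m))) free11_gen =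
      psi 1 (\<Sum>m\<in>keys p. single m (lookup p m))"
    by (simp add: psi_sum free11.mul_sum_left cong: sum.cong)
  then show ?thesis by (simp add: poly_mapping_sum_single)
qed

text \<open>A factor of maximal index stands last in the base monomial. This case of even
  multiplicativity, which holds by construction, is the starting point for all others.\<close>

lemma psi_last:
  assumes "m \<noteq> 0" "\<forall>k\<in>keys m. k \<le> j"
  shows "free11_mul (psi 0 (single m 1)) (psi 0 (dvar j)) =
    (psi 0 (single m 1 * dvar j) :: 'k::field_char_0 free11)"
proof -
  have "psi 0 (single m 1 * dvar j) =
      (free11_scale (1 / 2 ^ two_exponent (m + single j 1)) (base_monomial (m + single j 1) 0) :: 'k free11)"
    by (simp add: dvar_def mult_single psi_single)
  then show ?thesis
    unfolding base_monomial_add[OF assms(2)] using assms(1)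
    by (simp add: psi_dvar psi_single free11.mul_scale_left free11.mul_scale_right
        two_exponent_add two_exponent_single power_add mult.commute)
qed

lemma R_power_even: "R_power j \<in> free11_even"
  by (induction j) (simp_all add: R_power_0 R_power_Suc associator_def free11.subspace_diff
      free11.subspace_even free11.mul_odd_odd free11.mul_even_odd free11.mul_even_even
      free11_gen_odd)

lemma base_monomial_even: "base_monomial m 0 \<in> (free11_even :: 'k::field_char_0 free11 set)"
proof (induction m rule: monomial_induct)
  case zero
  then show ?case using free11.subspace_0[OF free11.subspace_even] by (simp add: base_monomial_0)
next
  case (add m j)
  then show ?case
    unfolding base_monomial_add[OF add(2)] by (auto intro: R_power_even free11.mul_even_even)
qed

lemma psi_even: "psi 0 p \<in> free11_even"
  unfolding psi_def lin_ext_def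
  by (intro free11.subspace_sum free11.subspace_scale free11.subspace_even base_monomial_even)

lemma base_monomial_odd_part: "base_monomial m 1 \<in> (free11_odd :: 'k::field_char_0 free11 set)"
  by (cases "m = 0") (auto simp: base_monomial_0 base_monomial_odd
      intro: free11_gen_odd free11.mul_even_odd base_monomial_even)

lemma psi_odd_part: "psi 1 p \<in> free11_odd"
  unfolding psi_def lin_ext_def
  by (intro free11.subspace_sum free11.subspace_scale free11.subspace_odd base_monomial_odd_part)

text \<open>Restrict scalars to the rational numbers: the coordinates with respect to a basis over
  them are additive and determine the vector.\<close>

lemma rat_functional_eq_0:
  fixes scale :: "'k::field_char_0 \<Rightarrow> 'a::ab_group_add \<Rightarrow> 'a"
  assumes "vector_space scale" and zero: "\<And>f :: 'a \<Rightarrow> rat. additive f \<Longrightarrow> f v = 0"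
  shows "v = 0"
proof -
  interpret vector_space scale by fact
  interpret Q: vector_space "\<lambda>q. scale (of_rat q)"
    by unfold_locales (simp_all add: scale_right_distrib scale_left_distrib of_rat_add of_rat_mult)
  define B where "B = Q.extend_basis {}"
  have B: "Q.independent B" "Q.span B = UNIV"
    using Q.independent_extend_basis[OF Q.independent_empty] Q.span_extend_basis[OF Q.independent_empty]
    unfolding B_def by auto
  have "Q.representation B v b = 0" for b
    by (rule zero, unfold_locales) (simp add: Q.representation_add B)
  then show ?thesis
    using Q.sum_nonzero_representation_eq[OF B(1), of v] B(2) by simp
qed

text \<open>Both clauses concern products of degree 2 m in x, as \<open>psi 0\<close> doubles the
  weight and \<open>psi 1\<close> doubles it and adds 1; \<open>mult_odd\<close> is the assertion in
  degree 2 m + 1. The induction on the degree thus alternates between the two, the even assertion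
  coming first for each m.\<close>

definition mult_even :: "nat \<Rightarrow> 'k::field_char_0 itself \<Rightarrow> bool" where
  "mult_even m _ \<longleftrightarrow> (\<forall>i j. \<forall>a\<in>homogeneous i. \<forall>b\<in>homogeneous j :: 'k dpoly set.
     (0 < i \<and> 0 < j \<and> i + j = m \<longrightarrow> free11_mul (psi 0 a) (psi 0 b) = psi 0 (a * b)) \<and>
     (i + j + 1 = m \<longrightarrow> free11_mul (psi 1 a) (psi 1 b) = psi 0 (odd_product a b)))"

definition mult_odd :: "nat \<Rightarrow> 'k::field_char_0 itself \<Rightarrow> bool" where
  "mult_odd m _ \<longleftrightarrow> (\<forall>i j. \<forall>a\<in>homogeneous i. \<forall>b\<in>homogeneous j :: 'k dpoly set.
     0 < i \<and> i + j = m \<longrightarrow> free11_mul (psi 0 a) (psi 1 b) = psi 1 (a * b) \<and>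
       free11_mul (psi 1 b) (psi 0 a) = psi 1 (a * b))"

lemma mult_evenD:
  assumes "mult_even m TYPE('k::field_char_0)" "a \<in> homogeneous i" "b \<in> (homogeneous j :: 'k dpoly set)"
  shows "0 < i \<Longrightarrow> 0 < j \<Longrightarrow> i + j = m \<Longrightarrow> free11_mul (psi 0 a) (psi 0 b) = psi 0 (a * b)"
    "i + j + 1 = m \<Longrightarrow> free11_mul (psi 1 a) (psi 1 b) = psi 0 (odd_product a b)"
  using assms unfolding mult_even_def by blast+

lemma mult_oddD:
  assumes "mult_odd m TYPE('k::field_char_0)" "a \<in> homogeneous i" "b \<in> (homogeneous j :: 'k dpoly set)"
    "0 < i" "i + j = m"
  shows "free11_mul (psi 0 a) (psi 1 b) = psi 1 (a * b)"
    "free11_mul (psi 1 b) (psi 0 a) = psi 1 (a * b)"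
  using assms unfolding mult_odd_def by blast+

section \<open>The defects of \<open>psi\<close> as cocycles\<close>

lemma free11_super_identities:
  assumes "a \<in> free11.parity_part p" "b \<in> free11.parity_part q" "c \<in> free11.parity_part r"
  shows "associator free11_mul a b c
      + (if q \<and> r then - associator free11_mul a c b else associator free11_mul a c b) = 0"
    "associator free11_mul a b c
      + (if p \<and> (q \<noteq> r) then - associator free11_mul b c a else associator free11_mul b c a)
      + (if r \<and> (p \<noteq> q) then - associator free11_mul c a b else associator free11_mul c a b) = 0"
  using free11.super_identities assms unfolding free11.super_identities_def by blast+

lemma psi_identities:
  fixes a b c :: "'k::field_char_0 dpoly"
  defines "A \<equiv> associator (free11_mul :: 'k free11 \<Rightarrow> _)"
  shows "A (psi 0 a) (psi 0 b) (psi 0 c) + A (psi 0 a) (psi 0 c) (psi 0 b) = 0"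
    "A (psi 0 a) (psi 1 b) (psi 1 c) - A (psi 0 a) (psi 1 c) (psi 1 b) = 0"
    "A (psi 1 b) (psi 1 c) (psi 0 a) + A (psi 1 b) (psi 0 a) (psi 1 c) = 0"
    "A (psi 0 a) (psi 1 b) (psi 1 c) + A (psi 1 b) (psi 1 c) (psi 0 a)
      - A (psi 1 c) (psi 0 a) (psi 1 b) = 0"
    "A (psi 0 a) (psi 0 b) (psi 1 c) + A (psi 0 a) (psi 1 c) (psi 0 b) = 0"
    "A (psi 1 c) (psi 0 a) (psi 0 b) + A (psi 1 c) (psi 0 b) (psi 0 a) = 0"
    "A (psi 1 a) (psi 1 b) (psi 1 c) - A (psi 1 a) (psi 1 c) (psi 1 b) = 0"
    "A (psi 1 a) (psi 1 b) (psi 1 c) + A (psi 1 b) (psi 1 c) (psi 1 a)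
      + A (psi 1 c) (psi 1 a) (psi 1 b) = 0"
  using free11_super_identities[of "psi 0 a" False "psi 0 b" False "psi 0 c" False]
    free11_super_identities[of "psi 0 a" False "psi 1 b" True "psi 1 c" True]
    free11_super_identities[of "psi 1 b" True "psi 1 c" True "psi 0 a" False]
    free11_super_identities[of "psi 0 a" False "psi 0 b" False "psi 1 c" True]
    free11_super_identities[of "psi 1 c" True "psi 0 a" False "psi 0 b" False]
    free11_super_identities[of "psi 1 a" True "psi 1 b" True "psi 1 c" True]
  unfolding A_def by (simp_all add: psi_even psi_odd_part)

lemma homogeneous_odd_product:
  assumes "a \<in> homogeneous i" "b \<in> homogeneous j" "d = i + j + 1"
  shows "odd_product a b \<in> homogeneous d"
proof -
  have g: "dvar 0 \<in> homogeneous 1" using homogeneous_dvar[of 0] by (simp add: One_nat_def)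
  have "dvar 0 * a * b \<in> homogeneous d"
    using homogeneous_mult[OF homogeneous_mult[OF g assms(1) refl] assms(2)] assms(3)
    by (simp add: ac_simps)
  moreover have "dderiv a * b \<in> homogeneous d" "a * dderiv b \<in> homogeneous d"
    using homogeneous_mult[OF homogeneous_dderiv[OF assms(1)] assms(2)]
      homogeneous_mult[OF assms(1) homogeneous_dderiv[OF assms(2)]] assms(3)
    by (simp_all add: One_nat_def)
  ultimately show ?thesis
    unfolding odd_product_def mult_2 distrib_right by (intro homogeneous_add)
qed

text \<open>An inner product of an associator omits a factor of positive degree, so the hypotheses
  evaluate it. Subtracting \<open>psi\<close> of the same superidentity in the model, stated in each
  case as a polynomial identity for \<open>odd_product\<close>, turns the superidentity of the free
  superalgebra into one for the defects.\<close>

lemma even_cocycle: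
  fixes f :: "'k::field_char_0 free11 \<Rightarrow> rat"
  assumes "additive f" and ev: "\<And>m. m < n \<Longrightarrow> mult_even m TYPE('k)"
    and od: "\<And>m. m < n \<Longrightarrow> mult_odd m TYPE('k)"
  shows "even_cocycle n (\<lambda>a b. f (free11_mul (psi 0 a) (psi 0 b) - psi 0 (a * b)))
    (\<lambda>a b. f (free11_mul (psi 1 a) (psi 1 b) - psi 0 (odd_product a b)))"
proof
  interpret f: additive f by fact
  note fs = f.add f.diff psi_add psi_diff
  have two: "f (psi \<epsilon> (2 * p)) = 2 * f (psi \<epsilon> p)" for \<epsilon> p
    by (simp only: mult_2 psi_add f.add)
  fix a b c :: "'k dpoly" and i j k
  show "f (free11_mul (psi 0 (a + b)) (psi 0 c) - psi 0 ((a + b) * c)) =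
      f (free11_mul (psi 0 a) (psi 0 c) - psi 0 (a * c)) + f (free11_mul (psi 0 b) (psi 0 c) - psi 0 (b * c))"
    "f (free11_mul (psi 0 a) (psi 0 (b + c)) - psi 0 (a * (b + c))) =
      f (free11_mul (psi 0 a) (psi 0 b) - psi 0 (a * b)) + f (free11_mul (psi 0 a) (psi 0 c) - psi 0 (a * c))"
    by (simp_all add: fs free11.mul_add_left free11.mul_add_right distrib_left distrib_right)
  assume a: "a \<in> homogeneous i" and b: "b \<in> homogeneous j" and c: "c \<in> homogeneous k" and i: "0 < i"
  {
    assume jk: "0 < j" "0 < k" and n: "i + j + k = n"
    have "free11_mul (psi 0 a) (psi 0 b) = psi 0 (a * b)" "free11_mul (psi 0 b) (psi 0 c) = psi 0 (b * c)"
      "free11_mul (psi 0 a) (psi 0 c) = psi 0 (a * c)" "free11_mul (psi 0 c) (psi 0 b) = psi 0 (c * b)"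
      using mult_evenD(1)[OF ev a b] mult_evenD(1)[OF ev b c] mult_evenD(1)[OF ev a c]
        mult_evenD(1)[OF ev c b] i jk n by auto
    then show "f (free11_mul (psi 0 (a * b)) (psi 0 c) - psi 0 (a * b * c)) +
        f (free11_mul (psi 0 (a * c)) (psi 0 b) - psi 0 (a * c * b)) =
        2 * f (free11_mul (psi 0 a) (psi 0 (b * c)) - psi 0 (a * (b * c)))"
      using arg_cong[OF psi_identities(1)[of a b c], of f]
      by (simp add: associator_def fs f.zero) (simp add: ac_simps)
  next
    assume n: "i + j + k + 1 = n"
    have oo: "free11_mul (psi 1 b) (psi 1 c) = psi 0 (odd_product b c)"
      "free11_mul (psi 1 c) (psi 1 b) = psi 0 (odd_product c b)"
      using mult_evenD(2)[OF ev b c] mult_evenD(2)[OF ev c b] i n by auto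
    have eo: "free11_mul (psi 0 a) (psi 1 b) = psi 1 (a * b)" "free11_mul (psi 1 b) (psi 0 a) = psi 1 (a * b)"
      "free11_mul (psi 0 a) (psi 1 c) = psi 1 (c * a)" "free11_mul (psi 1 c) (psi 0 a) = psi 1 (c * a)"
      using mult_oddD[OF od a b] mult_oddD[OF od a c] i n by (auto simp: mult.commute)
    have "odd_product (a * b) c + a * odd_product c b = odd_product (a * c) b + a * odd_product b c"
      by (simp add: odd_product_def dderiv_mult algebra_simps)
    from arg_cong[OF this, of "\<lambda>p. f (psi 0 p)"]
    show "f (free11_mul (psi 1 (a * b)) (psi 1 c) - psi 0 (odd_product (a * b) c)) -
        f (free11_mul (psi 0 a) (psi 0 (odd_product b c)) - psi 0 (a * odd_product b c)) =
        f (free11_mul (psi 1 (a * c)) (psi 1 b) - psi 0 (odd_product (a * c) b)) -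
        f (free11_mul (psi 0 a) (psi 0 (odd_product c b)) - psi 0 (a * odd_product c b))"
      using arg_cong[OF psi_identities(2)[of a b c], of f]
      by (simp add: associator_def fs f.zero oo eo mult.commute[of c a])
    have "odd_product b c * a + odd_product (a * b) c = odd_product b (c * a) + odd_product b (c * a)"
      by (simp add: odd_product_def dderiv_mult algebra_simps)
    from arg_cong[OF this, of "\<lambda>p. f (psi 0 p)"]
    show "f (free11_mul (psi 0 (odd_product b c)) (psi 0 a) - psi 0 (odd_product b c * a)) -
        2 * f (free11_mul (psi 1 b) (psi 1 (c * a)) - psi 0 (odd_product b (c * a))) +
        f (free11_mul (psi 1 (a * b)) (psi 1 c) - psi 0 (odd_product (a * b) c)) = 0"
      using arg_cong[OF psi_identities(3)[of b c a], of f]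
      by (simp add: associator_def fs f.zero oo eo two)
    have "odd_product (a * b) c + odd_product b c * a + odd_product c (a * b) =
        a * odd_product b c + odd_product b (c * a) + odd_product (c * a) b"
      by (simp add: odd_product_def dderiv_mult algebra_simps)
    from arg_cong[OF this, of "\<lambda>p. f (psi 0 p)"]
    show "f (free11_mul (psi 1 (a * b)) (psi 1 c) - psi 0 (odd_product (a * b) c)) -
        f (free11_mul (psi 0 a) (psi 0 (odd_product b c)) - psi 0 (a * odd_product b c)) +
        (f (free11_mul (psi 0 (odd_product b c)) (psi 0 a) - psi 0 (odd_product b c * a)) -
         f (free11_mul (psi 1 b) (psi 1 (c * a)) - psi 0 (odd_product b (c * a)))) =
        f (free11_mul (psi 1 (c * a)) (psi 1 b) - psi 0 (odd_product (c * a) b)) -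
        f (free11_mul (psi 1 c) (psi 1 (a * b)) - psi 0 (odd_product c (a * b)))"
      using arg_cong[OF psi_identities(4)[of a b c], of f]
      by (simp add: associator_def fs f.zero oo eo)
  }
qed

text \<open>The even assertion is required up to n inclusive: if c has weight 0, the inner product
  of the first two factors, \<open>a * b\<close> or \<open>odd_product a b\<close>, already has
  weight n.\<close>

lemma odd_cocycle:
  fixes f :: "'k::field_char_0 free11 \<Rightarrow> rat"
  assumes "additive f" and ev: "\<And>m. m \<le> n \<Longrightarrow> mult_even m TYPE('k)"
    and od: "\<And>m. m < n \<Longrightarrow> mult_odd m TYPE('k)"
  shows "odd_cocycle n (\<lambda>a b. f (free11_mul (psi 0 a) (psi 1 b) - psi 1 (a * b)))
    (\<lambda>a b. f (free11_mul (psi 1 a) (psi 0 b) - psi 1 (a * b)))"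
proof
  interpret f: additive f by fact
  note fs = f.add f.diff psi_add psi_diff
  fix a b c :: "'k dpoly" and i j k
  show "f (free11_mul (psi 0 (a + b)) (psi 1 c) - psi 1 ((a + b) * c)) =
      f (free11_mul (psi 0 a) (psi 1 c) - psi 1 (a * c)) + f (free11_mul (psi 0 b) (psi 1 c) - psi 1 (b * c))"
    "f (free11_mul (psi 1 a) (psi 0 (b + c)) - psi 1 (a * (b + c))) =
      f (free11_mul (psi 1 a) (psi 0 b) - psi 1 (a * b)) + f (free11_mul (psi 1 a) (psi 0 c) - psi 1 (a * c))"
    by (simp_all add: fs free11.mul_add_left free11.mul_add_right distrib_left distrib_right)
  show "f (free11_mul (psi 0 a) (psi 1 1) - psi 1 (a * 1)) = 0" if "a \<in> homogeneous n" "0 < n"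
    using psi_odd[OF that] by (simp add: psi_one f.zero)
  assume a: "a \<in> homogeneous i" and b: "b \<in> homogeneous j" and c: "c \<in> homogeneous k"
  {
    assume ij: "0 < i" "0 < j" and n: "i + j + k = n"
    have ee: "free11_mul (psi 0 a) (psi 0 b) = psi 0 (a * b)" "free11_mul (psi 0 b) (psi 0 a) = psi 0 (a * b)"
      using mult_evenD(1)[OF ev a b] mult_evenD(1)[OF ev b a] ij n by (auto simp: mult.commute)
    have eo: "free11_mul (psi 0 a) (psi 1 c) = psi 1 (a * c)" "free11_mul (psi 1 c) (psi 0 a) = psi 1 (a * c)"
      "free11_mul (psi 0 b) (psi 1 c) = psi 1 (b * c)" "free11_mul (psi 1 c) (psi 0 b) = psi 1 (b * c)"
      using mult_oddD[OF od a c] mult_oddD[OF od b c] ij n by auto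
    show "f (free11_mul (psi 0 (a * b)) (psi 1 c) - psi 1 (a * b * c)) -
        2 * f (free11_mul (psi 0 a) (psi 1 (b * c)) - psi 1 (a * (b * c))) +
        f (free11_mul (psi 1 (a * c)) (psi 0 b) - psi 1 (a * c * b)) = 0"
      using arg_cong[OF psi_identities(5)[of a b c], of f]
      by (simp add: associator_def fs f.zero ee eo) (simp add: ac_simps)
    show "f (free11_mul (psi 1 (a * c)) (psi 0 b) - psi 1 (a * c * b)) +
        f (free11_mul (psi 1 (b * c)) (psi 0 a) - psi 1 (b * c * a)) =
        2 * f (free11_mul (psi 1 c) (psi 0 (a * b)) - psi 1 (c * (a * b)))"
      using arg_cong[OF psi_identities(6)[of c a b], of f]
      by (simp add: associator_def fs f.zero ee eo) (simp add: ac_simps)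
  next
    assume n: "i + j + k + 1 = n"
    have oo: "free11_mul (psi 1 a) (psi 1 b) = psi 0 (odd_product a b)"
      "free11_mul (psi 1 b) (psi 1 c) = psi 0 (odd_product b c)"
      "free11_mul (psi 1 c) (psi 1 b) = psi 0 (odd_product c b)"
      "free11_mul (psi 1 a) (psi 1 c) = psi 0 (odd_product a c)"
      "free11_mul (psi 1 c) (psi 1 a) = psi 0 (odd_product c a)"
      using mult_evenD(2)[OF ev a b] mult_evenD(2)[OF ev b c] mult_evenD(2)[OF ev c b]
        mult_evenD(2)[OF ev a c] mult_evenD(2)[OF ev c a] n by auto
    have "odd_product a b * c + a * odd_product c b = odd_product a c * b + a * odd_product b c"
      by (simp add: odd_product_def algebra_simps)
    from arg_cong[OF this, of "\<lambda>p. f (psi 1 p)"]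
    show "f (free11_mul (psi 0 (odd_product a b)) (psi 1 c) - psi 1 (odd_product a b * c)) -
        f (free11_mul (psi 1 a) (psi 0 (odd_product b c)) - psi 1 (a * odd_product b c)) =
        f (free11_mul (psi 0 (odd_product a c)) (psi 1 b) - psi 1 (odd_product a c * b)) -
        f (free11_mul (psi 1 a) (psi 0 (odd_product c b)) - psi 1 (a * odd_product c b))"
      using arg_cong[OF psi_identities(7)[of a b c], of f]
      by (simp add: associator_def fs f.zero oo)
    have "odd_product a b * c + odd_product b c * a + odd_product c a * b =
        a * odd_product b c + b * odd_product c a + c * odd_product a b"
      by (simp add: odd_product_def algebra_simps)
    from arg_cong[OF this, of "\<lambda>p. f (psi 1 p)"]
    show "f (free11_mul (psi 0 (odd_product a b)) (psi 1 c) - psi 1 (odd_product a b * c)) -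
        f (free11_mul (psi 1 a) (psi 0 (odd_product b c)) - psi 1 (a * odd_product b c)) +
        (f (free11_mul (psi 0 (odd_product b c)) (psi 1 a) - psi 1 (odd_product b c * a)) -
         f (free11_mul (psi 1 b) (psi 0 (odd_product c a)) - psi 1 (b * odd_product c a))) +
        (f (free11_mul (psi 0 (odd_product c a)) (psi 1 b) - psi 1 (odd_product c a * b)) -
         f (free11_mul (psi 1 c) (psi 0 (odd_product a b)) - psi 1 (c * odd_product a b))) = 0"
      using arg_cong[OF psi_identities(8)[of a b c], of f]
      by (simp add: associator_def fs f.zero oo)
  }
qed

section \<open>The inductive step\<close>

lemma monomial_cases:
  fixes m :: "nat \<Rightarrow>\<^sub>0 nat"
  assumes "m \<noteq> 0"
  obtains (variable) j where "m = single j 1"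
    | (product) m1 m2 where "m1 \<noteq> 0" "m2 \<noteq> 0" "m = m1 + m2"
proof -
  obtain j where "lookup m j \<noteq> 0" using assms by (metis poly_mapping_eqI lookup_zero)
  then have "m = m - single j 1 + single j 1" by (rule monomial_split)
  moreover have "single j (1 :: nat) \<noteq> 0" by (metis lookup_single_eq lookup_zero zero_neq_one)
  ultimately show thesis using that by (metis add_0)
qed

lemma biadditive_homogeneous_eq_0:
  fixes Q :: "'k::field_char_0 dpoly \<Rightarrow> 'k dpoly \<Rightarrow> 'a::ab_group_add"
  assumes add: "\<And>a b c. Q (a + b) c = Q a c + Q b c" "\<And>a b c. Q a (b + c) = Q a b + Q a c"
    and zero: "\<And>m m' c d. weight m = i \<Longrightarrow> weight m' = j \<Longrightarrow> Q (single m c) (single m' d) = 0"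
    and hom: "a \<in> homogeneous i" "b \<in> homogeneous j"
  shows "Q a b = 0"
proof -
  have "Q (\<Sum>m\<in>keys a. single m (lookup a m)) b = (\<Sum>m\<in>keys a. Q (single m (lookup a m)) b)"
    by (rule additive.sum) (unfold_locales, rule add)
  moreover have "Q p (\<Sum>m\<in>keys b. single m (lookup b m)) = (\<Sum>m\<in>keys b. Q p (single m (lookup b m)))" for p
    by (rule additive.sum) (unfold_locales, rule add)
  moreover have "Q (single m (lookup a m)) (single m' (lookup b m')) = 0"
    if "m \<in> keys a" "m' \<in> keys b" for m m'
    using that hom by (intro zero) (auto simp: homogeneous_def)
  ultimately show ?thesis by (simp add: poly_mapping_sum_single)
qed

lemma psi_single_scale: "psi \<epsilon> (single m c) = free11_scale c (psi \<epsilon> (single m 1))"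
  using psi_scale[of \<epsilon> c "single m 1"] by (simp add: mult_single)

lemma odd_product_scale:
  "odd_product (single m c) (single m' d) =
   single 0 (c * d) * odd_product (single m 1) (single m' 1)"
proof -
  have *: "single m c = single 0 c * single m 1" "single m' d = single 0 d * single m' 1"
    "single 0 (c * d) = single 0 c * (single 0 d :: 'a dpoly)"
    by (simp_all add: mult_single)
  show ?thesis
    unfolding * by (simp add: odd_product_def dderiv_mult dderiv_const algebra_simps)
qed

lemma homogeneous_monomial: "weight m = i \<Longrightarrow> single m 1 \<in> homogeneous i"
  by (rule homogeneous_single)

text \<open>For \<open>E\<close>, a variable of largest index is carried to the last place, where
  \<open>psi_last\<close> applies. For \<open>P\<close>, \<open>O_eq\<close> reduces everything to
  \<open>P 1\<close>; on a product this is a combination of values of \<open>E\<close>, and on a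
  variable it vanishes by the recursion for \<open>R_power\<close>.\<close>

lemma mult_even_step:
  assumes ev: "\<And>m. m < n \<Longrightarrow> mult_even m TYPE('k::field_char_0)"
    and od: "\<And>m. m < n \<Longrightarrow> mult_odd m TYPE('k)"
  shows "mult_even n TYPE('k)"
proof -
  define E where "E a b = free11_mul (psi 0 a) (psi 0 b) - psi 0 (a * b)" for a b :: "'k dpoly"
  define P where "P a b = free11_mul (psi 1 a) (psi 1 b) - psi 0 (odd_product a b)" for a b :: "'k dpoly"
  have coc: "even_cocycle n (\<lambda>a b. f (E a b)) (\<lambda>a b. f (P a b))" if "additive f" for f
    unfolding E_def P_def by (rule even_cocycle[OF that ev od])
  have eqI: "u = v" if "\<And>f :: 'k free11 \<Rightarrow> rat. additive f \<Longrightarrow> f u = f v" for u v :: "'k free11"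
    using rat_functional_eq_0[OF free11.vector_space_axioms, of "u - v"] that
    by (simp add: additive.diff)
  have zeroI: "u = 0" if "\<And>f :: 'k free11 \<Rightarrow> rat. additive f \<Longrightarrow> f u = 0" for u :: "'k free11"
    using rat_functional_eq_0[OF free11.vector_space_axioms that] .

  \<comment> \<open>For l = 0 this is \<open>dvar_pair\<close>; for l > 0, \<open>dvar l\<close> is
    the derivative of \<open>dvar (l - 1)\<close> and \<open>deriv_pair\<close> applies.\<close>
  have pair: "E (dvar l * a) b = E (a * b) (dvar l)" "E a (dvar l * b) = E (a * b) (dvar l)"
    if "a \<in> homogeneous i" "b \<in> homogeneous j" "0 < i" "0 < j" "i + j + l + 1 = n" for a b i j l
  proof -
    have "f (E (dvar l * a) b) = f (E (a * b) (dvar l)) \<and> f (E a (dvar l * b)) = f (E (a * b) (dvar l))"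
      if f: "additive f" for f :: "'k free11 \<Rightarrow> rat"
    proof -
      interpret even_cocycle n "\<lambda>a b. f (E a b)" "\<lambda>a b. f (P a b)" by (rule coc[OF f])
      show ?thesis
        using dvar_pair[OF \<open>a \<in> _\<close> \<open>b \<in> _\<close>] deriv_pair[OF \<open>a \<in> _\<close> \<open>b \<in> _\<close> homogeneous_dvar[of "l - 1"]]
          \<open>0 < i\<close> \<open>0 < j\<close> \<open>i + j + l + 1 = n\<close>
        by (cases l) (simp_all add: dderiv_dvar)
    qed
    then show "E (dvar l * a) b = E (a * b) (dvar l)" "E a (dvar l * b) = E (a * b) (dvar l)"
      by (auto intro: eqI)
  qed
  have sym: "E (dvar l) a = E a (dvar l)" if "a \<in> homogeneous i" "0 < i" "i + l + 1 = n" for a i l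
  proof (rule eqI)
    fix f :: "'k free11 \<Rightarrow> rat" assume f: "additive f"
    interpret even_cocycle n "\<lambda>a b. f (E a b)" "\<lambda>a b. f (P a b)" by (rule coc[OF f])
    show "f (E (dvar l) a) = f (E a (dvar l))"
      using dvar_sym[OF that(1)] deriv_sym[OF that(1) homogeneous_dvar[of "l - 1"]] that
      by (cases l) (simp_all add: dderiv_dvar)
  qed
  have E_mono: "E (single m 1) (single m' 1) = 0"
    if m: "m \<noteq> 0" "m' \<noteq> 0" and n: "weight m + weight m' = n" for m m'
  proof -
    let ?K = "keys m \<union> keys m'"
    define j where "j = Max ?K"
    have "?K \<noteq> {}" using m by auto
    then have j: "j \<in> ?K" "\<And>k. k \<in> ?K \<Longrightarrow> k \<le> j"
      unfolding j_def by (auto intro: Max_in Max_ge simp del: Un_iff)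
    \<comment> \<open>The index j is maximal in both monomials together, so \<open>dvar j\<close>
      may be appended to any monomial in their variables.\<close>
    have last: "E (single M 1) (dvar j) = 0" if "M \<noteq> 0" "keys M \<subseteq> ?K" for M
      using psi_last[OF that(1), of j] that(2) j(2) by (auto simp: E_def)
    have keys: "keys M \<subseteq> keys (M + M')" for M M' :: "nat \<Rightarrow>\<^sub>0 nat"
      by (auto simp: in_keys_iff lookup_add)
    have split: "\<exists>M. m = M + single j 1" if "j \<in> keys m" for m :: "nat \<Rightarrow>\<^sub>0 nat"
      using monomial_split[of m j] that by (auto simp: in_keys_iff)
    note pos = weight_pos
    from j(1) show ?thesis
    proof
      assume "j \<in> keys m"
      then obtain M where M: "m = M + single j 1" using split by blast
      have w: "weight M + weight m' + j + 1 = n" using n by (simp add: M weight_add weight_single)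
      show ?thesis
      proof (cases "M = 0")
        case True
        then show ?thesis
          using sym[OF homogeneous_monomial[OF refl], of m' j] last[of m'] m w pos
          by (simp add: M dvar_def subset_insertI)
      next
        case False
        have "E (dvar j * single M 1) (single m' 1) = E (single M 1 * single m' 1) (dvar j)"
          using pair(1)[OF homogeneous_monomial[OF refl] homogeneous_monomial[OF refl], of M m' j]
            False m w pos by simp
        moreover have "E (single (M + m') 1) (dvar j) = 0"
          using last[of "M + m'"] False m keys[of M "single j 1"] Poly_Mapping.keys_add[of M m']
          by (auto simp: M poly_mapping_eq_iff fun_eq_iff lookup_add)
        ultimately show ?thesis by (simp add: M mult_single dvar_def add.commute)
      qed
    next
      assume "j \<in> keys m'"
      then obtain M where M: "m' = M + single j 1" using split by blast
      have w: "weight m + weight M + j + 1 = n" using n by (simp add: M weight_add weight_single)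
      show ?thesis
      proof (cases "M = 0")
        case True
        then show ?thesis using last[of m] m by (simp add: M dvar_def subset_insertI)
      next
        case False
        have "E (single m 1) (dvar j * single M 1) = E (single m 1 * single M 1) (dvar j)"
          using pair(2)[OF homogeneous_monomial[OF refl] homogeneous_monomial[OF refl], of m M j]
            False m w pos by simp
        moreover have "E (single (m + M) 1) (dvar j) = 0"
          using last[of "m + M"] False m keys[of M "single j 1"] Poly_Mapping.keys_add[of m M]
          by (auto simp: M poly_mapping_eq_iff fun_eq_iff lookup_add)
        ultimately show ?thesis by (simp add: M mult_single dvar_def add.commute)
      qed
    qed
  qed
  have E_vanish: "E a b = 0" if "a \<in> homogeneous i" "b \<in> homogeneous j" "0 < i" "0 < j" "i + j = n" for a b i j
  proof (rule biadditive_homogeneous_eq_0[OF _ _ _ that(1,2)])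
    fix m m' c d assume w: "weight m = i" "weight m' = j"
    have "E (single m c) (single m' d) = free11_scale (c * d) (E (single m 1) (single m' 1))"
      by (simp add: E_def mult_single psi_single_scale[of 0 m c] psi_single_scale[of 0 m' d]
          psi_single_scale[of 0 _ "c * d"] free11.mul_scale_left free11.mul_scale_right
          free11.scale_right_diff_distrib mult.commute)
    also have "E (single m 1) (single m' 1) = 0"
      using w that(3-5) by (intro E_mono) auto
    finally show "E (single m c) (single m' d) = 0" by simp
  qed (simp_all add: E_def psi_add free11.mul_add_left free11.mul_add_right distrib_left distrib_right)

  have P_one_mono: "f (P 1 (single m 1)) = 0"
    if f: "additive f" and m: "m \<noteq> 0" and n: "weight m + 1 = n"
    for f :: "'k free11 \<Rightarrow> rat" and m
  proof -
    interpret even_cocycle n "\<lambda>a b. f (E a b)" "\<lambda>a b. f (P a b)" by (rule coc[OF f])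
    show ?thesis
      using m
    proof (cases m rule: monomial_cases)
      case (variable j)
      have h: "dvar j \<in> (homogeneous (Suc j) :: 'k dpoly set)" "dvar 0 \<in> (homogeneous 1 :: 'k dpoly set)"
        using homogeneous_dvar[of j] homogeneous_dvar[of 0] by (simp_all add: One_nat_def)
      have nj: "Suc j + 1 = n" using n variable by (simp add: weight_single)
      have E: "E (dvar j) (dvar 0) = 0" "E (dvar 0) (dvar j) = 0"
        using E_vanish[OF h] E_vanish[OF h(2,1)] nj by auto
      \<comment> \<open>For p = \<open>dvar j\<close>, (px)x is p x^2 plus the associator (p, x, x),
        and the latter is twice \<open>dvar (Suc j)\<close> by the recursion; hence
        \<open>P (dvar j) 1\<close> = 0. Then \<open>O_eq\<close> at c = 1, whose derivative term is
        0, carries this over to \<open>P 1 (dvar j)\<close>.\<close>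
      have "free11_mul (psi 0 (dvar j)) (psi 0 (dvar 0)) = (psi 0 (dvar j * dvar 0) :: 'k free11)"
        using E(1) by (simp add: E_def)
      moreover have "free11_mul (psi 0 (dvar j)) free11_gen = (psi 1 (dvar j) :: 'k free11)"
        using psi_odd[OF h(1)] by simp
      moreover have "odd_product (dvar j) 1 = dvar j * dvar 0 + (2 * dvar (Suc j) :: 'k dpoly)"
        by (simp add: odd_product_def dderiv_dvar mult.commute)
      moreover have "psi 0 (2 * dvar (Suc j)) =
          (free11_scale 2 (psi 0 (dvar (Suc j))) :: 'k free11)"
        by (metis free11.scale_left_distrib free11.scale_one mult_2 one_add_one psi_add)
      ultimately have "P (dvar j) 1 = 0"
        unfolding P_def psi_add psi_dvar_Suc by (simp add: psi_dvar_0 psi_one associator_def psi_add)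
      then show ?thesis
        using O_eq[OF h(1) homogeneous_one] E f nj variable by (simp add: dvar_def additive.zero)
    next
      case (product m1 m2)
      then have pos: "0 < weight m1" "0 < weight m2" by (simp_all add: weight_pos)
      have "f (P 1 (single m1 1 * single m2 1)) = f (E (dvar 0) (single m1 1 * single m2 1)) +
          f (E (dderiv (single m1 1)) (single m2 1)) + f (E (dderiv (single m2 1)) (single m1 1))"
        using O_one_mult[OF homogeneous_monomial[OF refl] homogeneous_monomial[OF refl], of m1 m2]
          pos n product by (simp add: weight_add)
      moreover have "E (dvar 0) (single m1 1 * single m2 1) = 0"
        using E_vanish[OF homogeneous_dvar[of 0] homogeneous_mult[OF homogeneous_monomial[OF refl]
          homogeneous_monomial[OF refl] refl], of m1 m2] pos n product by (simp add: weight_add)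
      moreover have "E (dderiv (single m1 1)) (single m2 1) = 0" "E (dderiv (single m2 1)) (single m1 1) = 0"
        using E_vanish[OF homogeneous_dderiv[OF homogeneous_monomial[OF refl]] homogeneous_monomial[OF refl], of m1 m2]
          E_vanish[OF homogeneous_dderiv[OF homogeneous_monomial[OF refl]] homogeneous_monomial[OF refl], of m2 m1]
          pos n product by (simp_all add: weight_add)
      ultimately show ?thesis using f product by (simp add: additive.zero mult_single)
    qed
  qed
  have P_mono: "P (single m 1) (single m' 1) = 0" if w: "weight m + weight m' + 1 = n" for m m'
  proof (rule zeroI)
    fix f :: "'k free11 \<Rightarrow> rat" assume f: "additive f"
    interpret even_cocycle n "\<lambda>a b. f (E a b)" "\<lambda>a b. f (P a b)" by (rule coc[OF f])
    show "f (P (single m 1) (single m' 1)) = 0"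
    proof (cases "m = 0")
      case True
      have "P 1 1 = 0" by (simp add: P_def psi_one odd_product_def psi_dvar_0)
      then show ?thesis
        using True P_one_mono[OF f, of m'] w f by (cases "m' = 0") (simp_all add: additive.zero)
    next
      case False
      then have pos: "0 < weight m" by (rule weight_pos)
      have "m + m' \<noteq> 0" using pos by (metis weight_add weight_0 add_is_0 less_not_refl)
      then have "f (P 1 (single m 1 * single m' 1)) = 0"
        using P_one_mono[OF f, of "m + m'"] w by (simp add: mult_single weight_add)
      moreover have "E (dvar 0 * single m' 1) (single m 1) = 0" "E (dderiv (single m' 1)) (single m 1) = 0"
        using E_vanish[OF homogeneous_mult[OF homogeneous_dvar[of 0] homogeneous_monomial[OF refl] refl]
            homogeneous_monomial[OF refl], of m' m]
          E_vanish[OF homogeneous_dderiv[OF homogeneous_monomial[OF refl]] homogeneous_monomial[OF refl], of m' m]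
          pos w by simp_all
      ultimately show ?thesis
        using O_eq[OF homogeneous_monomial[OF refl] homogeneous_monomial[OF refl], of m m'] pos w f
        by (simp add: additive.zero)
    qed
  qed
  have P_vanish: "P a b = 0" if "a \<in> homogeneous i" "b \<in> homogeneous j" "i + j + 1 = n" for a b i j
  proof (rule biadditive_homogeneous_eq_0[OF _ _ _ that(1,2)])
    fix m m' c d assume w: "weight m = i" "weight m' = j"
    have "P (single m c) (single m' d) = free11_scale (c * d) (P (single m 1) (single m' 1))"
      by (simp add: P_def odd_product_scale[of m c] psi_scale psi_single_scale[of 1 m c]
          psi_single_scale[of 1 m' d] free11.mul_scale_left free11.mul_scale_right
          free11.scale_right_diff_distrib mult.commute)
    also have "P (single m 1) (single m' 1) = 0" using w that(3) by (intro P_mono) auto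
    finally show "P (single m c) (single m' d) = 0" by simp
  next
    have op: "odd_product (a + b) c = odd_product a c + odd_product b c"
      "odd_product a (b + c) = odd_product a b + odd_product a c" for a b c :: "'k dpoly"
      by (simp_all add: odd_product_def dderiv_add algebra_simps)
    show "P (a + b) c = P a c + P b c" "P a (b + c) = P a b + P a c" for a b c
      by (simp_all add: P_def op psi_add free11.mul_add_left free11.mul_add_right)
  qed
  show ?thesis
    unfolding mult_even_def using E_vanish P_vanish by (auto simp: E_def P_def)
qed

text \<open>A product of nontrivial monomials in either argument of \<open>M\<close> is covered by
  \<open>triple\<close>. Among pairs of variables, one of positive index is a derivative and
  \<open>derivative\<close> applies; two copies of \<open>dvar 0\<close> are left to
  \<open>dvar_dvar\<close>. Then \<open>N\<close> reduces to \<open>M\<close> by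
  \<open>N_eq\<close>, and \<open>N 1\<close> by \<open>N_one\<close> on products and by
  \<open>dvar_one\<close> or \<open>N_one_dvar\<close> on variables.\<close>

lemma mult_odd_step:
  assumes ev: "\<And>m. m \<le> n \<Longrightarrow> mult_even m TYPE('k::field_char_0)"
    and od: "\<And>m. m < n \<Longrightarrow> mult_odd m TYPE('k)"
  shows "mult_odd n TYPE('k)"
proof -
  define M where "M a b = free11_mul (psi 0 a) (psi 1 b) - psi 1 (a * b)" for a b :: "'k dpoly"
  define N where "N a b = free11_mul (psi 1 a) (psi 0 b) - psi 1 (a * b)" for a b :: "'k dpoly"
  have coc: "odd_cocycle n (\<lambda>a b. f (M a b)) (\<lambda>a b. f (N a b))" if "additive f" for f
    unfolding M_def N_def by (rule odd_cocycle[OF that ev od])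
  have zeroI: "u = 0" if "\<And>f :: 'k free11 \<Rightarrow> rat. additive f \<Longrightarrow> f u = 0" for u :: "'k free11"
    using rat_functional_eq_0[OF free11.vector_space_axioms that] .
  note hom = homogeneous_monomial[OF refl]
  have M_mono: "M (single m 1) (single m' 1) = 0" if m: "m \<noteq> 0" and w: "weight m + weight m' = n" for m m'
  proof (rule zeroI)
    fix f :: "'k free11 \<Rightarrow> rat" assume f: "additive f"
    interpret odd_cocycle n "\<lambda>a b. f (M a b)" "\<lambda>a b. f (N a b)" by (rule coc[OF f])
    show "f (M (single m 1) (single m' 1)) = 0"
    proof (cases "m' = 0")
      case True
      then show ?thesis using normal[of "single m 1"] w weight_pos[OF m] homogeneous_monomial[of m n] by simp
    next
      case m': False
      from m show ?thesis
      proof (cases m rule: monomial_cases)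
        case (product m1 m2)
        then show ?thesis
          using triple(1)[OF hom hom hom, of m1 m2 m'] m' w
          by (simp add: weight_pos weight_add mult_single)
      next
        case i: (variable i)
        from m' show ?thesis
        proof (cases m' rule: monomial_cases)
          case (product m1 m2)
          then show ?thesis
            using triple(2)[OF hom hom hom, of m m1 m2] m w
            by (simp add: weight_pos weight_add mult_single)
        next
          case j: (variable j)
          have n: "Suc i + Suc j = n" using w by (simp add: i j weight_single)
          have "f (M (dvar i) (dvar j)) = 0"
          proof (cases i)
            case 0
            show ?thesis
            proof (cases j)
              case 0
              then show ?thesis using dvar_dvar \<open>i = 0\<close> n by simp
            next
              case (Suc j')
              then show ?thesis
                using derivative(1)[OF homogeneous_dvar[of i] _ homogeneous_dvar[of j']] n
                by (simp add: dderiv_dvar)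
            qed
          next
            case (Suc i')
            then show ?thesis
              using derivative(2)[OF homogeneous_dvar[of i'] _ homogeneous_dvar[of j]] n
              by (simp add: dderiv_dvar)
          qed
          then show ?thesis by (simp add: i j dvar_def)
        qed
      qed
    qed
  qed
  have N_mono: "N (single m' 1) (single m 1) = 0" if m: "m \<noteq> 0" and w: "weight m + weight m' = n" for m m'
  proof (rule zeroI)
    fix f :: "'k free11 \<Rightarrow> rat" assume f: "additive f"
    interpret odd_cocycle n "\<lambda>a b. f (M a b)" "\<lambda>a b. f (N a b)" by (rule coc[OF f])
    show "f (N (single m' 1) (single m 1)) = 0"
    proof (cases "m' = 0")
      case False
      then show ?thesis
        using N_eq[OF hom hom, of m' m] M_mono[of m' m] m w f by (simp add: weight_pos additive.zero)
    next
      case m': True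
      from m show ?thesis
      proof (cases m rule: monomial_cases)
        case (product m1 m2)
        then show ?thesis
          using N_one[OF hom hom, of m1 m2] M_mono[of m1 m2] M_mono[of m2 m1] m' w f
          by (simp add: weight_pos weight_add mult_single additive.zero)
      next
        case j: (variable j)
        show ?thesis
        proof (cases j)
          case 0
          then show ?thesis using N_one_dvar m' w j by (simp add: weight_single dvar_def One_nat_def)
        next
          case (Suc i)
          \<comment> \<open>As \<open>dvar (Suc i)\<close> is the derivative of
            \<open>dvar i\<close>, \<open>dvar_one\<close> makes \<open>N 1 (dvar (Suc i))\<close>
            equal to - 2 times this defect.\<close>
          have "M (dvar i) (dvar 0) = 0"
            using M_mono[of "single i 1" "single 0 1"] Suc w m' j
            by (simp add: dvar_def weight_single poly_mapping_eq_iff fun_eq_iff lookup_single when_def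
                del: single_one)
          then have "f (N 1 (dvar (Suc i))) = 0"
            using dvar_one(2)[OF homogeneous_dvar[of i]] Suc w m' j f
            by (simp add: dderiv_dvar weight_single additive.zero)
          then show ?thesis by (simp add: Suc m' j dvar_def)
        qed
      qed
    qed
  qed
  have "M a b = 0 \<and> N b a = 0" if a: "a \<in> homogeneous i" and b: "b \<in> homogeneous j" and "0 < i" "i + j = n" for a b i j
  proof
    have m: "m \<noteq> 0" if "weight m = i" for m using that \<open>0 < i\<close> by auto
    show "M a b = 0"
    proof (rule biadditive_homogeneous_eq_0[OF _ _ _ a b])
      fix m m' c d assume w: "weight m = i" "weight m' = j"
      have "M (single m c) (single m' d) = free11_scale (c * d) (M (single m 1) (single m' 1))"
        by (simp add: M_def mult_single psi_single_scale[of 0 m c] psi_single_scale[of 1 m' d]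
            psi_single_scale[of 1 _ "c * d"] free11.mul_scale_left free11.mul_scale_right
            free11.scale_right_diff_distrib mult.commute)
      then show "M (single m c) (single m' d) = 0"
        using M_mono[of m m'] m w \<open>i + j = n\<close> by simp
    qed (simp_all add: M_def psi_add free11.mul_add_left free11.mul_add_right distrib_left distrib_right)
    show "N b a = 0"
    proof (rule biadditive_homogeneous_eq_0[OF _ _ _ b a])
      fix m' m d c assume w: "weight m' = j" "weight m = i"
      have "N (single m' d) (single m c) = free11_scale (d * c) (N (single m' 1) (single m 1))"
        by (simp add: N_def mult_single psi_single_scale[of 0 m c] psi_single_scale[of 1 m' d]
            psi_single_scale[of 1 _ "c * d"] free11.mul_scale_left free11.mul_scale_right
            free11.scale_right_diff_distrib mult.commute)
      then show "N (single m' d) (single m c) = 0"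
        using N_mono[of m m'] m w \<open>i + j = n\<close> by simp
    qed (simp_all add: N_def psi_add free11.mul_add_left free11.mul_add_right distrib_left distrib_right)
  qed
  then show ?thesis
    unfolding mult_odd_def by (auto simp: M_def N_def mult.commute)
qed

lemma mult_even_odd: "mult_even n TYPE('k::field_char_0)" "mult_odd n TYPE('k)"
proof (induction n rule: less_induct)
  case (less n)
  show ev: "mult_even n TYPE('k)" by (rule mult_even_step) (use less in auto)
  show "mult_odd n TYPE('k)"
    by (rule mult_odd_step) (use less ev in \<open>auto simp: le_less\<close>)
qed

lemmas psi_mult_even_even = mult_evenD(1)[OF mult_even_odd(1)]
  and psi_mult_odd_odd = mult_evenD(2)[OF mult_even_odd(1)]
  and psi_mult_even_odd = mult_oddD(1)[OF mult_even_odd(2)]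
  and psi_mult_odd_even = mult_oddD(2)[OF mult_even_odd(2)]

section \<open>The grading of the free superalgebra\<close>

definition free11_graded :: "nat \<Rightarrow> 'k::field_char_0 free11 set" where
  "free11_graded n = abs_free11 ` {f. \<forall>t\<in>keys f. mdeg t = n}"

lemma free11_graded_subspace: "free11.subspace (free11_graded n)"
  unfolding free11_graded_def
proof (rule abs_free11.subspace_image)
  have *: "(\<forall>t\<in>keys f. mdeg t = n) \<longleftrightarrow> (\<forall>t. mdeg t \<noteq> n \<longrightarrow> lookup f t = 0)" for f :: "'a freena"
    by (auto simp: in_keys_iff)
  show "freena.subspace {f :: 'a freena. \<forall>t\<in>keys f. mdeg t = n}"
    unfolding * by (auto simp: freena.subspace_def lookup_add coeff_scale_def lookup_map_zero)
qed

lemma free11_graded_mul: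
  assumes "a \<in> free11_graded m" "b \<in> free11_graded n" "d = m + n"
  shows "free11_mul a b \<in> free11_graded d"
proof -
  obtain f g where f: "a = abs_free11 f" "\<forall>t\<in>keys f. mdeg t = m"
    and g: "b = abs_free11 g" "\<forall>t\<in>keys g. mdeg t = n"
    using assms(1,2) by (auto simp: free11_graded_def)
  have "\<forall>t\<in>keys (freena_mul f g). mdeg t = d"
    using keys_freena_mul[of f g] f(2) g(2) assms(3) by fastforce
  then show ?thesis
    unfolding free11_graded_def f g abs_free11.hom_mul[symmetric] by blast
qed

lemma free11_gen_graded: "free11_gen \<in> free11_graded 1"
  unfolding free11_graded_def free11_gen.abs_eq by (rule imageI) simp

lemma R_power_graded: "R_power j \<in> free11_graded (2 * j + 2)"
proof (induction j)
  case 0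
  show ?case
    unfolding R_power_0 by (rule free11_graded_mul[OF free11_gen_graded free11_gen_graded]) simp
next
  case (Suc j)
  show ?case
    unfolding R_power_Suc associator_def
    by (intro free11.subspace_diff free11_graded_subspace
        free11_graded_mul[OF free11_graded_mul[OF Suc free11_gen_graded refl] free11_gen_graded]
        free11_graded_mul[OF Suc free11_graded_mul[OF free11_gen_graded free11_gen_graded refl]])
      simp_all
qed

lemma base_monomial_graded:
  assumes "\<epsilon> \<in> {0, 1}"
  shows "base_monomial m \<epsilon> \<in> (free11_graded (2 * weight m + \<epsilon>) :: 'k::field_char_0 free11 set)"
proof -
  have even: "base_monomial m 0 \<in> (free11_graded (2 * weight m) :: 'k free11 set)"
  proof (induction m rule: monomial_induct)
    case zero
    show ?case by (simp add: base_monomial_0 free11.subspace_0 free11_graded_subspace)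
  next
    case (add m j)
    show ?case
      unfolding base_monomial_add[OF add(2)]
      using R_power_graded[of j, where 'a = 'k] free11_graded_mul[OF add(1) R_power_graded[of j]]
      by (simp add: weight_add weight_single)
  qed
  have "base_monomial m 1 \<in> (free11_graded (2 * weight m + 1) :: 'k free11 set)"
    using free11_gen_graded free11_graded_mul[OF even free11_gen_graded refl]
    by (cases "m = 0") (simp_all add: base_monomial_0 base_monomial_odd)
  with even assms show ?thesis by auto
qed

text \<open>By multiplicativity the values of \<open>psi\<close> on homogeneous elements, of
  positive weight for \<open>psi 0\<close>, are closed under products, and they contain the
  generator. Keeping track of the weight gives spanning in each degree separately.\<close>

lemma word_eq_psi:
  obtains (even) i p where "mdeg t = 2 * i" "0 < i" "p \<in> homogeneous i"
      "abs_free11 (single t (1 :: 'k::field_char_0)) = psi 0 p"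
    | (odd) i p where "mdeg t = 2 * i + 1" "p \<in> homogeneous i"
      "abs_free11 (single t (1 :: 'k)) = psi 1 p"
proof -
  have "\<exists>i. \<exists>p \<in> homogeneous i.
      mdeg t = 2 * i \<and> 0 < i \<and> abs_free11 (single t (1 :: 'k)) = psi 0 p \<or>
      mdeg t = 2 * i + 1 \<and> abs_free11 (single t (1 :: 'k)) = psi 1 p"
  proof (induction t)
    case Gen
    show ?case
      by (rule exI[of _ 0], rule bexI[OF _ homogeneous_one]) (simp add: psi_one free11_gen.abs_eq)
  next
    case (Prod s t)
    have mul: "abs_free11 (single (Prod s t) (1 :: 'k)) =
        free11_mul (abs_free11 (single s 1)) (abs_free11 (single t 1))"
      by (simp add: freena_mul_single flip: abs_free11.hom_mul)
    obtain i p where p: "p \<in> homogeneous i"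
      and s: "mdeg s = 2 * i \<and> 0 < i \<and> abs_free11 (single s (1 :: 'k)) = psi 0 p \<or>
        mdeg s = 2 * i + 1 \<and> abs_free11 (single s (1 :: 'k)) = psi 1 p" using Prod(1) by blast
    obtain j q where q: "q \<in> homogeneous j"
      and t: "mdeg t = 2 * j \<and> 0 < j \<and> abs_free11 (single t (1 :: 'k)) = psi 0 q \<or>
        mdeg t = 2 * j + 1 \<and> abs_free11 (single t (1 :: 'k)) = psi 1 q" using Prod(2) by blast
    from s t show ?case
    proof (elim disjE conjE)
      assume "mdeg s = 2 * i" "0 < i" "abs_free11 (single s (1 :: 'k)) = psi 0 p"
        "mdeg t = 2 * j" "0 < j" "abs_free11 (single t (1 :: 'k)) = psi 0 q"
      then show ?case
        by (intro exI[of _ "i + j"] bexI[of _ "p * q"])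
          (simp_all add: mul psi_mult_even_even[OF p q] homogeneous_mult[OF p q])
    next
      assume "mdeg s = 2 * i" "0 < i" "abs_free11 (single s (1 :: 'k)) = psi 0 p"
        "mdeg t = 2 * j + 1" "abs_free11 (single t (1 :: 'k)) = psi 1 q"
      then show ?case
        by (intro exI[of _ "i + j"] bexI[of _ "p * q"])
          (simp_all add: mul psi_mult_even_odd[OF p q] homogeneous_mult[OF p q])
    next
      assume "mdeg s = 2 * i + 1" "abs_free11 (single s (1 :: 'k)) = psi 1 p"
        "mdeg t = 2 * j" "0 < j" "abs_free11 (single t (1 :: 'k)) = psi 0 q"
      then show ?case
        by (intro exI[of _ "j + i"] bexI[of _ "q * p"])
          (simp_all add: mul psi_mult_odd_even[OF q p] homogeneous_mult[OF q p])
    next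
      assume "mdeg s = 2 * i + 1" "abs_free11 (single s (1 :: 'k)) = psi 1 p"
        "mdeg t = 2 * j + 1" "abs_free11 (single t (1 :: 'k)) = psi 1 q"
      then show ?case
        by (intro exI[of _ "i + j + 1"] bexI[of _ "odd_product p q"])
          (simp_all add: mul psi_mult_odd_odd[OF p q] homogeneous_odd_product[OF p q])
    qed
  qed
  then show thesis using even odd by blast
qed

section \<open>Spanning, dual functionals and degrees\<close>

lemma index_norm_pos_iff: "0 < index_norm m \<longleftrightarrow> m \<noteq> 0"
proof
  assume "m \<noteq> 0"
  then obtain j where j: "j \<in> keys m" by (metis ex_in_conv keys_eq_empty)
  then have "0 < lookup m j" by (simp add: in_keys_iff)
  also have "lookup m j \<le> index_norm m"
    unfolding index_norm_def by (rule member_le_sum[OF j]) simp_all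
  finally show "0 < index_norm m" .
qed (auto simp: index_norm_def)

lemma abs_free11_eq_sum:
  "abs_free11 f = (\<Sum>t\<in>keys f. free11_scale (lookup f t) (abs_free11 (single t 1)))"
proof -
  have "free11_scale c (abs_free11 (single t 1)) = abs_free11 (single t c)" for t and c :: 'a
    by (simp add: coeff_scale_single flip: abs_free11.scale)
  then show ?thesis by (simp add: poly_mapping_sum_single flip: abs_free11.sum)
qed

lemma free11_graded_span:
  "(free11_graded n :: 'k::field_char_0 free11 set) \<subseteq> free11.span
     {base_monomial m \<epsilon> | m \<epsilon>. \<epsilon> \<in> {0, 1} \<and> \<epsilon> + index_norm m > 0 \<and> 2 * weight m + \<epsilon> = n}"
    (is "_ \<subseteq> free11.span ?B")
proof
  fix a :: "'k free11" assume "a \<in> free11_graded n"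
  then obtain f where f: "a = abs_free11 f" "\<forall>t\<in>keys f. mdeg t = n"
    by (auto simp: free11_graded_def)
  have psi: "psi \<epsilon> p \<in> free11.span ?B"
    if "p \<in> homogeneous i" "\<epsilon> \<in> {0, 1}" "0 < \<epsilon> + i" "2 * i + \<epsilon> = n" for \<epsilon> p i
    unfolding psi_def lin_ext_def
  proof (intro free11.span_sum free11.span_scale free11.span_base CollectI exI conjI refl)
    fix m assume "m \<in> keys p"
    then have w: "weight m = i" using that(1) by (simp add: homogeneous_def)
    then show "2 * weight m + \<epsilon> = n" using that(4) by simp
    \<comment> \<open>For \<epsilon> = 0 the weight is positive, which excludes the empty
      product.\<close>
    show "\<epsilon> + index_norm m > 0"
      using that(3) w by (cases "m = 0") (simp_all add: index_norm_pos_iff trans_less_add2)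
  qed (use that in auto)
  have "abs_free11 (single t (1 :: 'k)) \<in> free11.span ?B" if t: "mdeg t = n" for t
  proof (cases t rule: word_eq_psi[where 'k = 'k])
    case (even i p)
    then show ?thesis unfolding even(4) by (intro psi[OF even(3)]) (use t in auto)
  next
    case (odd i p)
    then show ?thesis unfolding odd(3) by (intro psi[OF odd(2)]) (use t in auto)
  qed
  then show "a \<in> free11.span ?B"
    unfolding f(1) abs_free11_eq_sum[of f] using f(2)
    by (intro free11.span_sum free11.span_scale) auto
qed

lemma model_hom_psi:
  fixes p :: "'k::field_char_0 dpoly"
  assumes "p \<in> homogeneous i"
  shows "0 < i \<Longrightarrow> model_hom (psi 0 p) = (p, 0)" "model_hom (psi 1 p) = (0, p)"
proof -
  have "model_hom (psi \<epsilon> (\<Sum>m\<in>keys p. single m (lookup p m))) =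
      (\<Sum>m\<in>keys p. model_hom (psi \<epsilon> (single m (lookup p m))))" for \<epsilon>
    by (simp add: psi_sum model_hom.sum)
  then have sum: "model_hom (psi \<epsilon> p) = (\<Sum>m\<in>keys p. model_hom (psi \<epsilon> (single m (lookup p m))))" for \<epsilon>
    by (simp add: poly_mapping_sum_single)
  have "model_hom (psi 0 (single m c)) = (single m c, 0)" if "m \<noteq> 0" for m and c :: 'k
    using that by (simp add: psi_single model_hom.scale model_hom_base_monomial model_scale_def mult_single)
  moreover have "m \<noteq> 0" if "m \<in> keys p" "0 < i" for m
    using that assms by (auto simp: homogeneous_def)
  ultimately have "0 < i \<Longrightarrow> model_hom (psi 0 p) = (\<Sum>m\<in>keys p. (single m (lookup p m), 0))"
    unfolding sum by (intro sum.cong) auto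
  then show "0 < i \<Longrightarrow> model_hom (psi 0 p) = (p, 0)"
    by (simp add: sum_prod poly_mapping_sum_single)
  have "model_hom (psi 1 (single m c)) = (0, single m c)" for m and c :: 'k
    by (simp add: psi_single model_hom.scale model_hom_base_monomial_odd model_scale_def mult_single)
  then show "model_hom (psi 1 p) = (0, p)"
    unfolding sum by (simp add: sum_prod poly_mapping_sum_single)
qed

text \<open>For \<epsilon> in {0, 1} these are the functionals dual to the base monomials, up to the
  nonzero factor \<open>2 ^ two_exponent m\<close>.\<close>

definition base_coeff :: "(nat \<Rightarrow>\<^sub>0 nat) \<Rightarrow> nat \<Rightarrow> 'k::field_char_0 free11 \<Rightarrow> 'k" where
  "base_coeff m \<epsilon> a = lookup (if \<epsilon> = 0 then fst (model_hom a) else snd (model_hom a)) m"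

lemma lookup_const_mult: "lookup (single 0 c * p) m = c * lookup p m"
  by (simp add: lookup_map_zero flip: mult_map_scale_conv_mult)

lemma linear_base_coeff: "Vector_Spaces.linear free11_scale (*) (base_coeff m \<epsilon>)"
  by unfold_locales
    (auto simp: base_coeff_def model_hom.add model_hom.scale model_scale_def lookup_add
      lookup_const_mult algebra_simps)

lemma base_coeff_base_monomial:
  assumes "\<epsilon> \<in> {0, 1}" "\<epsilon>' \<in> {0, 1}" "\<epsilon>' + index_norm m' > 0"
  shows "base_coeff m \<epsilon> (base_monomial m' \<epsilon>' :: 'k::field_char_0 free11) \<noteq> 0 \<longleftrightarrow> m' = m \<and> \<epsilon>' = \<epsilon>"
  using assms
  by (auto simp: base_coeff_def index_norm_pos_iff model_hom_base_monomial
      model_hom_base_monomial_odd lookup_single when_def split: if_splits)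

text \<open>The upper bound is the grading. For the lower one, a representative of smaller degree is
  a combination of words whose images in the model have another parity or another weight than the
  monomial, so \<open>base_coeff m \<epsilon>\<close> would vanish on it.\<close>

lemma free11_degree_base_monomial:
  assumes "\<epsilon> \<in> {0, 1}" "\<epsilon> + index_norm m > 0"
  shows "free11_degree (base_monomial m \<epsilon> :: 'k::field_char_0 free11) = 2 * weight m + \<epsilon>"
  unfolding free11_degree_def
proof (rule Least_equality)
  show "\<exists>f. (base_monomial m \<epsilon> :: 'k free11) = abs_free11 f \<and> (\<forall>t\<in>keys f. mdeg t \<le> 2 * weight m + \<epsilon>)"
    using base_monomial_graded[OF assms(1), of m] unfolding free11_graded_def by fastforce
next
  fix n
  assume "\<exists>f. (base_monomial m \<epsilon> :: 'k free11) = abs_free11 f \<and> (\<forall>t\<in>keys f. mdeg t \<le> n)"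
  then obtain f :: "'k freena" where f: "base_monomial m \<epsilon> = abs_free11 f" "\<forall>t\<in>keys f. mdeg t \<le> n" by blast
  interpret L: Vector_Spaces.linear free11_scale "(*)" "base_coeff m \<epsilon> :: 'k free11 \<Rightarrow> 'k"
    by (rule linear_base_coeff)
  show "2 * weight m + \<epsilon> \<le> n"
  proof (rule ccontr)
    assume less: "\<not> 2 * weight m + \<epsilon> \<le> n"
    have "base_coeff m \<epsilon> (abs_free11 (single t (1 :: 'k))) = 0" if "t \<in> keys f" for t
    proof -
      have deg: "mdeg t < 2 * weight m + \<epsilon>" using f(2) that less by fastforce
      have outside: "lookup p m = 0" if "p \<in> homogeneous i" "i \<noteq> weight m" for p :: "'k dpoly" and i
        using that by (auto simp: homogeneous_def in_keys_iff)
      show ?thesis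
      proof (cases t rule: word_eq_psi[where 'k = 'k])
        case (even i p)
        then show ?thesis
          using deg assms(1) outside[of p i] by (auto simp: base_coeff_def model_hom_psi)
      next
        case (odd i p)
        then show ?thesis
          using deg assms(1) outside[of p i] by (auto simp: base_coeff_def model_hom_psi)
      qed
    qed
    then have "base_coeff m \<epsilon> (abs_free11 f) = 0"
      unfolding abs_free11_eq_sum[of f] by (simp add: L.sum L.scale)
    then show False using base_coeff_base_monomial[OF assms(1,1,2), of m, where 'k = 'k] f(1) by simp
  qed
qed


section \<open>The Grassmann algebra\<close>

lemma (in nonassoc_algebra) generated_subalgebra: "subalgebra (generated_subalgebra S)"
  unfolding generated_subalgebra_def
proof (rule hull_in)
  fix \<B> assume "\<forall>B\<in>\<B>. subalgebra B"
  then show "subalgebra (\<Inter> \<B>)"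
    unfolding subalgebra_def by (auto intro: subspace_Inter)
qed

lemma (in vector_space) independent_familyI:
  assumes "\<And>i. i \<in> A \<Longrightarrow> \<exists>f. Vector_Spaces.linear scale (*) f \<and> f (b i) \<noteq> 0 \<and> (\<forall>j\<in>A. j \<noteq> i \<longrightarrow> f (b j) = 0)"
  shows "inj_on b A" "independent (b ` A)"
proof -
  show "inj_on b A"
  proof (rule inj_onI)
    fix i j assume "i \<in> A" "j \<in> A" "b i = b j"
    then show "i = j" using assms[of i] by metis
  qed
  show "independent (b ` A)"
    unfolding dependent_def
  proof (rule notI, elim bexE imageE, clarify)
    fix i assume i: "i \<in> A" "b i \<in> span (b ` A - {b i})"
    obtain f where f: "Vector_Spaces.linear scale (*) f" "f (b i) \<noteq> 0" "\<forall>j\<in>A. j \<noteq> i \<longrightarrow> f (b j) = 0"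
      using assms[OF i(1)] by blast
    interpret f: Vector_Spaces.linear scale "(*)" f by (rule f(1))
    from i(2) have "f (b i) = 0"
    proof (induction rule: span_induct)
      case base
      show ?case by (auto simp: subspace_def f.add f.scale f.zero)
    next
      case (step x)
      then show ?case using f(3) by auto
    qed
    with f(2) show False by simp
  qed
qed

interpretation free11_tensor: nonassoc_algebra "coeff_scale (free11_scale :: 'k::field \<Rightarrow> _)"
  "tensor_mul free11_scale free11_mul"
  by (rule free11.nonassoc_algebra_tensor)

lemma grassmann11_subalgebra: "free11_tensor.subalgebra grassmann11"
  unfolding grassmann11_def by (rule free11_tensor.generated_subalgebra)

lemma tensor_mul_single:
  "tensor_mul free11_scale free11_mul (single S a) (single T b) =
    (if S |\<inter>| T = {||} then single (S |\<union>| T) (free11_scale ((- 1) ^ inversions S T) (free11_mul a b))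
     else 0)"
  using free11.tensor_mul_tensor[of a "single S 1" b "single T 1"]
  by (simp add: free11.tensor_single gmul_single')

text \<open>For a product word the set S is cut into disjoint pieces whose sizes are the degrees of
  the two factors. Multiplying the two elements so obtained yields the desired one up to a sign,
  which is its own inverse.\<close>

lemma grassmann11_word:
  "fcard S = mdeg t \<Longrightarrow> single S (abs_free11 (single t (1 :: 'k::field_char_0))) \<in> grassmann11"
proof (induction t arbitrary: S)
  case Gen
  then have "card (fset S) = 1" by (simp add: fcard.rep_eq)
  then obtain i where "fset S = {i}" by (rule card_1_singletonE)
  then have "S = {|i|}" by (metis bot_fset.rep_eq finsert.rep_eq fset_inject)
  then have "single S (abs_free11 (single Gen (1 :: 'k))) = free11_tensor free11_gen (ggen i)"
    by (simp add: free11_tensor_def ggen_def free11.tensor_single free11_gen.abs_eq)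
  then show ?case
    unfolding grassmann11_def free11_tensor.generated_subalgebra_def
    by (simp add: hull_inc)
next
  case (Prod s t)
  have "mdeg s \<le> card (fset S)" using Prod.prems by (simp add: fcard.rep_eq)
  then obtain U where U: "U \<subseteq> fset S" "card U = mdeg s" "finite U"
    by (rule obtain_subset_with_card_n)
  define S1 S2 where "S1 = Abs_fset U" and "S2 = S |-| S1"
  have S1: "fset S1 = U" unfolding S1_def by (rule Abs_fset_inverse) (simp add: U)
  have eq: "S1 |\<union>| S2 = S" and disj: "S1 |\<inter>| S2 = {||}"
    using U(1) S1 unfolding S2_def by (auto simp flip: fset_inject)
  have card: "fcard S1 = mdeg s" "fcard S2 = mdeg t"
    using Prod.prems U S1 by (simp_all add: fcard.rep_eq S2_def card_Diff_subset)
  let ?a = "abs_free11 (single s (1 :: 'k))" and ?b = "abs_free11 (single t (1 :: 'k))"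
  let ?c = "(- 1 :: 'k) ^ inversions S1 S2"
  have "tensor_mul free11_scale free11_mul (single S1 ?a) (single S2 ?b) \<in> grassmann11"
    using Prod.IH card grassmann11_subalgebra unfolding free11_tensor.subalgebra_def by blast
  then have "coeff_scale free11_scale ?c (single S (free11_scale ?c (free11_mul ?a ?b))) \<in> grassmann11"
    using grassmann11_subalgebra unfolding free11_tensor.subalgebra_def
    by (auto simp: tensor_mul_single disj eq intro: free11.T.subspace_scale)
  moreover have "?c * ?c = 1" by (simp flip: power_mult_distrib)
  ultimately have "single S (free11_mul ?a ?b) \<in> grassmann11"
    by (simp add: coeff_scale_single)
  then show ?case by (simp add: freena_mul_single flip: abs_free11.hom_mul)
qed

lemma grassmann11_graded:
  assumes "a \<in> free11_graded (fcard S)"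
  shows "single S a \<in> (grassmann11 :: (nat fset \<Rightarrow>\<^sub>0 'k::field_char_0 free11) set)"
proof -
  obtain f where f: "a = abs_free11 f" "\<forall>t\<in>keys f. mdeg t = fcard S"
    using assms by (auto simp: free11_graded_def)
  have add: "additive (single S :: 'k free11 \<Rightarrow> _)" by unfold_locales (rule single_add)
  have "single S a = (\<Sum>t\<in>keys f. coeff_scale free11_scale (lookup f t) (single S (abs_free11 (single t 1))))"
    unfolding f(1) abs_free11_eq_sum[of f] by (simp add: additive.sum[OF add] coeff_scale_single)
  also have "\<dots> \<in> grassmann11"
    using f(2) grassmann11_subalgebra unfolding free11_tensor.subalgebra_def
    by (intro free11.T.subspace_sum free11.T.subspace_scale grassmann11_word) auto
  finally show ?thesis .
qed

text \<open>The elements with coefficient of degree |S| at every S form a subalgebra containing the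
  generators. Together with \<open>grassmann11_graded\<close> this describes
  \<open>grassmann11\<close> completely and reduces the base to the homogeneous components of the
  free superalgebra.\<close>

lemma grassmann11_coeff_graded:
  assumes "u \<in> (grassmann11 :: (nat fset \<Rightarrow>\<^sub>0 'k::field_char_0 free11) set)"
  shows "lookup u S \<in> free11_graded (fcard S)"
proof -
  let ?V = "{u :: nat fset \<Rightarrow>\<^sub>0 'k free11. \<forall>S. lookup u S \<in> free11_graded (fcard S)}"
  note [simp] = free11.subspace_0[OF free11_graded_subspace]
  have sub: "free11.T.subspace ?V"
    by (auto simp: free11.T.subspace_def lookup_add coeff_scale_def lookup_map_zero
        intro: free11.subspace_add free11.subspace_scale free11_graded_subspace)
  have single: "single S a \<in> ?V" if "a \<in> free11_graded (fcard S)" for S a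
    using that by (auto simp: lookup_single when_def)
  have "tensor_mul free11_scale free11_mul u v \<in> ?V" if "u \<in> ?V" "v \<in> ?V" for u v
  proof -
    have "tensor free11_scale (free11_mul (lookup u S) (lookup v T)) (gword_mul S T) \<in> ?V" for S T
    proof (cases "S |\<inter>| T = {||}")
      case True
      then have "fset S \<inter> fset T = {}" by (metis bot_fset.rep_eq inf_fset.rep_eq)
      then have "fcard (S |\<union>| T) = fcard S + fcard T" by (simp add: fcard.rep_eq card_Un_disjoint)
      then have "free11_scale c (free11_mul (lookup u S) (lookup v T)) \<in> free11_graded (fcard (S |\<union>| T))" for c
        using that by (intro free11.subspace_scale free11_graded_subspace free11_graded_mul) auto
      then show ?thesis
        unfolding gword_mul_def using True by (simp only: if_True simp_thms free11.tensor_single single)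
    qed (simp add: gword_mul_def)
    then show ?thesis
      unfolding tensor_mul_def bilin_ext_def by (intro free11.T.subspace_sum[OF sub])
  qed
  with sub have "free11_tensor.subalgebra ?V" unfolding free11_tensor.subalgebra_def by blast
  moreover have "free11_tensor free11_gen (ggen i) \<in> ?V" for i
    unfolding free11_tensor_def ggen_def free11.tensor_single free11.scale_one
    by (rule single) (simp add: fcard.rep_eq free11_gen_graded[unfolded One_nat_def])
  ultimately have "grassmann11 \<subseteq> ?V"
    unfolding grassmann11_def free11_tensor.generated_subalgebra_def by (intro hull_minimal) auto
  then show ?thesis using assms by blast
qed

theorem corollary3p9:
  "vector_space.basis_family
     (coeff_scale (free11_scale :: 'k::field_char_0 \<Rightarrow> 'k free11 \<Rightarrow> 'k free11))
     (\<lambda>(I, \<epsilon>, js). free11_tensor (base_monomial I \<epsilon>) (gprod_list (map ggen js)))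
     {(I, \<epsilon>, js). \<epsilon> \<in> {0, 1} \<and> \<epsilon> + index_norm I > 0 \<and> sorted_wrt (<) js \<and>
        length js = free11_degree (base_monomial I \<epsilon> :: 'k free11)}
     (grassmann11 :: (nat fset \<Rightarrow>\<^sub>0 'k free11) set)"
proof -
  define b where "b = (\<lambda>(I, \<epsilon>, js).
    free11_tensor (base_monomial I \<epsilon> :: 'k free11) (gprod_list (map ggen js)))"
  define A where "A = {(I, \<epsilon>, js :: nat list). \<epsilon> \<in> {0, 1} \<and> \<epsilon> + index_norm I > 0 \<and> sorted_wrt (<) js \<and>
        length js = free11_degree (base_monomial I \<epsilon> :: 'k free11)}"
  have b: "b (I, \<epsilon>, js) = single (fset_of_list js) (base_monomial I \<epsilon>)" if "sorted_wrt (<) js" for I \<epsilon> js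
    using that by (simp add: b_def free11_tensor_def gprod_list_ggen free11.tensor_single)
  have card: "fcard (fset_of_list js) = length js" if "sorted_wrt (<) js" for js :: "nat list"
    using that by (simp add: fcard.rep_eq fset_of_list.rep_eq distinct_card strict_sorted_iff)
  have A: "(I, \<epsilon>, js) \<in> A \<longleftrightarrow> \<epsilon> \<in> {0, 1} \<and> \<epsilon> + index_norm I > 0 \<and> sorted_wrt (<) js \<and>
      length js = 2 * weight I + \<epsilon>" for I \<epsilon> js
    by (auto simp: A_def free11_degree_base_monomial)
  have dual: "\<exists>f. Vector_Spaces.linear (coeff_scale free11_scale) (*) f \<and> f (b i) \<noteq> 0 \<and>
      (\<forall>j\<in>A. j \<noteq> i \<longrightarrow> f (b j) = 0)" if i: "i \<in> A" for i :: "(nat \<Rightarrow>\<^sub>0 nat) \<times> nat \<times> nat list"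
  proof -
    obtain I \<epsilon> js where Ijs: "i = (I, \<epsilon>, js)" by (cases i)
    \<comment> \<open>Different increasing lists give different words, so passing to the coefficient
      at the word of \<open>js\<close> separates the lists; \<open>base_coeff\<close> then separates
      the base monomials that share this word.\<close>
    let ?f = "\<lambda>u. base_coeff I \<epsilon> (lookup u (fset_of_list js)) :: 'k"
    interpret L: Vector_Spaces.linear free11_scale "(*)" "base_coeff I \<epsilon> :: 'k free11 \<Rightarrow> 'k"
      by (rule linear_base_coeff)
    have "Vector_Spaces.linear (coeff_scale free11_scale) (*) ?f"
      by unfold_locales
        (simp_all add: lookup_add L.add L.scale coeff_scale_def lookup_map_zero algebra_simps)
    moreover have "?f (b i) \<noteq> 0"
      using i base_coeff_base_monomial[of \<epsilon> \<epsilon> I I, where 'k = 'k] unfolding Ijs A by (simp add: b)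
    moreover have "?f (b j) = 0" if "j \<in> A" "j \<noteq> i" for j
    proof -
      obtain I' \<epsilon>' js' where j: "j = (I', \<epsilon>', js')" by (cases j)
      show ?thesis
      proof (cases "js' = js")
        case True
        have "\<not> (I' = I \<and> \<epsilon>' = \<epsilon>)" using that(2) True unfolding Ijs j by simp
        moreover have "\<epsilon> \<in> {0, 1}" "\<epsilon>' \<in> {0, 1}" "\<epsilon>' + index_norm I' > 0" and "sorted_wrt (<) js"
          using i that(1) unfolding Ijs j A by auto
        ultimately have "base_coeff I \<epsilon> (base_monomial I' \<epsilon>' :: 'k free11) = 0"
          using base_coeff_base_monomial[of \<epsilon> \<epsilon>' I' I, where 'k = 'k] by blast
        then show ?thesis
          unfolding j True using \<open>sorted_wrt (<) js\<close> by (simp add: b)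
      next
        case False
        then have "fset_of_list js' \<noteq> fset_of_list js"
          using i that(1) unfolding Ijs j A by (metis fset_of_list.rep_eq strict_sorted_equal)
        then show ?thesis
          using that(1) unfolding j A by (simp add: b lookup_single when_def L.zero)
      qed
    qed
    ultimately show ?thesis by blast
  qed
  have "free11.T.span (b ` A) = grassmann11"
  proof (intro equalityI free11.T.span_minimal subsetI)
    show "free11.T.subspace (grassmann11 :: (nat fset \<Rightarrow>\<^sub>0 'k free11) set)"
      using grassmann11_subalgebra unfolding free11_tensor.subalgebra_def by blast
    fix u assume "u \<in> b ` A"
    then obtain I \<epsilon> js where u: "u = b (I, \<epsilon>, js)" "(I, \<epsilon>, js) \<in> A" by auto
    then show "u \<in> grassmann11"
      using base_monomial_graded[of \<epsilon> I] unfolding A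
      by (auto simp: b card intro!: grassmann11_graded)
  next
    fix u :: "nat fset \<Rightarrow>\<^sub>0 'k free11" assume u: "u \<in> grassmann11"
    have "single S a \<in> free11.T.span (b ` A)" if "a \<in> free11_graded (fcard S)" for S a
    proof -
      define js where "js = sorted_list_of_set (fset S)"
      have js: "sorted_wrt (<) js" "fset_of_list js = S"
        by (simp_all add: js_def fset_inject[symmetric] fset_of_list.rep_eq)
      from that free11_graded_span have "a \<in> free11.span {base_monomial I \<epsilon> | I \<epsilon>.
          \<epsilon> \<in> {0, 1} \<and> \<epsilon> + index_norm I > 0 \<and> 2 * weight I + \<epsilon> = fcard S}" by blast
      then show ?thesis
      proof (induction rule: free11.span_induct)
        case base
        show ?case
          unfolding free11.subspace_def
          by (auto simp: single_add coeff_scale_single[symmetric]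
              intro: free11.T.span_zero free11.T.span_add free11.T.span_scale)
      next
        case (step a)
        then obtain I \<epsilon> where a: "a = base_monomial I \<epsilon>" "\<epsilon> \<in> {0, 1}" "\<epsilon> + index_norm I > 0"
          "2 * weight I + \<epsilon> = fcard S" by auto
        have "(I, \<epsilon>, js) \<in> A" using a js card[OF js(1)] unfolding A by simp
        moreover have "single S a = b (I, \<epsilon>, js)" using a js b by simp
        ultimately show ?case by (auto intro: free11.T.span_base)
      qed
    qed
    then have "(\<Sum>S\<in>keys u. single S (lookup u S)) \<in> free11.T.span (b ` A)"
      using grassmann11_coeff_graded[OF u] by (intro free11.T.span_sum) blast
    then show "u \<in> free11.T.span (b ` A)" by (simp add: poly_mapping_sum_single)
  qed
  then show ?thesis
    unfolding free11.T.basis_family_def b_def[symmetric] A_def[symmetric]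
    using free11.T.independent_familyI[of A b, OF dual] by blast
qed

end
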